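(* Let $\mathcal{D}\subseteq\mathcal{B}$ be a unital inclusion of von Neumann algebras with a normal conditional expectation $E:\mathcal{B}\to\mathcal{D}$ whose GNS representation is faithful. Suppose there is a normal, faithful, tracial state $\tau_{\mathcal{D}}$ on $\mathcal{D}$ such that $\tau_{\mathcal{D}}\circ E$ is a trace on $\mathcal{B}$. Let $(\mathcal{M},F)=( *_{\mathcal{D}})_1^\infty(\mathcal{B},E)$ be the von Neumann algebra free product with amalgamation over $\mathcal{D}$ of countably infinitely many copies of $(\mathcal{B},E)$. Then the center $Z(\mathcal{M})$ of $\mathcal{M}$ lies in $\mathcal{D}$. In particular, $$Z(\mathcal{M})=\mathcal{D}\cap Z(\mathcal{B}).$$
   Context: $Z(\cdot)$ denotes the center. The GNS representation of $E$ is the action of $\mathcal{B}$ by left multiplication on the Hilbert $\mathcal{D}$-module $L^2(\mathcal{B},E)$; it is faithful iff the only $x\in\mathcal{B}$ with $E(y^*x^*xy)=0$ for all $y\in\mathcal{B}$ is $x=0$. The amalgamated free product $(\mathcal{M},F)=( *_{\mathcal{D}})_1^\infty(\mathcal{B},E)$ consists of a von Neumann algebra $\mathcal{M}$ generated by copies $\mathcal{B}_i$ ($i\ge1$) of $\mathcal{B}$, all containing the common unital subalgebra $\mathcal{D}$, and a normal conditional expectation $F:\mathcal{M}\to\mathcal{D}$ with faithful GNS representation, restricting on $\mathcal{B}_i$ to the copy $E_i$ of $E$, such that $F(b_1\cdots b_n)=0$ whenever $b_j\in\mathcal{B}_{i(j)}\cap\ker E_{i(j)}$ and $i(j)\ne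 i(j+1)$ for all $j$. *)

theory Defs
  imports "HOL-Analysis.Analysis"
begin

section \<open>Complex Hilbert spaces and bounded operators\<close>

text \<open>The inner product is linear in its second argument. The real scalar multiplication and the
  norm are those inherited from \<^class>\<open>banach\<close>; the two compatibility axioms tie them to the
  complex structure. In particular \<open>cinner x x\<close> is real and nonnegative, and zero only for \<open>x = 0\<close>.\<close>

class chilbert_space = banach +
  fixes scaleC :: "complex \<Rightarrow> 'a \<Rightarrow> 'a"  (infixr \<open>*\<^sub>C\<close> 75)
    and cinner :: "'a \<Rightarrow> 'a \<Rightarrow> complex"
  assumes scaleC_add_right: "c *\<^sub>C (x + y) = c *\<^sub>C x + c *\<^sub>C y"
    and scaleC_add_left: "(c + d) *\<^sub>C x = c *\<^sub>C x + d *\<^sub>C x"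
    and scaleC_scaleC: "c *\<^sub>C d *\<^sub>C x = (c * d) *\<^sub>C x"
    and scaleC_of_real: "complex_of_real r *\<^sub>C x = r *\<^sub>R x"
    and cinner_commute: "cinner x y = cnj (cinner y x)"
    and cinner_add_right: "cinner x (y + z) = cinner x y + cinner x z"
    and cinner_scaleC_right: "cinner x (c *\<^sub>C y) = c * cinner x y"
    and cinner_self: "cinner x x = complex_of_real ((norm x)\<^sup>2)"

typedef (overloaded) 'h bop =
  "{T :: 'h::chilbert_space \<Rightarrow> 'h. bounded_linear T \<and> (\<forall>c x. T (c *\<^sub>C x) = c *\<^sub>C T x)}"
  morphisms apply_bop Bop
proof
  show "(\<lambda>x. 0) \<in> {T :: 'h \<Rightarrow> 'h. bounded_linear T \<and> (\<forall>c x. T (c *\<^sub>C x) = c *\<^sub>C T x)}"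
    using scaleC_add_right[of _ "0 :: 'h" 0] by auto
qed

setup_lifting type_definition_bop

lemma scaleC_zero_right: "c *\<^sub>C (0 :: 'h::chilbert_space) = 0"
  using scaleC_add_right[of c "0 :: 'h" 0] by simp

lemma scaleC_minus_right: "c *\<^sub>C (- x) = - (c *\<^sub>C (x :: 'h::chilbert_space))"
  by (metis add.right_inverse minus_unique scaleC_add_right scaleC_zero_right)

lemma scaleC_diff_right: "c *\<^sub>C (x - y) = c *\<^sub>C x - c *\<^sub>C (y :: 'h::chilbert_space)"
  using scaleC_add_right[of c x "- y"] by (simp add: scaleC_minus_right)

lemma bounded_linear_scaleC: "bounded_linear (\<lambda>x :: 'h::chilbert_space. c *\<^sub>C x)"
proof (rule bounded_linear_intro[where K = "cmod c"])
  fix x y :: 'h and r :: real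
  show "c *\<^sub>C (x + y) = c *\<^sub>C x + c *\<^sub>C y" by (rule scaleC_add_right)
  show "c *\<^sub>C r *\<^sub>R x = r *\<^sub>R c *\<^sub>C x"
    by (simp add: scaleC_scaleC mult.commute flip: scaleC_of_real)
  have "cinner (c *\<^sub>C x) (c *\<^sub>C x) = c * cnj c * cinner x x"
    by (metis cinner_commute cinner_scaleC_right complex_cnj_cnj complex_cnj_mult mult.assoc)
  then have "complex_of_real ((norm (c *\<^sub>C x))\<^sup>2) = complex_of_real ((norm x * cmod c)\<^sup>2)"
    by (simp only: cinner_self complex_norm_square of_real_mult power_mult_distrib mult_ac of_real_power)
       (simp add: complex_norm_square mult_ac flip: of_real_power)
  then have "(norm (c *\<^sub>C x))\<^sup>2 = (norm x * cmod c)\<^sup>2"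
    by (simp only: of_real_eq_iff)
  then show "norm (c *\<^sub>C x) \<le> norm x * cmod c"
    by (simp add: power2_eq_iff_nonneg)
qed

instantiation bop :: (chilbert_space) "{ring, monoid_mult}"
begin

lift_definition zero_bop :: "'a bop" is "\<lambda>x. 0"
  by (auto simp: scaleC_zero_right)

lift_definition one_bop :: "'a bop" is "\<lambda>x. x"
  by (auto simp: bounded_linear_ident)

lift_definition plus_bop :: "'a bop \<Rightarrow> 'a bop \<Rightarrow> 'a bop" is "\<lambda>S T x. S x + T x"
  by (auto simp: bounded_linear_add scaleC_add_right)

lift_definition minus_bop :: "'a bop \<Rightarrow> 'a bop \<Rightarrow> 'a bop" is "\<lambda>S T x. S x - T x"
  by (auto simp: bounded_linear_sub scaleC_diff_right)

lift_definition uminus_bop :: "'a bop \<Rightarrow> 'a bop" is "\<lambda>T x. - T x"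
  by (auto simp: bounded_linear_minus scaleC_minus_right)

lift_definition times_bop :: "'a bop \<Rightarrow> 'a bop \<Rightarrow> 'a bop" is "\<lambda>S T x. S (T x)"
  by (auto simp: bounded_linear_compose)

instance
proof
  fix a b c :: "'a bop"
  show "a * (b + c) = a * b + a * c"
    by transfer (auto simp: linear_simps)
qed (transfer; auto simp: algebra_simps fun_eq_iff)+

end

lift_definition scaleC_bop :: "complex \<Rightarrow> 'h::chilbert_space bop \<Rightarrow> 'h bop" is "\<lambda>c T x. c *\<^sub>C T x"
  by (auto simp: scaleC_scaleC mult.commute intro: bounded_linear_compose[OF bounded_linear_scaleC])

text \<open>The adjoint exists and is unique by the Riesz representation theorem.\<close>

definition adj :: "'h::chilbert_space bop \<Rightarrow> 'h bop"  (\<open>_\<^sup>\<dagger>\<close> [1000] 999) where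
  "T\<^sup>\<dagger> = (THE S. \<forall>x y. cinner (apply_bop S x) y = cinner x (apply_bop T y))"

definition positive_bop :: "'h::chilbert_space bop \<Rightarrow> bool" where
  "positive_bop T \<longleftrightarrow> (\<forall>x. cinner x (apply_bop T x) \<in> \<real>\<^sub>\<ge>\<^sub>0)"

section \<open>Von Neumann algebras\<close>

definition commutant :: "'h::chilbert_space bop set \<Rightarrow> 'h bop set" where
  "commutant S = {T. \<forall>s\<in>S. T * s = s * T}"

definition von_neumann_algebra :: "'h::chilbert_space bop set \<Rightarrow> bool" where
  "von_neumann_algebra M \<longleftrightarrow> (\<forall>x\<in>M. x\<^sup>\<dagger> \<in> M) \<and> commutant (commutant M) = M"

definition center :: "'h::chilbert_space bop set \<Rightarrow> 'h bop set" where
  "center M = M \<inter> commutant M"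

text \<open>The ultraweak topology on the algebra of all bounded operators is the coarsest one for which
  all functionals \<open>T \<mapsto> \<Sum>n. \<langle>\<xi> n, T (\<eta> n)\<rangle>\<close> with square-summable \<open>\<xi>\<close>, \<open>\<eta>\<close> are continuous.\<close>

definition ultraweak_functional ::
    "(nat \<Rightarrow> 'h::chilbert_space) \<Rightarrow> (nat \<Rightarrow> 'h) \<Rightarrow> 'h bop \<Rightarrow> complex" where
  "ultraweak_functional \<xi> \<eta> T = (\<Sum>n. cinner (\<xi> n) (apply_bop T (\<eta> n)))"

definition ultraweak_topology :: "'h::chilbert_space bop topology" where
  "ultraweak_topology = topology_generated_by
     {ultraweak_functional \<xi> \<eta> -` U | \<xi> \<eta> U.
        summable (\<lambda>n. (norm (\<xi> n))\<^sup>2) \<and> summable (\<lambda>n. (norm (\<eta> n))\<^sup>2) \<and> open U}"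

definition normal_map ::
    "'h::chilbert_space bop set \<Rightarrow> 'k::chilbert_space bop set \<Rightarrow> ('h bop \<Rightarrow> 'k bop) \<Rightarrow> bool" where
  "normal_map M N \<Phi> \<longleftrightarrow>
     continuous_map (subtopology ultraweak_topology M) (subtopology ultraweak_topology N) \<Phi>"

definition normal_functional :: "'h::chilbert_space bop set \<Rightarrow> ('h bop \<Rightarrow> complex) \<Rightarrow> bool" where
  "normal_functional M \<phi> \<longleftrightarrow> continuous_map (subtopology ultraweak_topology M) euclidean \<phi>"

definition state_on :: "'h::chilbert_space bop set \<Rightarrow> ('h bop \<Rightarrow> complex) \<Rightarrow> bool" where
  "state_on M \<phi> \<longleftrightarrow>
     (\<forall>x\<in>M. \<forall>y\<in>M. \<phi> (x + y) = \<phi> x + \<phi> y) \<and>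
     (\<forall>c. \<forall>x\<in>M. \<phi> (scaleC_bop c x) = c * \<phi> x) \<and>
     (\<forall>x\<in>M. positive_bop x \<longrightarrow> \<phi> x \<in> \<real>\<^sub>\<ge>\<^sub>0) \<and>
     \<phi> 1 = 1"

definition faithful_on :: "'h::chilbert_space bop set \<Rightarrow> ('h bop \<Rightarrow> complex) \<Rightarrow> bool" where
  "faithful_on M \<phi> \<longleftrightarrow> (\<forall>x\<in>M. \<phi> (x\<^sup>\<dagger> * x) = 0 \<longrightarrow> x = 0)"

definition tracial_on :: "'h::chilbert_space bop set \<Rightarrow> ('h bop \<Rightarrow> complex) \<Rightarrow> bool" where
  "tracial_on M \<phi> \<longleftrightarrow> (\<forall>x\<in>M. \<forall>y\<in>M. \<phi> (x * y) = \<phi> (y * x))"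

definition conditional_expectation ::
    "'h::chilbert_space bop set \<Rightarrow> 'h bop set \<Rightarrow> ('h bop \<Rightarrow> 'h bop) \<Rightarrow> bool" where
  "conditional_expectation B D E \<longleftrightarrow>
     (\<forall>x\<in>B. E x \<in> D) \<and>
     (\<forall>x\<in>B. \<forall>y\<in>B. E (x + y) = E x + E y) \<and>
     (\<forall>c. \<forall>x\<in>B. E (scaleC_bop c x) = scaleC_bop c (E x)) \<and>
     (\<forall>x\<in>B. positive_bop x \<longrightarrow> positive_bop (E x)) \<and>
     (\<forall>d\<in>D. E d = d) \<and>
     (\<forall>d\<in>D. \<forall>e\<in>D. \<forall>x\<in>B. E (d * x * e) = d * E x * e)"

text \<open>The Hilbert module \<open>L\<^sup>2(B,E)\<close> is the separated completion of \<open>B\<close> for the \<open>D\<close>-valued inner product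
  \<open>\<langle>x, y\<rangle> = E (x\<^sup>\<dagger> y)\<close>. Left multiplication by \<open>x\<close> vanishes on it iff, for all \<open>y\<close> in \<open>B\<close>, the vector \<open>x y\<close>
  is null, that is, \<open>E ((x y)\<^sup>\<dagger> (x y)) = 0\<close>.\<close>

definition faithful_gns :: "'h::chilbert_space bop set \<Rightarrow> ('h bop \<Rightarrow> 'h bop) \<Rightarrow> bool" where
  "faithful_gns B E \<longleftrightarrow> (\<forall>x\<in>B. (\<forall>y\<in>B. E (y\<^sup>\<dagger> * x\<^sup>\<dagger> * x * y) = 0) \<longrightarrow> x = 0)"

definition star_isomorphism ::
    "'h::chilbert_space bop set \<Rightarrow> 'k::chilbert_space bop set \<Rightarrow> ('h bop \<Rightarrow> 'k bop) \<Rightarrow> bool" where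
  "star_isomorphism B N \<pi> \<longleftrightarrow>
     bij_betw \<pi> B N \<and>
     (\<forall>x\<in>B. \<forall>y\<in>B. \<pi> (x + y) = \<pi> x + \<pi> y) \<and>
     (\<forall>c. \<forall>x\<in>B. \<pi> (scaleC_bop c x) = scaleC_bop c (\<pi> x)) \<and>
     (\<forall>x\<in>B. \<forall>y\<in>B. \<pi> (x * y) = \<pi> x * \<pi> y) \<and>
     (\<forall>x\<in>B. \<pi> (x\<^sup>\<dagger>) = (\<pi> x)\<^sup>\<dagger>)"

section \<open>The amalgamated free product of countably infinitely many copies\<close>

text \<open>The copies of \<open>B\<close> are the algebras \<open>\<pi> i ` B\<close>, where \<open>i\<close> ranges over all natural numbers (from 0).
  The maps \<open>\<pi> i\<close> agree on \<open>D\<close>, so that \<open>\<pi> i ` D\<close> is the common subalgebra for every \<open>i\<close>; it is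
  written \<open>\<pi> 0 ` D\<close>. In the last clause, a letter \<open>(i, b)\<close> stands for the element \<open>\<pi> i b\<close> of the \<open>i\<close>-th
  copy, which lies in the kernel of the \<open>i\<close>-th copy of \<open>E\<close> iff \<open>E b = 0\<close>.\<close>

definition amalgamated_free_product ::
    "'h::chilbert_space bop set \<Rightarrow> 'h bop set \<Rightarrow> ('h bop \<Rightarrow> 'h bop) \<Rightarrow>
     (nat \<Rightarrow> 'h bop \<Rightarrow> 'k::chilbert_space bop) \<Rightarrow> 'k bop set \<Rightarrow> ('k bop \<Rightarrow> 'k bop) \<Rightarrow> bool" where
  "amalgamated_free_product B D E \<pi> M F \<longleftrightarrow>
     von_neumann_algebra M \<and>
     (\<forall>i. von_neumann_algebra (\<pi> i ` B) \<and> star_isomorphism B (\<pi> i ` B) (\<pi> i)) \<and>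
     (\<forall>i j. \<forall>d\<in>D. \<pi> i d = \<pi> j d) \<and>
     M = von_neumann_algebra hull (\<Union>i. \<pi> i ` B) \<and>
     conditional_expectation M (\<pi> 0 ` D) F \<and>
     normal_map M (\<pi> 0 ` D) F \<and>
     faithful_gns M F \<and>
     (\<forall>i. \<forall>b\<in>B. F (\<pi> i b) = \<pi> i (E b)) \<and>
     (\<forall>w. w \<noteq> [] \<and> (\<forall>(i, b)\<in>set w. b \<in> B \<and> E b = 0) \<and> distinct_adj (map fst w) \<longrightarrow>
        F (prod_list (map (\<lambda>(i, b). \<pi> i b) w)) = 0)"

end

theory Submission
  imports Defs
begin

text \<open>
  Write \<open>D\<close> also for its copy \<open>\<pi> 0 ` D\<close> in \<open>M\<close>, let \<open>\<phi>\<close> be the state of \<open>M\<close> that is \<open>F\<close> followed by the given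
  trace of \<open>D\<close>, and \<open>\<parallel>x\<parallel>\<^sub>2 = \<phi> (x\<^sup>\<dagger> x)\<^sup>1\<^sup>/\<^sup>2\<close>.

  The reason why the center lies in \<open>D\<close> is that a central element is approximated by elements of finitely
  many copies, and must commute with letters from a fresh copy, with which such elements are free. In
  detail, let \<open>x\<close> be central, \<open>z = x - F x\<close> and \<open>a = F (z\<^sup>\<dagger> z)\<close>. Let \<open>y\<close> be a combination of words in finitely
  many copies that is \<open>\<parallel>\<cdot>\<parallel>\<^sub>2\<close>-close to \<open>x\<close>, and \<open>\<gamma>\<close> a letter with expectation \<open>0\<close> from another copy.
  Then \<open>(y - F y) \<gamma>\<close> is orthogonal to the rest of \<open>y \<gamma> - \<gamma> y\<close>, which is small as \<open>x \<gamma> = \<gamma> x\<close>. In the limit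
  \<open>a \<gamma> = 0\<close> (\<open>central_defect_annihilates_letters\<close>); since \<open>a\<close> is in \<open>D\<close>, this does not depend on the copy.
  So \<open>a\<close> annihilates all nonempty reduced words and therefore the kernel of \<open>F\<close>, whence \<open>a a = F (a z\<^sup>\<dagger> z) = 0\<close> and
  \<open>z = 0\<close> (\<open>center_subset\<close>).

  This requires that \<open>\<phi>\<close> is a faithful trace and that the words are \<open>\<parallel>\<cdot>\<parallel>\<^sub>2\<close>-dense in \<open>M\<close>. On words the trace
  property is a count of letters (\<open>\<phi>_trace_words\<close>); density extends it to \<open>M\<close>, and with it faithfulness of
  the GNS representation of \<open>F\<close> becomes faithfulness of \<open>\<phi>\<close>. Density is the difficult point. Von Neumann's
  bicommutant theorem gives ultraweak density, but \<open>\<phi>\<close> is not visibly ultraweakly continuous: the trace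
  is normal for the Hilbert space of \<open>B\<close>, whereas \<open>F\<close> is normal for that of \<open>M\<close>, and the isomorphism between the
  two copies of \<open>D\<close> is a purely algebraic one.

  What an algebraic isomorphism preserves is the order, because positivity can be expressed through
  invertibility (\<open>positive_iff_invertible\<close>), and with it the limits of bounded increasing sequences. So the
  transported trace respects such limits. This suffices for two measure-theoretic facts about \<open>D\<close>: some
  normal positive functional \<open>\<omega>\<close> is faithful on it (\<open>separating_sequence\<close>), and on positive contractions the
  trace is absolutely continuous with respect to \<open>\<omega>\<close> (\<open>absolute_continuity\<close>, a Borel--Cantelli argument).
  Given \<open>x\<close>, the bicommutant theorem and normality of \<open>\<omega> \<circ> F\<close> yield a combination \<open>y\<close> of words for which
  \<open>h = F ((x - y)\<^sup>\<dagger> (x - y))\<close> is small against \<open>\<omega>\<close>. Compressing \<open>y\<close> by \<open>(1 + h)\<^sup>-\<^sup>1\<close> bounds the error by the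
  contraction \<open>h (1 + h)\<^sup>-\<^sup>1\<close>, to which absolute continuity applies (\<open>selfadjoint_approximation\<close>).
\<close>

section \<open>The geometry of complex Hilbert spaces\<close>

notation apply_bop (infixr \<open>\<rhd>\<close> 75)

lemma cinner_add_left: "cinner (x + y) (z :: 'h::chilbert_space) = cinner x z + cinner y z"
  by (metis cinner_commute cinner_add_right complex_cnj_add)

lemma cinner_scaleC_left: "cinner (c *\<^sub>C x) (y :: 'h::chilbert_space) = cnj c * cinner x y"
  by (metis cinner_commute cinner_scaleC_right complex_cnj_mult)

lemma cinner_zero_right [simp]: "cinner x (0 :: 'h::chilbert_space) = 0"
  using cinner_add_right[of x 0 0] by simp

lemma cinner_zero_left [simp]: "cinner 0 (x :: 'h::chilbert_space) = 0"
  using cinner_add_left[of 0 0 x] by simp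

lemma cinner_minus_right: "cinner x (- y :: 'h::chilbert_space) = - cinner x y"
  using cinner_add_right[of x y "- y"] by (simp add: eq_neg_iff_add_eq_0 add.commute)

lemma cinner_minus_left: "cinner (- x) (y :: 'h::chilbert_space) = - cinner x y"
  using cinner_add_left[of x "- x" y] by (simp add: eq_neg_iff_add_eq_0 add.commute)

lemma cinner_diff_right: "cinner x (y - z :: 'h::chilbert_space) = cinner x y - cinner x z"
  using cinner_add_right[of x y "- z"] by (simp add: cinner_minus_right)

lemma cinner_diff_left: "cinner (x - y) (z :: 'h::chilbert_space) = cinner x z - cinner y z"
  using cinner_add_left[of x "- y" z] by (simp add: cinner_minus_left)

lemma cinner_scaleR_right: "cinner x (r *\<^sub>R y :: 'h::chilbert_space) = of_real r * cinner x y"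
  using cinner_scaleC_right[of x "of_real r" y] by (simp add: scaleC_of_real)

lemma cinner_scaleR_left: "cinner (r *\<^sub>R x) (y :: 'h::chilbert_space) = of_real r * cinner x y"
  using cinner_scaleC_left[of "of_real r" x y] by (simp add: scaleC_of_real)

lemmas cinner_simps = cinner_add_left cinner_add_right cinner_diff_left cinner_diff_right
  cinner_minus_left cinner_minus_right cinner_scaleC_left cinner_scaleC_right
  cinner_scaleR_left cinner_scaleR_right

lemma scaleC_one [simp]: "1 *\<^sub>C x = (x :: 'h::chilbert_space)"
  using scaleC_of_real[of 1 x] by simp

lemma scaleC_minus_one: "(- 1) *\<^sub>C x = - (x :: 'h::chilbert_space)"
  using scaleC_of_real[of "- 1" x] by simp

lemma Re_cinner_self: "Re (cinner x (x :: 'h::chilbert_space)) = (norm x)\<^sup>2"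
  by (simp add: cinner_self)

lemma Re_cinner_commute: "Re (cinner x (y :: 'h::chilbert_space)) = Re (cinner y x)"
  by (metis cinner_commute complex_cnj(1) cnj.simps(1))

lemma norm_add_square:
  "(norm (x + y :: 'h::chilbert_space))\<^sup>2 = (norm x)\<^sup>2 + 2 * Re (cinner x y) + (norm y)\<^sup>2"
  by (simp add: cinner_simps Re_cinner_commute[of y x] flip: Re_cinner_self)

lemma norm_diff_square:
  "(norm (x - y :: 'h::chilbert_space))\<^sup>2 = (norm x)\<^sup>2 - 2 * Re (cinner x y) + (norm y)\<^sup>2"
  by (simp add: cinner_simps Re_cinner_commute[of y x] flip: Re_cinner_self)

lemma norm_scaleC: "norm (c *\<^sub>C x) = cmod c * norm (x :: 'h::chilbert_space)"
proof -
  have "cinner (c *\<^sub>C x) (c *\<^sub>C x) = complex_of_real ((cmod c)\<^sup>2) * cinner x x"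
    by (simp only: cinner_simps complex_norm_square) (simp add: ac_simps)
  then have "complex_of_real ((norm (c *\<^sub>C x))\<^sup>2) = complex_of_real ((cmod c * norm x)\<^sup>2)"
    by (simp only: cinner_self power_mult_distrib of_real_mult)
  then have "(norm (c *\<^sub>C x))\<^sup>2 = (cmod c * norm x)\<^sup>2"
    by (simp only: of_real_eq_iff)
  then show ?thesis by (simp add: power2_eq_iff_nonneg)
qed

text \<open>It is enough to let \<open>l\<close> run over the real multiples of \<open>cnj b\<close>. The inequality is stated for the
  entries \<open>a\<close>, \<open>b\<close>, \<open>c\<close> of a Gram matrix because it is needed for inner products, for the forms of
  positive operators and for states.\<close>

lemma gram_cauchy_schwarz:
  fixes a c :: real and b :: complex
  assumes pos: "\<And>l. 0 \<le> a + 2 * Re (l * b) + (cmod l)\<^sup>2 * c" and c: "0 \<le> c"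
  shows "(cmod b)\<^sup>2 \<le> a * c"
proof -
  have *: "0 \<le> a - 2 * t * (cmod b)\<^sup>2 + t\<^sup>2 * (cmod b)\<^sup>2 * c" for t :: real
  proof -
    have "of_real (- t) * cnj b * b = of_real (- t * (cmod b)\<^sup>2)"
      by (simp only: of_real_mult complex_norm_square) (simp add: ac_simps)
    then have "Re (of_real (- t) * cnj b * b) = - t * (cmod b)\<^sup>2"
      by (metis Re_complex_of_real)
    then show ?thesis
      using pos[of "of_real (- t) * cnj b"] by (simp add: norm_mult power_mult_distrib)
  qed
  show ?thesis
  proof (cases "c = 0")
    case True
    have a: "0 \<le> a" using *[of 0] by simp
    show ?thesis
    proof (rule ccontr)
      assume "\<not> ?thesis"
      then have b: "(cmod b)\<^sup>2 > 0" using True by simp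
      have "0 \<le> a - 2 * ((a + 1) / (cmod b)\<^sup>2) * (cmod b)\<^sup>2"
        using *[of "(a + 1) / (cmod b)\<^sup>2"] True by simp
      also have "\<dots> = a - 2 * (a + 1)" using b by simp
      finally show False using a by simp
    qed
  next
    case False
    then have "c > 0" using c by simp
    have "0 \<le> (a - 2 * (1 / c) * (cmod b)\<^sup>2 + (1 / c)\<^sup>2 * (cmod b)\<^sup>2 * c) * c"
      using *[of "1 / c"] \<open>c > 0\<close> by (intro mult_nonneg_nonneg) auto
    also have "\<dots> = a * c - (cmod b)\<^sup>2"
      using \<open>c > 0\<close> by (simp add: field_simps power2_eq_square)
    finally show ?thesis by simp
  qed
qed

lemma cinner_cauchy_schwarz: "cmod (cinner x (y :: 'h::chilbert_space)) \<le> norm x * norm y"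
proof -
  have "0 \<le> (norm x)\<^sup>2 + 2 * Re (l * cinner x y) + (cmod l)\<^sup>2 * (norm y)\<^sup>2" for l
    using norm_add_square[of x "l *\<^sub>C y"]
    by (simp add: cinner_simps norm_scaleC power_mult_distrib) (metis zero_le_power2)
  then have "(cmod (cinner x y))\<^sup>2 \<le> (norm x)\<^sup>2 * (norm y)\<^sup>2"
    by (rule gram_cauchy_schwarz) auto
  then show ?thesis
    by (metis (no_types) mult_nonneg_nonneg norm_ge_zero power2_le_imp_le power_mult_distrib)
qed

lemma bounded_bilinear_cinner: "bounded_bilinear (cinner :: 'h::chilbert_space \<Rightarrow> 'h \<Rightarrow> complex)"
proof
  show "\<exists>K. \<forall>a b. norm (cinner a b :: complex) \<le> norm (a :: 'h) * norm b * K"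
    using cinner_cauchy_schwarz by (intro exI[of _ 1]) auto
qed (simp_all add: cinner_simps scaleR_conv_of_real)

lemmas tendsto_cinner = bounded_bilinear.tendsto[OF bounded_bilinear_cinner]

lemma cinner_eq_zeroI: "x = 0" if "\<And>y. cinner y x = 0" for x :: "'h::chilbert_space"
  using that[of x] by (simp add: cinner_self)

lemma cinner_extI: "x = y" if "\<And>z. cinner z x = cinner z y" for x :: "'h::chilbert_space"
  using cinner_eq_zeroI[of "x - y"] that by (simp add: cinner_simps)

text \<open>The parallelogram law makes every minimizing sequence Cauchy. Real subspaces are allowed because
  one application concerns the self-adjoint part of an algebra; for complex subspaces, multiplying
  by \<open>\<i>\<close> turns orthogonality for the real inner product into orthogonality.\<close>

lemma real_orthogonal_projection:
  fixes S :: "'h::chilbert_space set"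
  assumes S: "subspace S" and cl: "closed S"
  obtains p where "p \<in> S" "\<And>s. s \<in> S \<Longrightarrow> Re (cinner s (x - p)) = 0"
proof -
  define d where "d = (INF s\<in>S. (norm (x - s))\<^sup>2)"
  have S0: "0 \<in> S" using S by (simp add: subspace_0)
  have bdd: "bdd_below ((\<lambda>s. (norm (x - s))\<^sup>2) ` S)" by (rule bdd_belowI[of _ 0]) auto
  have d_le: "d \<le> (norm (x - s))\<^sup>2" if "s \<in> S" for s
    unfolding d_def by (rule cINF_lower[OF bdd that])
  have "\<exists>s\<in>S. (norm (x - s))\<^sup>2 < d + 1 / real (Suc n)" for n
    using cINF_less_iff[OF _ bdd, of "d + 1 / real (Suc n)"] S0 unfolding d_def by fastforce
  then obtain s where s: "\<And>n. s n \<in> S" "\<And>n. (norm (x - s n))\<^sup>2 < d + 1 / real (Suc n)"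
    by metis
  have par: "(norm (s n - s m))\<^sup>2 \<le> 2 / real (Suc n) + 2 / real (Suc m)" for n m
  proof -
    have "(1/2) *\<^sub>R (s n + s m) \<in> S" using S s by (simp add: subspace_add subspace_scale)
    then have "d \<le> (norm (x - (1/2) *\<^sub>R (s n + s m)))\<^sup>2" by (rule d_le)
    also have "x - (1/2) *\<^sub>R (s n + s m) = (1/2) *\<^sub>R ((x - s n) + (x - s m))"
      by (simp add: algebra_simps flip: scaleR_add_left)
    finally have "4 * d \<le> (norm ((x - s n) + (x - s m)))\<^sup>2"
      by (simp add: power_mult_distrib power2_eq_square)
    moreover have "(norm (u - v))\<^sup>2 = 2 * (norm u)\<^sup>2 + 2 * (norm v)\<^sup>2 - (norm (u + v))\<^sup>2"
      for u v :: 'h by (simp add: norm_add_square norm_diff_square)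
    from this[of "x - s m" "x - s n"]
    have "(norm (s n - s m))\<^sup>2 = 2 * (norm (x - s n))\<^sup>2 + 2 * (norm (x - s m))\<^sup>2
        - (norm ((x - s n) + (x - s m)))\<^sup>2"
      by (simp add: add.commute norm_minus_commute)
    ultimately show ?thesis using s(2)[of n] s(2)[of m] by simp
  qed
  have "Cauchy s"
  proof (rule CauchyI)
    fix e :: real assume "e > 0"
    then obtain M where M: "inverse (real (Suc M)) < e\<^sup>2 / 4"
      using reals_Archimedean[of "e\<^sup>2 / 4"] by auto
    have "norm (s m - s n) < e" if "m \<ge> M" "n \<ge> M" for m n
    proof -
      have "2 / real (Suc m) \<le> 2 / real (Suc M)" "2 / real (Suc n) \<le> 2 / real (Suc M)"
        using that by (auto intro: divide_left_mono)
      then have "(norm (s m - s n))\<^sup>2 \<le> 2 / real (Suc M) + 2 / real (Suc M)"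
        using par[of m n] by linarith
      also have "\<dots> = 4 * inverse (real (Suc M))" by (simp add: divide_inverse)
      also have "\<dots> < e\<^sup>2" using M by simp
      finally show ?thesis using \<open>e > 0\<close> by (simp add: power_less_imp_less_base)
    qed
    then show "\<exists>M. \<forall>m\<ge>M. \<forall>n\<ge>M. norm (s m - s n) < e" by blast
  qed
  then obtain p where p: "s \<longlonglongrightarrow> p" using Cauchy_convergent_iff convergent_def by blast
  have pS: "p \<in> S" using cl p s(1) closed_sequentially by blast
  have "(\<lambda>n. (norm (x - s n))\<^sup>2) \<longlonglongrightarrow> (norm (x - p))\<^sup>2" by (intro tendsto_intros p)
  moreover have "(\<lambda>n. d + 1 / real (Suc n)) \<longlonglongrightarrow> d + 0"
    by (intro tendsto_intros LIMSEQ_Suc[OF lim_1_over_n])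
  ultimately have pd: "(norm (x - p))\<^sup>2 \<le> d"
    using s(2) by (intro LIMSEQ_le[of _ _ _ "d"]) (auto intro: less_imp_le)
  have "Re (cinner r (x - p)) = 0" if "r \<in> S" for r
  proof -
    have "2 * t * Re (cinner r (x - p)) \<le> t\<^sup>2 * (norm r)\<^sup>2" for t :: real
    proof -
      have "p + t *\<^sub>R r \<in> S" using pS that S by (simp add: subspace_add subspace_scale)
      then have "(norm (x - p))\<^sup>2 \<le> (norm ((x - p) - t *\<^sub>R r))\<^sup>2"
        using order_trans[OF pd d_le] by (simp only: diff_diff_eq)
      then have "(norm (x - p))\<^sup>2 \<le> (norm (x - p))\<^sup>2 - 2 * Re (cinner (x - p) (t *\<^sub>R r)) + (norm (t *\<^sub>R r))\<^sup>2"
        by (simp only: norm_diff_square[of "x - p" "t *\<^sub>R r"])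
      then show ?thesis
        by (simp add: cinner_scaleR_right power_mult_distrib Re_cinner_commute[of "x - p" r])
    qed note * = this
    have "(cmod (of_real (Re (cinner r (x - p)))))\<^sup>2 \<le> 0 * (norm r)\<^sup>2"
    proof (rule gram_cauchy_schwarz)
      fix l :: complex
      have "- 2 * Re l * Re (cinner r (x - p)) \<le> (Re l)\<^sup>2 * (norm r)\<^sup>2"
        using *[of "- Re l"] by simp
      also have "\<dots> \<le> (cmod l)\<^sup>2 * (norm r)\<^sup>2"
        by (rule mult_right_mono) (auto simp: cmod_power2)
      finally show "0 \<le> 0 + 2 * Re (l * complex_of_real (Re (cinner r (x - p))))
          + (cmod l)\<^sup>2 * (norm r)\<^sup>2" by simp
    qed simp
    then show ?thesis by simp
  qed
  with pS show ?thesis using that by blast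
qed

lemma complex_subspace_real:
  fixes S :: "'h::chilbert_space set"
  assumes "0 \<in> S" "\<And>x y. x \<in> S \<Longrightarrow> y \<in> S \<Longrightarrow> x + y \<in> S" "\<And>c x. x \<in> S \<Longrightarrow> c *\<^sub>C x \<in> S"
  shows "subspace S"
  using assms by (auto simp: subspace_def simp flip: scaleC_of_real)

lemma orthogonal_projection:
  fixes S :: "'h::chilbert_space set"
  assumes "0 \<in> S" "\<And>x y. x \<in> S \<Longrightarrow> y \<in> S \<Longrightarrow> x + y \<in> S" and sc: "\<And>c x. x \<in> S \<Longrightarrow> c *\<^sub>C x \<in> S"
    and "closed S"
  obtains p where "p \<in> S" "\<And>s. s \<in> S \<Longrightarrow> cinner s (x - p) = 0"
proof -
  have "subspace S" using assms(1-3) by (rule complex_subspace_real)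
  then obtain p where p: "p \<in> S" "\<And>s. s \<in> S \<Longrightarrow> Re (cinner s (x - p)) = 0"
    using real_orthogonal_projection \<open>closed S\<close> by blast
  have "cinner s (x - p) = 0" if "s \<in> S" for s
    using p(2)[OF that] p(2)[OF sc[OF that, of \<i>]]
    by (auto simp: cinner_scaleC_left complex_eq_iff)
  with p(1) show ?thesis using that by blast
qed

text \<open>The kernel has a vector \<open>z\<close> orthogonal to it, and every \<open>x\<close> differs from a multiple of \<open>z\<close> by an
  element of the kernel.\<close>

lemma riesz_representation:
  fixes f :: "'h::chilbert_space \<Rightarrow> complex"
  assumes bl: "bounded_linear f" and sc: "\<And>c x. f (c *\<^sub>C x) = c * f x"
  obtains y where "\<And>x. f x = cinner y x"
proof (cases "\<forall>x. f x = 0")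
  case True
  then show ?thesis using that[of 0] by simp
next
  case False
  then obtain x0 where x0: "f x0 \<noteq> 0" by blast
  interpret bounded_linear f by (rule bl)
  define S where "S = {x. f x = 0}"
  have "closed S" unfolding S_def
    by (intro closed_Collect_eq continuous_intros continuous_on)
  then obtain p where p: "p \<in> S" "\<And>s. s \<in> S \<Longrightarrow> cinner s (x0 - p) = 0"
    using orthogonal_projection[of S x0] by (auto simp: S_def zero add sc)
  define z where "z = x0 - p"
  have fz: "f z = f x0" using p(1) by (simp add: z_def S_def diff)
  then have "z \<noteq> 0" using x0 zero by auto
  have "f x = cinner ((cnj (f z) / (norm z)\<^sup>2) *\<^sub>C z) x" for x
  proof -
    have "x - (f x / f z) *\<^sub>C z \<in> S"
      using x0 by (simp add: S_def diff sc fz)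
    then have "cinner (x - (f x / f z) *\<^sub>C z) z = 0" using p(2) z_def by blast
    then have "cinner z (x - (f x / f z) *\<^sub>C z) = 0"
      by (metis cinner_commute complex_cnj_zero)
    then have "cinner z x = f x / f z * (norm z)\<^sup>2"
      by (simp add: cinner_simps cinner_self)
    then show ?thesis using x0 \<open>z \<noteq> 0\<close> by (simp add: cinner_simps fz)
  qed
  then show ?thesis using that by blast
qed

section \<open>Bounded operators and their adjoints\<close>

lemma apply_bop_simps [simp]:
  "0 \<rhd> x = 0" "1 \<rhd> x = x" "(S + T) \<rhd> x = S \<rhd> x + T \<rhd> x" "(S - T) \<rhd> x = S \<rhd> x - T \<rhd> x"
  "(- T) \<rhd> x = - (T \<rhd> x)" "(S * T) \<rhd> x = S \<rhd> T \<rhd> x" "scaleC_bop c T \<rhd> x = c *\<^sub>C (T \<rhd> x)"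
  by (transfer; simp)+

lemma bop_eqI: "S = T" if "\<And>x. S \<rhd> x = T \<rhd> x"
  using that by (simp add: apply_bop_inject[symmetric] fun_eq_iff)

lemma bounded_linear_apply_bop: "bounded_linear (apply_bop T)"
  using apply_bop[of T] by blast

lemma apply_bop_scaleC: "T \<rhd> c *\<^sub>C x = c *\<^sub>C (T \<rhd> x)"
  using apply_bop[of T] by blast

lemma apply_bop_add: "T \<rhd> (x + y) = T \<rhd> x + T \<rhd> y"
  and apply_bop_diff: "T \<rhd> (x - y) = T \<rhd> x - T \<rhd> y"
  and apply_bop_minus: "T \<rhd> (- x) = - (T \<rhd> x)"
  and apply_bop_zero [simp]: "T \<rhd> 0 = 0"
  and apply_bop_scaleR: "T \<rhd> (r *\<^sub>R x) = r *\<^sub>R (T \<rhd> x)"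
  using bounded_linear_apply_bop[of T]
  by (auto simp: linear_simps)

lemmas tendsto_apply_bop = bounded_linear.tendsto[OF bounded_linear_apply_bop]

lemma apply_Bop: "bounded_linear f \<Longrightarrow> (\<And>c x. f (c *\<^sub>C x) = c *\<^sub>C f x) \<Longrightarrow> apply_bop (Bop f) = f"
  by (rule Bop_inverse) auto

definition bnorm :: "'h::chilbert_space bop \<Rightarrow> real" where
  "bnorm T = onorm (apply_bop T)"

lemma bnorm_bound: "norm (T \<rhd> x) \<le> bnorm T * norm x"
  unfolding bnorm_def by (rule onorm[OF bounded_linear_apply_bop])

lemma bnorm_nonneg: "0 \<le> bnorm T"
  unfolding bnorm_def by (rule onorm_pos_le[OF bounded_linear_apply_bop])

lemma adj_exists: "\<exists>S. \<forall>x y. cinner (S \<rhd> x) y = cinner x (T \<rhd> y)"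
proof -
  have "\<exists>z. \<forall>y. cinner x (T \<rhd> y) = cinner z y" for x
  proof -
    have "bounded_linear (\<lambda>y. cinner x (T \<rhd> y))"
      by (rule bounded_linear_compose[OF bounded_bilinear.bounded_linear_right[OF bounded_bilinear_cinner]
            bounded_linear_apply_bop])
    then show ?thesis
      by (rule riesz_representation) (auto simp: apply_bop_scaleC cinner_simps)
  qed
  then obtain f where f: "\<And>x y. cinner (f x) y = cinner x (T \<rhd> y)" by metis
  have f': "cinner z (f x) = cinner (T \<rhd> z) x" for x z
    by (metis cinner_commute f)
  have add: "f (x + y) = f x + f y" for x y
    by (rule cinner_extI) (simp add: cinner_simps f')
  have sc: "f (c *\<^sub>C x) = c *\<^sub>C f x" for c x
    by (rule cinner_extI) (simp add: cinner_simps f')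
  have "bounded_linear f"
  proof (rule bounded_linear_intro[where K = "bnorm T"])
    fix x
    have "(norm (f x))\<^sup>2 = Re (cinner x (T \<rhd> f x))"
      by (simp add: f flip: Re_cinner_self)
    also have "\<dots> \<le> norm x * norm (T \<rhd> f x)"
      using cinner_cauchy_schwarz complex_Re_le_cmod order_trans by blast
    also have "\<dots> \<le> norm x * (bnorm T * norm (f x))"
      by (intro mult_left_mono bnorm_bound) auto
    finally have "norm (f x) * norm (f x) \<le> (norm x * bnorm T) * norm (f x)"
      by (simp add: power2_eq_square mult.assoc)
    then show "norm (f x) \<le> norm x * bnorm T"
      by (cases "norm (f x) = 0") (auto simp: bnorm_nonneg)
  next
    show "f (r *\<^sub>R x) = r *\<^sub>R f x" for r x
      using sc[of "of_real r" x] by (simp add: scaleC_of_real)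
  qed (rule add)
  then have "apply_bop (Bop f) = f" using sc by (rule apply_Bop)
  then show ?thesis using f by metis
qed

lemma cinner_adj_left: "cinner (T\<^sup>\<dagger> \<rhd> x) y = cinner x (T \<rhd> y)"
proof -
  obtain S where S: "\<forall>x y. cinner (S \<rhd> x) y = cinner x (T \<rhd> y)" using adj_exists by blast
  have "R = S" if R: "\<forall>x y. cinner (R \<rhd> x) y = cinner x (T \<rhd> y)" for R
    by (intro bop_eqI cinner_extI) (metis R S cinner_commute)
  with S have "T\<^sup>\<dagger> = S" unfolding adj_def by (intro the_equality) blast+
  then show ?thesis using S by simp
qed

lemma cinner_adj_right: "cinner x (T\<^sup>\<dagger> \<rhd> y) = cinner (T \<rhd> x) y"
  by (metis cinner_adj_left cinner_commute)

lemma adj_unique: "T\<^sup>\<dagger> = S" if "\<And>x y. cinner (S \<rhd> x) y = cinner x (T \<rhd> y)"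
  by (intro bop_eqI cinner_extI) (metis that cinner_adj_right cinner_commute)

lemma adj_adj [simp]: "(T\<^sup>\<dagger>)\<^sup>\<dagger> = T"
  by (rule adj_unique) (simp add: cinner_adj_right)

lemma adj_simps [simp]:
  "(0 :: 'h::chilbert_space bop)\<^sup>\<dagger> = 0" "(1 :: 'h bop)\<^sup>\<dagger> = 1"
  by (rule adj_unique; simp)+

lemma adj_mult: "(S * T)\<^sup>\<dagger> = T\<^sup>\<dagger> * S\<^sup>\<dagger>"
  and adj_add: "(S + T)\<^sup>\<dagger> = S\<^sup>\<dagger> + T\<^sup>\<dagger>"
  and adj_diff: "(S - T)\<^sup>\<dagger> = S\<^sup>\<dagger> - T\<^sup>\<dagger>"
  and adj_minus: "(- T)\<^sup>\<dagger> = - T\<^sup>\<dagger>"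
  and adj_scaleC: "(scaleC_bop c T)\<^sup>\<dagger> = scaleC_bop (cnj c) (T\<^sup>\<dagger>)"
  by (rule adj_unique; simp add: cinner_simps cinner_adj_left)+

lemma scaleC_bop_mult: "scaleC_bop c S * T = scaleC_bop c (S * T)" "S * scaleC_bop c T = scaleC_bop c (S * T)"
  by (rule bop_eqI; simp add: apply_bop_scaleC)+

lemma scaleC_bop_simps:
  "scaleC_bop 1 T = T" "scaleC_bop c (scaleC_bop d T) = scaleC_bop (c * d) T"
  "scaleC_bop (c + d) T = scaleC_bop c T + scaleC_bop d T"
  "scaleC_bop c (S + T) = scaleC_bop c S + scaleC_bop c T"
  "scaleC_bop c (S - T) = scaleC_bop c S - scaleC_bop c T"
  "scaleC_bop (- 1) T = - T" "scaleC_bop c 0 = 0" "scaleC_bop 0 T = 0"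
  using scaleC_of_real[of 0]
  by (auto intro!: bop_eqI simp: scaleC_scaleC scaleC_add_left scaleC_add_right scaleC_diff_right
      scaleC_minus_one scaleC_zero_right)

lemma bnorm_adj: "norm (T\<^sup>\<dagger> \<rhd> x) \<le> bnorm T * norm x"
proof -
  have "(norm (T\<^sup>\<dagger> \<rhd> x))\<^sup>2 = Re (cinner x (T \<rhd> T\<^sup>\<dagger> \<rhd> x))"
    by (simp add: cinner_adj_left flip: Re_cinner_self)
  also have "\<dots> \<le> norm x * norm (T \<rhd> T\<^sup>\<dagger> \<rhd> x)"
    using cinner_cauchy_schwarz complex_Re_le_cmod order_trans by blast
  also have "\<dots> \<le> norm x * (bnorm T * norm (T\<^sup>\<dagger> \<rhd> x))"
    by (intro mult_left_mono bnorm_bound) auto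
  finally have "norm (T\<^sup>\<dagger> \<rhd> x) * norm (T\<^sup>\<dagger> \<rhd> x) \<le> (bnorm T * norm x) * norm (T\<^sup>\<dagger> \<rhd> x)"
    by (simp add: power2_eq_square ac_simps)
  then show ?thesis
    by (cases "norm (T\<^sup>\<dagger> \<rhd> x) = 0") (auto simp: bnorm_nonneg)
qed

section \<open>Positive operators\<close>

abbreviation le_bop :: "'h::chilbert_space bop \<Rightarrow> 'h bop \<Rightarrow> bool" (infix \<open>\<preceq>\<close> 50) where
  "S \<preceq> T \<equiv> positive_bop (T - S)"

abbreviation of_real_bop :: "real \<Rightarrow> 'h::chilbert_space bop \<Rightarrow> 'h bop" (infixr \<open>*\<^sub>r\<close> 75) where
  "r *\<^sub>r T \<equiv> scaleC_bop (complex_of_real r) T"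

lemma form_scale: "Re (cinner x ((r *\<^sub>r T) \<rhd> y)) = r * Re (cinner x (T \<rhd> y))"
  by (simp add: cinner_simps)

text \<open>Polarization at \<open>x + y\<close> and \<open>x + \<i> y\<close>. This is where complex scalars matter: over the reals a
  form does not see the antisymmetric part.\<close>

lemma selfadjoint_if_real_form:
  assumes "\<And>x. Im (cinner x (T \<rhd> x)) = 0"
  shows "T\<^sup>\<dagger> = T"
proof (rule adj_unique)
  fix x y
  have "Im (cinner x (T \<rhd> y)) = - Im (cinner y (T \<rhd> x))"
    using assms[of "x + y"] assms[of x] assms[of y] by (simp add: apply_bop_add cinner_simps)
  moreover have "Re (cinner x (T \<rhd> y)) = Re (cinner y (T \<rhd> x))"
    using assms[of "x + \<i> *\<^sub>C y"] assms[of x] assms[of y]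
    by (simp add: apply_bop_add apply_bop_scaleC cinner_simps)
  ultimately have "cinner x (T \<rhd> y) = cnj (cinner y (T \<rhd> x))"
    by (simp add: complex_eq_iff)
  then show "cinner (T \<rhd> x) y = cinner x (T \<rhd> y)"
    by (metis cinner_commute)
qed

lemma positive_bop_iff: "positive_bop T \<longleftrightarrow> T\<^sup>\<dagger> = T \<and> (\<forall>x. 0 \<le> Re (cinner x (T \<rhd> x)))"
proof
  assume T: "positive_bop T"
  then have "T\<^sup>\<dagger> = T"
    by (intro selfadjoint_if_real_form) (auto simp: positive_bop_def complex_nonneg_Reals_iff)
  with T show "T\<^sup>\<dagger> = T \<and> (\<forall>x. 0 \<le> Re (cinner x (T \<rhd> x)))"
    by (auto simp: positive_bop_def complex_nonneg_Reals_iff)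
next
  assume T: "T\<^sup>\<dagger> = T \<and> (\<forall>x. 0 \<le> Re (cinner x (T \<rhd> x)))"
  have "cnj (cinner x (T \<rhd> x)) = cinner x (T \<rhd> x)" for x
    by (metis T cinner_adj_left cinner_commute)
  then have "Im (cinner x (T \<rhd> x)) = 0" for x
    by (metis Reals_cnj_iff complex_is_Real_iff)
  with T show "positive_bop T" by (auto simp: positive_bop_def complex_nonneg_Reals_iff)
qed

lemma positive_selfadjoint: "positive_bop T \<Longrightarrow> T\<^sup>\<dagger> = T"
  by (simp add: positive_bop_iff)

lemma positive_form: "positive_bop T \<Longrightarrow> 0 \<le> Re (cinner x (T \<rhd> x))"
  by (simp add: positive_bop_iff)

lemma le_bop_form: "S \<preceq> T \<Longrightarrow> Re (cinner x (S \<rhd> x)) \<le> Re (cinner x (T \<rhd> x))"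
  using positive_form[of "T - S" x] by (simp add: cinner_simps)

lemma le_bopI: "S \<preceq> T" if "S\<^sup>\<dagger> = S" "T\<^sup>\<dagger> = T" "\<And>x. Re (cinner x (S \<rhd> x)) \<le> Re (cinner x (T \<rhd> x))"
  using that by (simp add: positive_bop_iff adj_diff cinner_simps)

lemma cinner_selfadjoint: "T\<^sup>\<dagger> = T \<Longrightarrow> cinner x (T \<rhd> y) = cinner (T \<rhd> x) y"
  by (metis cinner_adj_left)

lemma positive_zero [simp]: "positive_bop 0"
  and positive_one [simp]: "positive_bop 1"
  by (auto simp: positive_bop_iff Re_cinner_self)

lemma positive_add: "positive_bop S \<Longrightarrow> positive_bop T \<Longrightarrow> positive_bop (S + T)"
  by (auto simp: positive_bop_iff adj_add cinner_simps)

lemma positive_scale: "0 \<le> r \<Longrightarrow> positive_bop T \<Longrightarrow> positive_bop (r *\<^sub>r T)"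
  by (auto simp: positive_bop_iff adj_scaleC cinner_simps)

lemma positive_conj: "positive_bop T \<Longrightarrow> positive_bop (S\<^sup>\<dagger> * T * S)"
  by (auto simp: positive_bop_iff adj_mult mult.assoc cinner_adj_right)

lemma positive_square: "positive_bop (S\<^sup>\<dagger> * S)"
  using positive_conj[of 1 S] by simp

lemma le_bop_trans: "R \<preceq> S \<Longrightarrow> S \<preceq> T \<Longrightarrow> R \<preceq> T"
  using positive_add[of "S - R" "T - S"] by (simp add: algebra_simps)

lemma positive_le: "positive_bop S \<Longrightarrow> S \<preceq> T \<Longrightarrow> positive_bop T"
  using positive_add[of "S" "T - S"] by (simp add: algebra_simps)

lemma le_bop_conj: "A \<preceq> T \<Longrightarrow> S\<^sup>\<dagger> * A * S \<preceq> S\<^sup>\<dagger> * T * S"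
  using positive_conj[of "T - A" S] by (simp add: algebra_simps)

lemma positive_sum: "(\<And>i. i \<in> I \<Longrightarrow> positive_bop (f i)) \<Longrightarrow> positive_bop (sum f I)"
  by (induction I rule: infinite_finite_induct) (auto intro: positive_add)

lemma positive_cauchy_schwarz:
  assumes "positive_bop T"
  shows "(cmod (cinner x (T \<rhd> y)))\<^sup>2 \<le> Re (cinner x (T \<rhd> x)) * Re (cinner y (T \<rhd> y))"
proof (rule gram_cauchy_schwarz)
  fix l
  have "0 \<le> Re (cinner (x + l *\<^sub>C y) (T \<rhd> (x + l *\<^sub>C y)))"
    by (rule positive_form[OF assms])
  also have "\<dots> = Re (cinner x (T \<rhd> x)) + Re (l * cinner x (T \<rhd> y)) + Re (cnj l * cinner y (T \<rhd> x))
      + Re (cnj l * l * cinner y (T \<rhd> y))"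
    by (simp add: apply_bop_add apply_bop_scaleC cinner_simps mult.assoc ring_distribs)
  also have "cinner y (T \<rhd> x) = cnj (cinner x (T \<rhd> y))"
    by (metis assms cinner_commute cinner_selfadjoint positive_selfadjoint)
  also have "cnj l * cnj (cinner x (T \<rhd> y)) = cnj (l * cinner x (T \<rhd> y))" by simp
  also have "cnj l * l = of_real ((cmod l)\<^sup>2)" by (simp only: complex_norm_square mult.commute)
  finally show "0 \<le> Re (cinner x (T \<rhd> x)) + 2 * Re (l * cinner x (T \<rhd> y))
      + (cmod l)\<^sup>2 * Re (cinner y (T \<rhd> y))" by (simp del: complex_cnj_mult)
qed (rule positive_form[OF assms])

lemma le_bop_antisym:
  assumes "S \<preceq> T" "T \<preceq> S" shows "S = T"
proof -
  have pos: "positive_bop (T - S)" by fact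
  have "Re (cinner x ((T - S) \<rhd> x)) = 0" for x
    using positive_form[OF assms(1), of x] positive_form[OF assms(2), of x] by (simp add: cinner_simps)
  then have "cinner x ((T - S) \<rhd> y) = 0" for x y
    using positive_cauchy_schwarz[OF pos, of x y] by simp
  then have "(T - S) \<rhd> y = 0" for y by (rule cinner_eq_zeroI)
  then show ?thesis by (intro bop_eqI) simp
qed

lemma positive_form_zero:
  assumes "positive_bop T" "Re (cinner x (T \<rhd> x)) = 0"
  shows "T \<rhd> x = 0"
  using positive_cauchy_schwarz[OF assms(1), of _ x] assms(2) by (intro cinner_eq_zeroI) simp

text \<open>Cauchy--Schwarz for the form of \<open>T\<close>, at the vectors \<open>T x\<close> and \<open>x\<close>. It turns smallness of the form
  at a vector into smallness of the image of that vector.\<close>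

lemma norm_square_le_form:
  assumes T: "positive_bop T" "T \<preceq> c *\<^sub>r 1"
  shows "(norm (T \<rhd> x))\<^sup>2 \<le> c * Re (cinner x (T \<rhd> x))"
proof -
  have "((norm (T \<rhd> x))\<^sup>2)\<^sup>2 = (cmod (cinner (T \<rhd> x) (T \<rhd> x)))\<^sup>2"
    by (simp add: cinner_self norm_power)
  also have "\<dots> \<le> Re (cinner (T \<rhd> x) (T \<rhd> T \<rhd> x)) * Re (cinner x (T \<rhd> x))"
    by (rule positive_cauchy_schwarz[OF T(1)])
  also have "\<dots> \<le> (c * (norm (T \<rhd> x))\<^sup>2) * Re (cinner x (T \<rhd> x))"
    using le_bop_form[OF T(2), of "T \<rhd> x"]
    by (intro mult_right_mono positive_form[OF T(1)]) (simp add: cinner_simps Re_cinner_self cinner_self)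
  finally have "(norm (T \<rhd> x))\<^sup>2 * (norm (T \<rhd> x))\<^sup>2 \<le> (c * Re (cinner x (T \<rhd> x))) * (norm (T \<rhd> x))\<^sup>2"
    by (simp add: power2_eq_square ac_simps)
  then show ?thesis
  proof (cases "T \<rhd> x = 0")
    case False
    then show ?thesis
      using \<open>(norm (T \<rhd> x))\<^sup>2 * (norm (T \<rhd> x))\<^sup>2 \<le> _\<close> by (simp only: mult_le_cancel_right) simp
  qed simp
qed

lemma le_bop_bnorm: "T\<^sup>\<dagger> = T \<Longrightarrow> T \<preceq> bnorm T *\<^sub>r 1"
proof (rule le_bopI)
  fix x
  have "Re (cinner x (T \<rhd> x)) \<le> norm x * norm (T \<rhd> x)"
    using cinner_cauchy_schwarz complex_Re_le_cmod order_trans by blast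
  also have "\<dots> \<le> norm x * (bnorm T * norm x)" by (intro mult_left_mono bnorm_bound) auto
  finally show "Re (cinner x (T \<rhd> x)) \<le> Re (cinner x ((bnorm T *\<^sub>r 1) \<rhd> x))"
    by (simp add: cinner_simps cinner_self power2_eq_square ac_simps)
qed (auto simp: adj_scaleC)

lemma square_le_bnorm: "T\<^sup>\<dagger> * T \<preceq> (bnorm T)\<^sup>2 *\<^sub>r 1"
proof (rule le_bopI)
  fix x
  have "Re (cinner x ((T\<^sup>\<dagger> * T) \<rhd> x)) = (norm (T \<rhd> x))\<^sup>2"
    by (simp add: cinner_adj_right Re_cinner_self)
  also have "\<dots> \<le> (bnorm T * norm x)\<^sup>2"
    by (intro power_mono bnorm_bound) auto
  finally show "Re (cinner x ((T\<^sup>\<dagger> * T) \<rhd> x)) \<le> Re (cinner x (((bnorm T)\<^sup>2 *\<^sub>r 1) \<rhd> x))"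
    by (simp add: cinner_simps cinner_self power_mult_distrib)
qed (auto simp: adj_scaleC adj_mult)

lemma contraction_square: "T * T \<preceq> T" if "positive_bop T" "T \<preceq> 1"
proof (rule le_bopI)
  fix x
  have "(norm (T \<rhd> x))\<^sup>2 \<le> Re (cinner x (T \<rhd> x))"
    using norm_square_le_form[of T 1 x] that by (simp add: scaleC_bop_simps)
  then show "Re (cinner x ((T * T) \<rhd> x)) \<le> Re (cinner x (T \<rhd> x))"
    using that(1) by (simp add: cinner_selfadjoint[of T x "T \<rhd> x"] positive_selfadjoint Re_cinner_self)
qed (auto simp: positive_selfadjoint that adj_mult)

lemma contraction_norm: "norm (T \<rhd> x) \<le> norm x" if "positive_bop T" "T \<preceq> 1"
proof -
  have "(norm (T \<rhd> x))\<^sup>2 \<le> Re (cinner x (T \<rhd> x))"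
    using norm_square_le_form[of T 1 x] that by (simp add: scaleC_bop_simps)
  also have "\<dots> \<le> (norm x)\<^sup>2"
    using le_bop_form[OF that(2), of x] by (simp add: Re_cinner_self)
  finally show ?thesis by (rule power2_le_imp_le) simp
qed

subsection \<open>Inverses and the function \<open>s/(1+s)\<close>\<close>

text \<open>Being bounded below, \<open>T\<close> is injective with closed range; a vector orthogonal to the range is
  killed by the coercive form.\<close>

lemma coercive_inverse:
  assumes T: "T\<^sup>\<dagger> = T" and c: "c > 0" and co: "\<And>x. c * (norm x)\<^sup>2 \<le> Re (cinner x (T \<rhd> x))"
  obtains R where "R * T = 1" "T * R = 1"
proof -
  have below: "c * norm x \<le> norm (T \<rhd> x)" for x
  proof (cases "x = 0")
    case False
    have "c * norm x * norm x \<le> norm (T \<rhd> x) * norm x"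
      using co[of x] order_trans[OF complex_Re_le_cmod cinner_cauchy_schwarz[of x "T \<rhd> x"]]
      by (simp add: power2_eq_square ac_simps)
    then show ?thesis using False by simp
  qed simp
  define S where "S = range (apply_bop T)"
  have "complete S" unfolding S_def
    by (rule complete_isometric_image[OF c subspace_UNIV bounded_linear_apply_bop]) (auto intro: below complete_UNIV)
  then have "closed S" by (rule complete_imp_closed)
  have "\<exists>x. T \<rhd> x = y" for y
  proof -
    obtain p where p: "p \<in> S" "\<And>s. s \<in> S \<Longrightarrow> cinner s (y - p) = 0"
    proof (rule orthogonal_projection[of S y])
      show "0 \<in> S" unfolding S_def by (metis apply_bop_zero rangeI)
      show "u + v \<in> S" if "u \<in> S" "v \<in> S" for u v
        using that by (auto simp: S_def simp flip: apply_bop_add)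
      show "k *\<^sub>C u \<in> S" if "u \<in> S" for k u
        using that by (auto simp: S_def simp flip: apply_bop_scaleC)
    qed (use \<open>closed S\<close> in auto)
    have "cinner (T \<rhd> (y - p)) (y - p) = 0" using p(2) S_def by blast
    then have "Re (cinner (y - p) (T \<rhd> (y - p))) = 0" by (metis Re_cinner_commute zero_complex.sel(1))
    then have "(norm (y - p))\<^sup>2 \<le> 0" using co[of "y - p"] c
      by (metis mult_le_cancel_left_pos mult_zero_right)
    then show ?thesis using p(1) S_def by auto
  qed
  then obtain f where f: "\<And>y. T \<rhd> f y = y" by metis
  have inj: "u = v" if "T \<rhd> u = T \<rhd> v" for u v
    using below[of "u - v"] c that by (simp add: apply_bop_diff mult_le_0_iff)
  have "bounded_linear f"
  proof (rule bounded_linear_intro[where K = "1 / c"])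
    fix x show "norm (f x) \<le> norm x * (1 / c)" using below[of "f x"] c by (simp add: f field_simps)
  qed (rule inj, simp add: f apply_bop_add apply_bop_scaleR)+
  moreover have "f (k *\<^sub>C x) = k *\<^sub>C f x" for k x by (rule inj) (simp add: f apply_bop_scaleC)
  ultimately have Bf: "apply_bop (Bop f) = f" by (rule apply_Bop)
  have "Bop f * T = 1" by (rule bop_eqI, rule inj) (simp add: f Bf)
  moreover have "T * Bop f = 1" by (rule bop_eqI) (simp add: f Bf)
  ultimately show ?thesis using that by blast
qed

text \<open>The inverse of \<open>1 + s\<close>, which exists for positive \<open>s\<close>.\<close>

definition resolvent :: "'h::chilbert_space bop \<Rightarrow> 'h bop" where
  "resolvent s = (SOME r. r * (1 + s) = 1 \<and> (1 + s) * r = 1)"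

text \<open>The operator \<open>s/(1+s)\<close>. It replaces the positive operator \<open>s\<close> by one that lies between \<open>0\<close> and \<open>1\<close>
  and below \<open>s\<close>, in an order preserving way, so that unbounded increasing sequences become bounded
  ones. It plays the role that spectral projections would have.\<close>

definition cut :: "'h::chilbert_space bop \<Rightarrow> 'h bop" where
  "cut s = 1 - resolvent s"

lemma resolvent_inverse:
  assumes "positive_bop s"
  shows "resolvent s * (1 + s) = 1" "(1 + s) * resolvent s = 1"
proof -
  have "\<exists>r. r * (1 + s) = 1 \<and> (1 + s) * r = 1"
  proof (rule coercive_inverse[of "1 + s" 1])
    show "(1 + s)\<^sup>\<dagger> = 1 + s" using assms by (simp add: adj_add positive_selfadjoint)
    show "1 * (norm x)\<^sup>2 \<le> Re (cinner x ((1 + s) \<rhd> x))" for x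
      using positive_form[OF assms, of x] by (simp add: cinner_simps Re_cinner_self)
  qed auto
  from someI_ex[OF this] show "resolvent s * (1 + s) = 1" "(1 + s) * resolvent s = 1"
    unfolding resolvent_def by blast+
qed

lemma resolvent_commute:
  assumes s: "positive_bop s" and "T * s = s * T"
  shows "T * resolvent s = resolvent s * T"
proof -
  have "T * (1 + s) = (1 + s) * T" using assms by (simp add: algebra_simps)
  then have "resolvent s * (T * (1 + s)) * resolvent s = resolvent s * ((1 + s) * T) * resolvent s" by simp
  then show ?thesis
    by (simp add: mult.assoc resolvent_inverse[OF s]) (simp add: resolvent_inverse[OF s] flip: mult.assoc)
qed

context
  fixes s :: "'h::chilbert_space bop"
  assumes s: "positive_bop s"
begin

text \<open>Substituting \<open>x = y + s y\<close> turns statements about functions of \<open>s\<close> into inequalities between the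
  numbers \<open>\<langle>y, s y\<rangle>\<close>, \<open>\<parallel>s y\<parallel>\<^sup>2\<close> and \<open>\<langle>s y, s s y\<rangle>\<close>.\<close>

lemma resolvent_vector: obtains y where "x = y + s \<rhd> y" "resolvent s \<rhd> x = y" "cut s \<rhd> x = s \<rhd> y"
proof (rule that[of "resolvent s \<rhd> x"])
  show "x = resolvent s \<rhd> x + s \<rhd> resolvent s \<rhd> x"
    using resolvent_inverse(2)[OF s] by (metis apply_bop_simps(2,3,6))
  then show "cut s \<rhd> x = s \<rhd> resolvent s \<rhd> x"
    by (simp add: cut_def algebra_simps)
qed simp

lemma cut_eq: "cut s = s * resolvent s" "cut s = resolvent s * s"
  using resolvent_inverse[OF s] by (auto simp: cut_def algebra_simps)

lemma resolvent_positive: "positive_bop (resolvent s)"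
proof -
  have "cinner x (resolvent s \<rhd> x) \<in> \<real>\<^sub>\<ge>\<^sub>0" for x
  proof -
    obtain y where y: "x = y + s \<rhd> y" "resolvent s \<rhd> x = y" by (rule resolvent_vector)
    have "cinner x (resolvent s \<rhd> x) = cinner y y + cinner y (s \<rhd> y)"
      unfolding y(2) by (simp add: y(1) cinner_simps cinner_selfadjoint[OF positive_selfadjoint[OF s], of y y])
    then show ?thesis using s
      by (auto simp: positive_bop_def cinner_self simp del: of_real_power)
  qed
  then show ?thesis by (simp add: positive_bop_def)
qed

lemma cut_selfadjoint: "(cut s)\<^sup>\<dagger> = cut s"
  by (simp add: cut_def adj_diff positive_selfadjoint resolvent_positive)

lemma cut_positive: "positive_bop (cut s)"
proof -
  have "0 \<le> Re (cinner x (cut s \<rhd> x))" for x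
  proof -
    obtain y where y: "x = y + s \<rhd> y" "cut s \<rhd> x = s \<rhd> y" by (rule resolvent_vector)
    show ?thesis unfolding y(2) using positive_form[OF s, of y]
      by (simp add: y(1) cinner_simps Re_cinner_self)
  qed
  then show ?thesis by (simp add: positive_bop_iff cut_selfadjoint)
qed

lemma cut_le_one: "cut s \<preceq> 1"
  by (simp add: cut_def resolvent_positive)

lemma cut_le: "cut s \<preceq> s"
proof (rule le_bopI)
  fix x
  obtain y where y: "x = y + s \<rhd> y" "cut s \<rhd> x = s \<rhd> y" by (rule resolvent_vector)
  have "Re (cinner (y + s \<rhd> y) (s \<rhd> y)) \<le> Re (cinner (y + s \<rhd> y) (s \<rhd> (y + s \<rhd> y)))"
    using positive_form[OF s, of "s \<rhd> y"]
    by (simp add: cinner_simps apply_bop_add Re_cinner_self cinner_selfadjoint[OF positive_selfadjoint[OF s], of y "s \<rhd> y"])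
  then show "Re (cinner x (cut s \<rhd> x)) \<le> Re (cinner x (s \<rhd> x))" unfolding y(2) by (simp add: y(1))
qed (simp_all add: cut_selfadjoint positive_selfadjoint s)

lemma le_cut:
  assumes c: "s \<preceq> c *\<^sub>r 1" "0 \<le> c"
  shows "(1 / (1 + c)) *\<^sub>r s \<preceq> cut s"
proof (rule le_bopI)
  fix x
  obtain y where y: "x = y + s \<rhd> y" "cut s \<rhd> x = s \<rhd> y" by (rule resolvent_vector)
  have 1: "(norm (s \<rhd> y))\<^sup>2 \<le> c * Re (cinner y (s \<rhd> y))" by (rule norm_square_le_form[OF s c(1)])
  have 2: "Re (cinner (s \<rhd> y) (s \<rhd> s \<rhd> y)) \<le> c * (norm (s \<rhd> y))\<^sup>2"
    using le_bop_form[OF c(1), of "s \<rhd> y"] by (simp add: cinner_simps Re_cinner_self cinner_self)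
  have "Re (cinner x (s \<rhd> x)) = Re (cinner y (s \<rhd> y)) + 2 * (norm (s \<rhd> y))\<^sup>2 + Re (cinner (s \<rhd> y) (s \<rhd> s \<rhd> y))"
    by (simp add: y(1) cinner_simps apply_bop_add Re_cinner_self cinner_selfadjoint[OF positive_selfadjoint[OF s], of y "s \<rhd> y"])
  moreover have "Re (cinner x (cut s \<rhd> x)) = Re (cinner y (s \<rhd> y)) + (norm (s \<rhd> y))\<^sup>2"
    unfolding y(2) by (simp add: y(1) cinner_simps Re_cinner_self)
  ultimately have "Re (cinner x (s \<rhd> x)) \<le> (1 + c) * Re (cinner x (cut s \<rhd> x))"
    using 1 2 by (simp add: algebra_simps)
  then show "Re (cinner x (((1 / (1 + c)) *\<^sub>r s) \<rhd> x)) \<le> Re (cinner x (cut s \<rhd> x))"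
    unfolding form_scale using c(2) by (simp add: field_simps)
qed (simp_all add: cut_selfadjoint positive_selfadjoint s adj_scaleC)

end

text \<open>With \<open>y\<close> and \<open>z\<close> the images of \<open>x\<close> under the two resolvents, \<open>\<langle>x, z\<rangle>\<close> equals \<open>\<langle>z, (1+s) y\<rangle>\<close>, and
  Cauchy--Schwarz for the form of \<open>1 + s\<close> compares the two values.\<close>

lemma resolvent_antimono:
  assumes s: "positive_bop s" and le: "s \<preceq> t"
  shows "resolvent t \<preceq> resolvent s"
proof (rule le_bopI)
  have t: "positive_bop t" using positive_le s le by blast
  fix x
  obtain y where y: "x = y + s \<rhd> y" "resolvent s \<rhd> x = y" by (rule resolvent_vector[OF s])
  obtain z where z: "x = z + t \<rhd> z" "resolvent t \<rhd> x = z" by (rule resolvent_vector[OF t])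
  let ?r = "Re (cinner x (resolvent s \<rhd> x))" and ?q = "Re (cinner x (resolvent t \<rhd> x))"
  have p: "positive_bop (1 + s)" using s by (simp add: positive_add)
  have "?q = Re (cinner z ((1 + s) \<rhd> y))"
    unfolding z(2) using y(1) by (simp add: Re_cinner_commute)
  then have "?q\<^sup>2 \<le> (cmod (cinner z ((1 + s) \<rhd> y)))\<^sup>2"
    using abs_Re_le_cmod by (metis abs_le_square_iff abs_norm_cancel)
  also have "\<dots> \<le> Re (cinner z ((1 + s) \<rhd> z)) * Re (cinner y ((1 + s) \<rhd> y))"
    by (rule positive_cauchy_schwarz[OF p])
  also have "\<dots> \<le> Re (cinner z ((1 + t) \<rhd> z)) * Re (cinner y ((1 + s) \<rhd> y))"
    using le_bop_form[OF le, of z]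
    by (intro mult_right_mono positive_form[OF p]) (auto simp: cinner_simps)
  also have "Re (cinner z ((1 + t) \<rhd> z)) = ?q"
    unfolding z(2) using z(1) by (simp add: Re_cinner_commute)
  also have "Re (cinner y ((1 + s) \<rhd> y)) = ?r"
    unfolding y(2) using y(1) by (simp add: Re_cinner_commute)
  finally have "?q * ?q \<le> ?r * ?q" by (simp add: power2_eq_square mult.commute)
  moreover have "0 \<le> ?q" "0 \<le> ?r" by (auto intro: positive_form resolvent_positive s t)
  ultimately show "?q \<le> ?r" by (cases "?q = 0") auto
qed (use assms positive_le in \<open>auto intro!: positive_selfadjoint resolvent_positive\<close>)

lemma cut_mono: "positive_bop s \<Longrightarrow> s \<preceq> t \<Longrightarrow> cut s \<preceq> cut t"
  using resolvent_antimono[of s t] by (simp add: cut_def)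

subsection \<open>Strong limits\<close>

definition strong_limit :: "(nat \<Rightarrow> 'h::chilbert_space bop) \<Rightarrow> 'h bop \<Rightarrow> bool" where
  "strong_limit a l \<longleftrightarrow> (\<forall>x. (\<lambda>n. a n \<rhd> x) \<longlonglongrightarrow> l \<rhd> x)"

lemma strong_limit_form: "strong_limit a l \<Longrightarrow> (\<lambda>n. cinner x (a n \<rhd> y)) \<longlonglongrightarrow> cinner x (l \<rhd> y)"
  unfolding strong_limit_def by (intro tendsto_cinner tendsto_const) auto

lemma strong_limit_selfadjoint:
  assumes "strong_limit a l" "\<And>n. (a n)\<^sup>\<dagger> = a n" shows "l\<^sup>\<dagger> = l"
proof (rule adj_unique)
  fix x y
  have "(\<lambda>n. cinner (a n \<rhd> x) y) \<longlonglongrightarrow> cinner (l \<rhd> x) y"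
    using assms(1) unfolding strong_limit_def by (intro tendsto_cinner tendsto_const) auto
  moreover have "cinner (a n \<rhd> x) y = cinner x (a n \<rhd> y)" for n
    by (metis assms(2) cinner_adj_left)
  ultimately show "cinner (l \<rhd> x) y = cinner x (l \<rhd> y)"
    using strong_limit_form[OF assms(1), of x y] LIMSEQ_unique by simp
qed

lemma strong_limit_positive:
  assumes "strong_limit a l" "\<And>n. positive_bop (a n)" shows "positive_bop l"
proof -
  have "l\<^sup>\<dagger> = l" using strong_limit_selfadjoint[OF assms(1)] assms(2) positive_selfadjoint by blast
  moreover have "0 \<le> Re (cinner x (l \<rhd> x))" for x
    using tendsto_Re[OF strong_limit_form[OF assms(1), of x x]] positive_form[OF assms(2)]
    by (intro LIMSEQ_le_const) auto
  ultimately show ?thesis by (simp add: positive_bop_iff)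
qed

lemma strong_limit_diff:
  "strong_limit a k \<Longrightarrow> strong_limit b l \<Longrightarrow> strong_limit (\<lambda>n. a n - b n) (k - l)"
  unfolding strong_limit_def by (auto intro: tendsto_diff)

lemma strong_limit_const: "strong_limit (\<lambda>n. a) a"
  by (simp add: strong_limit_def)

lemma strong_limit_mult: "strong_limit a k \<Longrightarrow> strong_limit (\<lambda>n. S * a n * T) (S * k * T)"
  unfolding strong_limit_def by (auto intro: tendsto_apply_bop)

lemma strong_limit_unique: "strong_limit a k \<Longrightarrow> strong_limit a l \<Longrightarrow> k = l"
  unfolding strong_limit_def by (metis LIMSEQ_unique bop_eqI)

lemma strong_limit_ignore: "strong_limit a k \<Longrightarrow> strong_limit (\<lambda>n. a (n + m)) k"
  unfolding strong_limit_def using LIMSEQ_ignore_initial_segment by fast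

lemma increasing_le_bop:
  assumes "\<And>n. a n \<preceq> a (Suc n)" "m \<le> n" shows "a m \<preceq> a n"
  using assms(2) by (induction n rule: dec_induct) (auto intro: le_bop_trans assms(1))

lemma strong_limit_ge:
  assumes "strong_limit a l" "\<And>n. a n \<preceq> a (Suc n)" shows "a m \<preceq> l"
  using strong_limit_positive[OF strong_limit_diff[OF strong_limit_ignore[OF assms(1), of m] strong_limit_const[of "a m"]]]
  by (simp add: increasing_le_bop[of a, OF assms(2)])

lemma strong_limit_le:
  assumes "strong_limit a l" "\<And>n. a n \<preceq> b" shows "l \<preceq> b"
  using strong_limit_positive[OF strong_limit_diff[OF strong_limit_const[of b] assms(1)]] assms(2) by simp

text \<open>The forms converge by monotonicity, and the estimate of \<open>norm_square_le_form\<close> upgrades this to convergence of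
  vectors.\<close>

lemma monotone_strong_limit:
  fixes a :: "nat \<Rightarrow> 'h::chilbert_space bop"
  assumes pos: "\<And>n. positive_bop (a n)" and le1: "\<And>n. a n \<preceq> 1" and inc: "\<And>n. a n \<preceq> a (Suc n)"
  obtains l where "strong_limit a l"
proof -
  have "convergent (\<lambda>n. a n \<rhd> x)" for x
  proof -
    define q where "q n = Re (cinner x (a n \<rhd> x))" for n
    have "incseq q" unfolding q_def by (intro incseq_SucI le_bop_form inc)
    moreover have "q n \<le> (norm x)\<^sup>2" for n
      using le_bop_form[OF le1, of x n] by (simp add: q_def Re_cinner_self)
    ultimately obtain L where "q \<longlonglongrightarrow> L" using incseq_convergent by metis
    then have "Cauchy q" by (rule LIMSEQ_imp_Cauchy)
    have diff: "(norm (a n \<rhd> x - a m \<rhd> x))\<^sup>2 \<le> q n - q m" if "m \<le> n" for m n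
    proof -
      have "a m \<preceq> a n" by (rule increasing_le_bop[of a, OF inc that])
      moreover have "a n - a m \<preceq> 1"
        using positive_add[OF le1[of n] pos[of m]] by (simp add: algebra_simps)
      ultimately show ?thesis
        using norm_square_le_form[of "a n - a m" 1 x] by (simp add: scaleC_bop_simps q_def cinner_simps)
    qed
    have "Cauchy (\<lambda>n. a n \<rhd> x)"
    proof (rule CauchyI)
      fix e :: real assume "e > 0"
      then obtain M where M: "\<forall>m\<ge>M. \<forall>n\<ge>M. norm (q m - q n) < e\<^sup>2"
        using CauchyD[OF \<open>Cauchy q\<close>, of "e\<^sup>2"] by auto
      have main: "norm (a n \<rhd> x - a m \<rhd> x) < e" if "m \<ge> M" "n \<ge> M" "m \<le> n" for m n
      proof -
        have "(norm (a n \<rhd> x - a m \<rhd> x))\<^sup>2 < e\<^sup>2"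
          using diff[OF that(3)] M that by (smt (verit) real_norm_def)
        then show ?thesis by (rule power_less_imp_less_base) (use \<open>e > 0\<close> in simp)
      qed
      have "norm (a m \<rhd> x - a n \<rhd> x) < e" if "m \<ge> M" "n \<ge> M" for m n
        using main that by (metis nat_le_linear norm_minus_commute)
      then show "\<exists>M. \<forall>m\<ge>M. \<forall>n\<ge>M. norm (a m \<rhd> x - a n \<rhd> x) < e" by blast
    qed
    then show ?thesis by (simp add: Cauchy_convergent_iff)
  qed
  then obtain f where f: "\<And>x. (\<lambda>n. a n \<rhd> x) \<longlonglongrightarrow> f x" unfolding convergent_def by metis
  have "f (x + y) = f x + f y" for x y
    by (rule LIMSEQ_unique[OF f]) (simp add: apply_bop_add tendsto_add f)
  moreover have sc: "f (c *\<^sub>C x) = c *\<^sub>C f x" for c x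
    by (rule LIMSEQ_unique[OF f])
      (simp add: apply_bop_scaleC bounded_linear.tendsto[OF bounded_linear_scaleC f])
  moreover have "norm (f x) \<le> norm x * 1" for x
    using tendsto_norm[OF f[of x]] contraction_norm[OF pos le1] by (intro LIMSEQ_le_const2) auto
  ultimately have "bounded_linear f"
    by (intro bounded_linear_intro[where K = 1]) (auto simp flip: scaleC_of_real)
  then have "apply_bop (Bop f) = f" using sc by (rule apply_Bop)
  then have "strong_limit a (Bop f)" by (simp add: strong_limit_def f)
  then show ?thesis using that by blast
qed

section \<open>Von Neumann algebras\<close>

lemma commutant_antimono: "S \<subseteq> T \<Longrightarrow> commutant T \<subseteq> commutant S"
  by (auto simp: commutant_def)

lemma subset_bicommutant: "S \<subseteq> commutant (commutant S)"
  by (auto simp: commutant_def)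

lemma commutant_adj:
  assumes "\<And>x. x \<in> S \<Longrightarrow> x\<^sup>\<dagger> \<in> S" "T \<in> commutant S"
  shows "T\<^sup>\<dagger> \<in> commutant S"
proof -
  have "T\<^sup>\<dagger> * x = x * T\<^sup>\<dagger>" if "x \<in> S" for x
  proof -
    have "T * x\<^sup>\<dagger> = x\<^sup>\<dagger> * T" using assms that by (auto simp: commutant_def)
    then have "(T * x\<^sup>\<dagger>)\<^sup>\<dagger> = (x\<^sup>\<dagger> * T)\<^sup>\<dagger>" by simp
    then show ?thesis by (simp add: adj_mult)
  qed
  then show ?thesis by (simp add: commutant_def)
qed

lemma von_neumann_algebra_bicommutant:
  assumes "\<And>x. x \<in> S \<Longrightarrow> x\<^sup>\<dagger> \<in> S"
  shows "von_neumann_algebra (commutant (commutant S))"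
proof -
  have "commutant (commutant (commutant S)) = commutant S"
    by (intro equalityI commutant_antimono subset_bicommutant)
  moreover have "x\<^sup>\<dagger> \<in> commutant (commutant S)" if "x \<in> commutant (commutant S)" for x
    using commutant_adj[OF commutant_adj[OF assms] that] .
  ultimately show ?thesis by (simp add: von_neumann_algebra_def)
qed

lemma vna_iff: "von_neumann_algebra N \<Longrightarrow> T \<in> N \<longleftrightarrow> (\<forall>s\<in>commutant N. T * s = s * T)"
  unfolding von_neumann_algebra_def commutant_def by blast

context
  fixes N :: "'h::chilbert_space bop set"
  assumes N: "von_neumann_algebra N"
begin

lemma vna_adj: "T \<in> N \<Longrightarrow> T\<^sup>\<dagger> \<in> N"
  using N by (simp add: von_neumann_algebra_def)

lemma vna_zero: "0 \<in> N" and vna_one: "1 \<in> N"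
  by (auto simp: vna_iff[OF N])

lemma vna_add: "S \<in> N \<Longrightarrow> T \<in> N \<Longrightarrow> S + T \<in> N"
  and vna_diff: "S \<in> N \<Longrightarrow> T \<in> N \<Longrightarrow> S - T \<in> N"
  and vna_minus: "T \<in> N \<Longrightarrow> - T \<in> N"
  and vna_scale: "T \<in> N \<Longrightarrow> scaleC_bop c T \<in> N"
  by (auto simp: vna_iff[OF N] algebra_simps scaleC_bop_mult)

lemma vna_mult: "S \<in> N \<Longrightarrow> T \<in> N \<Longrightarrow> S * T \<in> N"
  unfolding vna_iff[OF N] by (metis mult.assoc)

lemma vna_sum: "(\<And>i. i \<in> I \<Longrightarrow> f i \<in> N) \<Longrightarrow> sum f I \<in> N"
  by (induction I rule: infinite_finite_induct) (auto intro: vna_zero vna_add)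

lemma vna_resolvent: "positive_bop s \<Longrightarrow> s \<in> N \<Longrightarrow> resolvent s \<in> N"
  unfolding vna_iff[OF N] by (metis resolvent_commute)

lemma vna_cut: "positive_bop s \<Longrightarrow> s \<in> N \<Longrightarrow> cut s \<in> N"
  unfolding cut_def by (intro vna_diff vna_one vna_resolvent)

lemma vna_inverse: "T \<in> N \<Longrightarrow> R * T = 1 \<Longrightarrow> T * R = 1 \<Longrightarrow> R \<in> N"
proof -
  assume T: "T \<in> N" and R: "R * T = 1" "T * R = 1"
  have "R * s = s * R" if "s \<in> commutant N" for s
  proof -
    have "T * s = s * T" using T that vna_iff[OF N] by blast
    then have "R * (T * s) * R = R * (s * T) * R" by simp
    then show ?thesis by (simp add: mult.assoc R) (simp add: R flip: mult.assoc)
  qed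
  then show ?thesis by (simp add: vna_iff[OF N])
qed

lemma vna_strong_limit:
  assumes a: "\<And>n. a n \<in> N" and l: "strong_limit a l"
  shows "l \<in> N"
proof -
  have "l * s = s * l" if "s \<in> commutant N" for s
  proof -
    have "a n * s = s * a n" for n using a that vna_iff[OF N] by blast
    then have "strong_limit (\<lambda>n. a n * s) (s * l)"
      using strong_limit_mult[OF l, of s 1] by simp
    moreover have "strong_limit (\<lambda>n. a n * s) (l * s)"
      using strong_limit_mult[OF l, of 1 s] by simp
    ultimately show ?thesis using strong_limit_unique by blast
  qed
  then show ?thesis by (simp add: vna_iff[OF N])
qed

text \<open>Positivity of a self-adjoint element can be read off from the algebra alone: it says that the
  spectrum lies in the nonnegative reals. If the form of \<open>x\<close> had a negative infimum \<open>- t\<close> over unit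
  vectors, then \<open>x + t\<close> would be positive with approximate null vectors, so not invertible.\<close>

lemma positive_iff_invertible:
  assumes x: "x \<in> N" "x\<^sup>\<dagger> = x"
  shows "positive_bop x \<longleftrightarrow> (\<forall>t>0. \<exists>y\<in>N. y * (x + t *\<^sub>r 1) = 1 \<and> (x + t *\<^sub>r 1) * y = 1)"
proof
  assume pos: "positive_bop x"
  show "\<forall>t>0. \<exists>y\<in>N. y * (x + t *\<^sub>r 1) = 1 \<and> (x + t *\<^sub>r 1) * y = 1"
  proof (intro allI impI)
    fix t :: real assume t: "t > 0"
    obtain y where y: "y * (x + t *\<^sub>r 1) = 1" "(x + t *\<^sub>r 1) * y = 1"
    proof (rule coercive_inverse[of "x + t *\<^sub>r 1" t])
      show "(x + t *\<^sub>r 1)\<^sup>\<dagger> = x + t *\<^sub>r 1" by (simp add: adj_add adj_scaleC x)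
      show "t * (norm v)\<^sup>2 \<le> Re (cinner v ((x + t *\<^sub>r 1) \<rhd> v))" for v
        using positive_form[OF pos, of v] by (simp add: cinner_simps cinner_self)
    qed (use t in auto)
    moreover have "y \<in> N" by (rule vna_inverse[OF _ y]) (intro vna_add vna_scale vna_one x)
    ultimately show "\<exists>y\<in>N. y * (x + t *\<^sub>r 1) = 1 \<and> (x + t *\<^sub>r 1) * y = 1" by blast
  qed
next
  assume inv: "\<forall>t>0. \<exists>y\<in>N. y * (x + t *\<^sub>r 1) = 1 \<and> (x + t *\<^sub>r 1) * y = 1"
  show "positive_bop x"
  proof (rule ccontr)
    define q where "q v = Re (cinner v (x \<rhd> v))" for v
    have q_scale: "q (r *\<^sub>R v) = r\<^sup>2 * q v" for r v
      by (simp add: q_def apply_bop_scaleR cinner_simps power2_eq_square)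
    assume "\<not> positive_bop x"
    then obtain v where v: "q v < 0" using x by (auto simp: positive_bop_iff q_def not_le)
    then have "v \<noteq> 0" by (auto simp: q_def)
    define U where "U = {u :: 'h. norm u = 1}"
    have u: "(1 / norm v) *\<^sub>R v \<in> U" using \<open>v \<noteq> 0\<close> by (simp add: U_def)
    define m where "m = (INF u\<in>U. q u)"
    have bdd: "bdd_below (q ` U)"
    proof (rule bdd_belowI2)
      fix w assume "w \<in> U"
      have "\<bar>q w\<bar> \<le> norm w * norm (x \<rhd> w)"
        unfolding q_def using abs_Re_le_cmod cinner_cauchy_schwarz order_trans by blast
      also have "\<dots> \<le> norm w * (bnorm x * norm w)" by (intro mult_left_mono bnorm_bound) auto
      finally show "- bnorm x \<le> q w" using \<open>w \<in> U\<close> by (simp add: U_def)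
    qed
    have "m \<le> q ((1 / norm v) *\<^sub>R v)" unfolding m_def by (rule cINF_lower[OF bdd u])
    also have "\<dots> < 0" using v \<open>v \<noteq> 0\<close> by (simp add: q_scale mult_less_0_iff divide_less_0_iff)
    finally have "m < 0" .
    \<comment> \<open>The form of \<open>T\<close> has infimum \<open>0\<close> over unit vectors, but \<open>T\<close> has an inverse by hypothesis.\<close>
    define T where "T = x + (- m) *\<^sub>r 1"
    have qm: "m * (norm w)\<^sup>2 \<le> q w" for w
    proof (cases "w = 0")
      case False
      then have "m \<le> q ((1 / norm w) *\<^sub>R w)"
        unfolding m_def by (intro cINF_lower[OF bdd]) (simp add: U_def)
      then show ?thesis using False by (simp add: q_scale field_simps power2_eq_square)
    qed (simp add: q_def)
    have T_form: "Re (cinner w (T \<rhd> w)) = q w - m * (norm w)\<^sup>2" for w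
      by (simp add: T_def q_def cinner_simps cinner_self)
    have T: "positive_bop T"
      using qm by (simp add: positive_bop_iff T_form) (simp add: T_def adj_add adj_scaleC x)
    have T_le: "T \<preceq> bnorm T *\<^sub>r 1" by (rule le_bop_bnorm[OF positive_selfadjoint[OF T]])
    obtain y where y: "y * T = 1" using inv \<open>m < 0\<close> unfolding T_def by (metis neg_0_less_iff_less)
    define K where "K = (bnorm y)\<^sup>2 * bnorm T"
    \<comment> \<open>An inverse keeps the form of \<open>T\<close> away from \<open>0\<close> on unit vectors.\<close>
    have K: "1 \<le> K * (q w - m)" if "w \<in> U" for w
    proof -
      have "1 = (norm (y \<rhd> T \<rhd> w))\<^sup>2" using y that by (simp add: U_def flip: apply_bop_simps(6))
      also have "\<dots> \<le> (bnorm y * norm (T \<rhd> w))\<^sup>2" by (intro power_mono bnorm_bound) auto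
      also have "\<dots> \<le> (bnorm y)\<^sup>2 * (bnorm T * Re (cinner w (T \<rhd> w)))"
        unfolding power_mult_distrib by (intro mult_left_mono norm_square_le_form[OF T T_le]) auto
      also have "\<dots> = K * (q w - m)" using that by (simp add: T_form K_def U_def)
      finally show ?thesis .
    qed
    have "K \<ge> 0" by (simp add: K_def bnorm_nonneg)
    moreover have "K \<noteq> 0" using K[OF u] by auto
    ultimately have "K > 0" by simp
    have "m < m + 1 / K" using \<open>K > 0\<close> by simp
    then obtain w where w: "w \<in> U" "q w < m + 1 / K"
      using cINF_less_iff[OF _ bdd, of "m + 1 / K"] u unfolding m_def by blast
    have "K * (q w - m) < K * (1 / K)" using w(2) \<open>K > 0\<close> by (intro mult_strict_left_mono) auto
    then show False using K[OF w(1)] \<open>K > 0\<close> by simp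
  qed
qed

end

subsection \<open>Order properties of star isomorphisms\<close>

locale vna_isomorphism =
  fixes B :: "'h::chilbert_space bop set" and N :: "'k::chilbert_space bop set" and \<pi> :: "'h bop \<Rightarrow> 'k bop"
  assumes B: "von_neumann_algebra B" and N: "von_neumann_algebra N" and iso: "star_isomorphism B N \<pi>"
begin

lemma bij: "bij_betw \<pi> B N"
  and add: "x \<in> B \<Longrightarrow> y \<in> B \<Longrightarrow> \<pi> (x + y) = \<pi> x + \<pi> y"
  and scale: "x \<in> B \<Longrightarrow> \<pi> (scaleC_bop c x) = scaleC_bop c (\<pi> x)"
  and mult: "x \<in> B \<Longrightarrow> y \<in> B \<Longrightarrow> \<pi> (x * y) = \<pi> x * \<pi> y"
  and adj: "x \<in> B \<Longrightarrow> \<pi> (x\<^sup>\<dagger>) = (\<pi> x)\<^sup>\<dagger>"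
  using iso unfolding star_isomorphism_def by blast+

lemma in_range: "x \<in> B \<Longrightarrow> \<pi> x \<in> N"
  using bij bij_betwE by blast

lemma preimage: assumes "y \<in> N" obtains x where "x \<in> B" "\<pi> x = y"
  using bij assms unfolding bij_betw_def by blast

lemma inject: "x \<in> B \<Longrightarrow> y \<in> B \<Longrightarrow> \<pi> x = \<pi> y \<longleftrightarrow> x = y"
  using bij unfolding bij_betw_def inj_on_def by blast

lemma diff: "x \<in> B \<Longrightarrow> y \<in> B \<Longrightarrow> \<pi> (x - y) = \<pi> x - \<pi> y"
  using add[of "x - y" y] by (simp add: vna_diff[OF B])

lemma zero: "\<pi> 0 = 0"
  using diff[of 0 0] by (simp add: vna_zero[OF B])

lemma one: "\<pi> 1 = 1"
proof -
  obtain e where e: "e \<in> B" "\<pi> e = 1" using preimage vna_one[OF N] by blast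
  have "\<pi> 1 = \<pi> 1 * \<pi> e" by (simp add: e)
  also have "\<dots> = \<pi> e" using mult[of 1 e] e vna_one[OF B] by simp
  finally show ?thesis by (simp add: e)
qed

lemma positive_iff: assumes x: "x \<in> B" shows "positive_bop (\<pi> x) \<longleftrightarrow> positive_bop x"
proof (cases "x\<^sup>\<dagger> = x")
  case True
  then have sa: "(\<pi> x)\<^sup>\<dagger> = \<pi> x" by (metis adj x)
  have sum: "\<pi> (x + t *\<^sub>r 1) = \<pi> x + t *\<^sub>r 1" "x + t *\<^sub>r 1 \<in> B" for t
    using x by (auto simp: add scale one vna_scale[OF B] vna_one[OF B] vna_add[OF B])
  have "y * (x + t *\<^sub>r 1) = 1 \<and> (x + t *\<^sub>r 1) * y = 1
      \<longleftrightarrow> \<pi> y * (\<pi> x + t *\<^sub>r 1) = 1 \<and> (\<pi> x + t *\<^sub>r 1) * \<pi> y = 1" if "y \<in> B" for y t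
    using that sum[of t] vna_mult[OF B] vna_one[OF B] by (metis inject mult one)
  moreover have "N = \<pi> ` B" using bij by (simp add: bij_betw_def)
  ultimately show ?thesis
    unfolding positive_iff_invertible[OF B x True] positive_iff_invertible[OF N in_range[OF x] sa] by auto
next
  case False
  then have "(\<pi> x)\<^sup>\<dagger> \<noteq> \<pi> x" using adj[OF x] inject vna_adj[OF B] x by metis
  then show ?thesis using False by (auto dest: positive_selfadjoint)
qed

lemma le_iff: "x \<in> B \<Longrightarrow> y \<in> B \<Longrightarrow> \<pi> x \<preceq> \<pi> y \<longleftrightarrow> x \<preceq> y"
  using positive_iff[of "y - x"] by (simp add: diff vna_diff[OF B])

text \<open>The strong limit of a bounded increasing sequence is its least upper bound in either algebra, so an
  order isomorphism carries one limit to the other. This stands in for ultraweak continuity of \<open>\<pi>\<close>.\<close>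

lemma strong_limit_iff:
  assumes a: "\<And>n. a n \<in> B" and pos: "\<And>n. positive_bop (a n)" and le1: "\<And>n. a n \<preceq> 1"
    and inc: "\<And>n. a n \<preceq> a (Suc n)" and l: "l \<in> B"
  shows "strong_limit (\<lambda>n. \<pi> (a n)) (\<pi> l) \<longleftrightarrow> strong_limit a l"
proof -
  obtain l' where l': "strong_limit a l'" using monotone_strong_limit pos le1 inc by blast
  have l'B: "l' \<in> B" by (rule vna_strong_limit[OF B a l'])
  \<comment> \<open>The limits on the two sides correspond to \<open>l'\<close> and \<open>k\<close> in \<open>B\<close>; each is an upper bound of the
    sequence, hence dominates the other.\<close>
  obtain g where g: "strong_limit (\<lambda>n. \<pi> (a n)) g"
    using monotone_strong_limit[of "\<lambda>n. \<pi> (a n)"] pos le1 inc a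
    by (metis le_iff positive_iff one vna_one[OF B])
  have "g \<in> N" by (rule vna_strong_limit[OF N in_range[OF a] g])
  then obtain k where k: "k \<in> B" "\<pi> k = g" using preimage by blast
  have "\<pi> (a n) \<preceq> \<pi> k" for n
    unfolding k(2) using a inc by (intro strong_limit_ge[OF g]) (simp add: le_iff)
  then have "l' \<preceq> k" using a k le_iff by (intro strong_limit_le[OF l']) blast
  moreover have "\<pi> (a n) \<preceq> \<pi> l'" for n
    using strong_limit_ge[OF l' inc] a l'B le_iff by blast
  then have "\<pi> k \<preceq> \<pi> l'" unfolding k(2) by (rule strong_limit_le[OF g])
  then have "k \<preceq> l'" using k l'B le_iff by blast
  ultimately have "k = l'" using le_bop_antisym by blast
  then have gl: "strong_limit (\<lambda>n. \<pi> (a n)) (\<pi> l')" using g k by simp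
  show ?thesis
  proof
    assume "strong_limit (\<lambda>n. \<pi> (a n)) (\<pi> l)"
    then have "\<pi> l = \<pi> l'" using gl strong_limit_unique by blast
    then show "strong_limit a l" using l' l l'B inject by simp
  next
    assume "strong_limit a l"
    then have "l = l'" using l' strong_limit_unique by blast
    then show "strong_limit (\<lambda>n. \<pi> (a n)) (\<pi> l)" using gl by simp
  qed
qed

end

section \<open>The ultraweak topology along sequences\<close>

lemma summable_cinner_bound:
  fixes \<xi> \<eta> :: "nat \<Rightarrow> 'h::chilbert_space"
  assumes "summable (\<lambda>n. (norm (\<xi> n))\<^sup>2)" "summable (\<lambda>n. (norm (\<eta> n))\<^sup>2)"
  shows "summable (\<lambda>n. norm (\<xi> n) * norm (\<eta> n))"
proof (rule summable_comparison_test)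
  have "norm (\<xi> n) * norm (\<eta> n) \<le> (norm (\<xi> n))\<^sup>2 + (norm (\<eta> n))\<^sup>2" for n    using sum_squares_bound[of "norm (\<xi> n)" "norm (\<eta> n)"]
      mult_nonneg_nonneg[OF norm_ge_zero norm_ge_zero, of "\<xi> n" "\<eta> n"] by linarith
  then show "\<exists>N. \<forall>n\<ge>N. norm (norm (\<xi> n) * norm (\<eta> n)) \<le> (norm (\<xi> n))\<^sup>2 + (norm (\<eta> n))\<^sup>2" by simp
qed (intro summable_add assms)

lemma summable_ultraweak:
  fixes \<xi> \<eta> :: "nat \<Rightarrow> 'h::chilbert_space"
  assumes "summable (\<lambda>n. (norm (\<xi> n))\<^sup>2)" "summable (\<lambda>n. (norm (\<eta> n))\<^sup>2)"
  shows "summable (\<lambda>n. cinner (\<xi> n) (T \<rhd> \<eta> n))"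
proof (rule summable_comparison_test)
  have "cmod (cinner (\<xi> n) (T \<rhd> \<eta> n)) \<le> bnorm T * (norm (\<xi> n) * norm (\<eta> n))" for n
  proof -
    have "cmod (cinner (\<xi> n) (T \<rhd> \<eta> n)) \<le> norm (\<xi> n) * norm (T \<rhd> \<eta> n)" by (rule cinner_cauchy_schwarz)
    also have "\<dots> \<le> norm (\<xi> n) * (bnorm T * norm (\<eta> n))" by (intro mult_left_mono bnorm_bound) auto
    finally show ?thesis by (simp add: ac_simps)
  qed
  then show "\<exists>N. \<forall>n\<ge>N. norm (cinner (\<xi> n) (T \<rhd> \<eta> n)) \<le> bnorm T * (norm (\<xi> n) * norm (\<eta> n))" by simp
qed (intro summable_mult summable_cinner_bound assms)

text \<open>Dominated convergence for series.\<close>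

lemma ultraweak_functional_limit:
  assumes l: "strong_limit a l" and C: "\<And>n x. norm (a n \<rhd> x) \<le> C * norm x"
    and s: "summable (\<lambda>n. (norm (\<xi> n))\<^sup>2)" "summable (\<lambda>n. (norm (\<eta> n))\<^sup>2)"
  shows "(\<lambda>n. ultraweak_functional \<xi> \<eta> (a n)) \<longlonglongrightarrow> ultraweak_functional \<xi> \<eta> l"
  unfolding ultraweak_functional_def
proof (rule tannerys_theorem[THEN conjunct2, THEN conjunct2])
  show "(\<lambda>n. cinner (\<xi> k) (a n \<rhd> \<eta> k)) \<longlonglongrightarrow> cinner (\<xi> k) (l \<rhd> \<eta> k)" for k
    by (rule strong_limit_form[OF l])
  show "summable (\<lambda>k. C * (norm (\<xi> k) * norm (\<eta> k)))"
    by (intro summable_mult summable_cinner_bound s)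
  have "cmod (cinner (\<xi> k) (a n \<rhd> \<eta> k)) \<le> C * (norm (\<xi> k) * norm (\<eta> k))" for k n
  proof -
    have "cmod (cinner (\<xi> k) (a n \<rhd> \<eta> k)) \<le> norm (\<xi> k) * norm (a n \<rhd> \<eta> k)" by (rule cinner_cauchy_schwarz)
    also have "\<dots> \<le> norm (\<xi> k) * (C * norm (\<eta> k))" by (intro mult_left_mono C) auto
    finally show ?thesis by (simp add: ac_simps)
  qed
  then show "\<forall>\<^sub>F (k, n) in at_top \<times>\<^sub>F sequentially.
      cmod (cinner (\<xi> k) (a n \<rhd> \<eta> k)) \<le> C * (norm (\<xi> k) * norm (\<eta> k))"
    by (intro always_eventually) auto
qed auto

lemma limitin_ultraweak:
  assumes l: "strong_limit a l" and C: "\<And>n x. norm (a n \<rhd> x) \<le> C * norm x"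
  shows "limitin ultraweak_topology a l sequentially"
proof -
  let ?S = "{ultraweak_functional \<xi> \<eta> -` U | \<xi> \<eta> U.
        summable (\<lambda>n. (norm (\<xi> n :: 'a))\<^sup>2) \<and> summable (\<lambda>n. (norm (\<eta> n))\<^sup>2) \<and> open U}"
  have "l \<in> V \<longrightarrow> eventually (\<lambda>n. a n \<in> V) sequentially" if "generate_topology_on ?S V" for V
    using that
  proof induction
    case (Int V W)
    then show ?case by (auto intro: eventually_conj)
  next
    case (UN K)
    show ?case
    proof
      assume "l \<in> \<Union>K"
      then obtain X where "X \<in> K" "l \<in> X" by blast
      then have "\<forall>\<^sub>F n in sequentially. a n \<in> X" using UN.IH by blast
      then show "\<forall>\<^sub>F n in sequentially. a n \<in> \<Union>K" using \<open>X \<in> K\<close> by (auto elim: eventually_mono)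
    qed
  next
    case (Basis V)
    then obtain \<xi> \<eta> U where V: "V = ultraweak_functional \<xi> \<eta> -` U" "open U"
      "summable (\<lambda>n. (norm (\<xi> n :: 'a))\<^sup>2)" "summable (\<lambda>n. (norm (\<eta> n))\<^sup>2)" by blast
    show ?case
      using topological_tendstoD[OF ultraweak_functional_limit[OF l C V(3,4)] V(2)] V(1) by auto
  qed auto
  moreover have "l \<in> \<Union>?S"
    by (rule UnionI[of "ultraweak_functional (\<lambda>_. 0) (\<lambda>_. 0) -` UNIV"]) (auto intro!: exI[of _ "\<lambda>_. 0"] exI[of _ UNIV])
  ultimately show ?thesis
    unfolding limitin_def ultraweak_topology_def openin_topology_generated_by_iff topology_generated_by_topspace
    by blast
qed

lemma limitin_ultraweak_form:
  assumes "limitin ultraweak_topology a l sequentially"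
  shows "(\<lambda>n. cinner x (a n \<rhd> y)) \<longlonglongrightarrow> cinner x (l \<rhd> y)"
proof -
  define e :: "'a \<Rightarrow> nat \<Rightarrow> 'a" where "e v n = (if n = 0 then v else 0)" for v n
  have e: "summable (\<lambda>n. (norm (e v n))\<^sup>2)" for v
    by (rule summable_finite[of "{0}"]) (auto simp: e_def)
  have f: "ultraweak_functional (e x) (e y) T = cinner x (T \<rhd> y)" for T
    unfolding ultraweak_functional_def using suminf_finite[of "{0}" "\<lambda>n. cinner (e x n) (T \<rhd> e y n)"]
    by (auto simp: e_def)
  show ?thesis
  proof (rule topological_tendstoI)
    fix U assume U: "open U" "cinner x (l \<rhd> y) \<in> U"
    have "openin ultraweak_topology (ultraweak_functional (e x) (e y) -` U)"
      unfolding ultraweak_topology_def using e U(1) by (intro topology_generated_by_Basis) blast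
    then show "\<forall>\<^sub>F n in sequentially. cinner x (a n \<rhd> y) \<in> U"
      using assms U(2) unfolding limitin_def by (auto simp: f)
  qed
qed

lemma normal_functional_limit:
  assumes "normal_functional N \<phi>" "\<And>n. a n \<in> N" "l \<in> N" "strong_limit a l"
    and "\<And>n x. norm (a n \<rhd> x) \<le> C * norm x"
  shows "(\<lambda>n. \<phi> (a n)) \<longlonglongrightarrow> \<phi> l"
proof -
  have "limitin (subtopology ultraweak_topology N) a l sequentially"
    using assms(2,3) limitin_ultraweak[OF assms(4,5)] by (simp add: limitin_subtopology)
  then have "limitin euclidean (\<phi> \<circ> a) (\<phi> l) sequentially"
    by (rule continuous_map_limit[OF assms(1)[unfolded normal_functional_def]])
  then show ?thesis by (simp add: comp_def)
qed

lemma normal_map_limit_form: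
  assumes "normal_map N N' \<Phi>" "\<And>n. a n \<in> N" "l \<in> N" "strong_limit a l"
    and "\<And>n x. norm (a n \<rhd> x) \<le> C * norm x"
  shows "(\<lambda>n. cinner x (\<Phi> (a n) \<rhd> y)) \<longlonglongrightarrow> cinner x (\<Phi> l \<rhd> y)"
proof -
  have "limitin (subtopology ultraweak_topology N) a l sequentially"
    using assms(2,3) limitin_ultraweak[OF assms(4,5)] by (simp add: limitin_subtopology)
  then have "limitin (subtopology ultraweak_topology N') (\<Phi> \<circ> a) (\<Phi> l) sequentially"
    by (rule continuous_map_limit[OF assms(1)[unfolded normal_map_def]])
  then show ?thesis
    using limitin_ultraweak_form[of "\<Phi> \<circ> a" "\<Phi> l"] by (simp add: limitin_subtopology comp_def)
qed

section \<open>Square-summable sequences and the density theorem\<close>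

lemma summable_norm_square_add:
  fixes f g :: "nat \<Rightarrow> 'h::real_normed_vector"
  assumes "summable (\<lambda>n. (norm (f n))\<^sup>2)" "summable (\<lambda>n. (norm (g n))\<^sup>2)"
  shows "summable (\<lambda>n. (norm (f n + g n))\<^sup>2)"
proof (rule summable_comparison_test)
  have "(norm (f n + g n))\<^sup>2 \<le> 2 * (norm (f n))\<^sup>2 + 2 * (norm (g n))\<^sup>2" for n
  proof -
    have "(norm (f n + g n))\<^sup>2 \<le> (norm (f n) + norm (g n))\<^sup>2"
      by (intro power_mono norm_triangle_ineq) auto
    then show ?thesis
      using sum_squares_bound[of "norm (f n)" "norm (g n)"] by (simp add: power2_sum)
  qed
  then show "\<exists>N. \<forall>n\<ge>N. norm ((norm (f n + g n))\<^sup>2) \<le> 2 * (norm (f n))\<^sup>2 + 2 * (norm (g n))\<^sup>2" by simp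
qed (intro summable_add summable_mult assms)

text \<open>Ultraweak functionals involve infinitely many vectors at once. On square-summable sequences such a
  functional becomes a single matrix coefficient of the operator acting diagonally.\<close>

typedef (overloaded) 'h ell2 = "{f :: nat \<Rightarrow> 'h::chilbert_space. summable (\<lambda>n. (norm (f n))\<^sup>2)}"
  morphisms coord Ell2
  by (rule exI[of _ "\<lambda>_. 0"]) simp

setup_lifting type_definition_ell2

lemma summable_coord: "summable (\<lambda>n. (norm (coord x n))\<^sup>2)"
  using coord by auto

lemma ell2_eqI: "x = y" if "\<And>n. coord x n = coord y n"
  using that by (simp add: coord_inject[symmetric] fun_eq_iff)

instantiation ell2 :: (chilbert_space) real_vector
begin

lift_definition zero_ell2 :: "'a ell2" is "\<lambda>_. 0" by simp
lift_definition plus_ell2 :: "'a ell2 \<Rightarrow> 'a ell2 \<Rightarrow> 'a ell2" is "\<lambda>f g n. f n + g n"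
  by (rule summable_norm_square_add)
lift_definition uminus_ell2 :: "'a ell2 \<Rightarrow> 'a ell2" is "\<lambda>f n. - f n" by simp
lift_definition minus_ell2 :: "'a ell2 \<Rightarrow> 'a ell2 \<Rightarrow> 'a ell2" is "\<lambda>f g n. f n - g n"
  using summable_norm_square_add[of _ "\<lambda>n. - _ n"] by simp
lift_definition scaleR_ell2 :: "real \<Rightarrow> 'a ell2 \<Rightarrow> 'a ell2" is "\<lambda>r f n. r *\<^sub>R f n"
  by (simp add: power_mult_distrib summable_mult)

instance
  by standard (transfer; simp add: fun_eq_iff algebra_simps)+

end

lemma coord_simps [simp]:
  "coord 0 n = 0" "coord (x + y) n = coord x n + coord y n" "coord (- x) n = - coord x n"
  "coord (x - y) n = coord x n - coord y n" "coord (r *\<^sub>R x) n = r *\<^sub>R coord x n"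
  by (transfer; simp)+

instantiation ell2 :: (chilbert_space) real_normed_vector
begin

definition norm_ell2 :: "'a ell2 \<Rightarrow> real" where
  "norm_ell2 x = sqrt (\<Sum>n. (norm (coord x n))\<^sup>2)"
definition sgn_ell2 :: "'a ell2 \<Rightarrow> 'a ell2" where
  "sgn_ell2 x = x /\<^sub>R norm x"
definition dist_ell2 :: "'a ell2 \<Rightarrow> 'a ell2 \<Rightarrow> real" where
  "dist_ell2 x y = norm (x - y)"
definition uniformity_ell2 :: "('a ell2 \<times> 'a ell2) filter" where
  "uniformity_ell2 = (INF e\<in>{0<..}. principal {(x, y). dist x y < e})"
definition open_ell2 :: "'a ell2 set \<Rightarrow> bool" where
  "open_ell2 U = (\<forall>x\<in>U. \<forall>\<^sub>F (x', y) in uniformity. x' = x \<longrightarrow> y \<in> U)"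

lemma norm_ell2_square: "(norm (x :: 'a ell2))\<^sup>2 = (\<Sum>n. (norm (coord x n))\<^sup>2)"
  unfolding norm_ell2_def by (simp add: suminf_nonneg summable_coord)

lemma L2_set_le_norm_ell2: "L2_set (\<lambda>n. norm (coord x n)) {..<N} \<le> norm (x :: 'a ell2)"
  unfolding L2_set_def norm_ell2_def
  by (intro real_sqrt_le_mono sum_le_suminf summable_coord) auto

lemma norm_ell2_leI:
  assumes "\<And>N. L2_set (\<lambda>n. norm (coord x n)) {..<N} \<le> c" "0 \<le> c"
  shows "norm (x :: 'a ell2) \<le> c"
proof -
  have "(\<Sum>n<N. (norm (coord x n))\<^sup>2) \<le> c\<^sup>2" for N
    using assms(1)[of N] unfolding L2_set_def by (meson real_sqrt_le_iff sqrt_le_D)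
  then have "(\<Sum>n. (norm (coord x n))\<^sup>2) \<le> c\<^sup>2" by (intro suminf_le_const summable_coord)
  then show ?thesis unfolding norm_ell2_def using assms(2) by (simp add: real_le_lsqrt)
qed

instance
proof
  fix x y :: "'a ell2" and r :: real
  show "norm x = 0 \<longleftrightarrow> x = 0"
  proof
    assume "norm x = 0"
    then have "(\<Sum>n. (norm (coord x n))\<^sup>2) = 0" by (simp add: norm_ell2_def)
    then have "\<forall>n. (norm (coord x n))\<^sup>2 = 0"
      by (subst (asm) suminf_eq_zero_iff[OF summable_coord]) auto
    then show "x = 0" by (intro ell2_eqI) simp
  qed (simp add: norm_ell2_def)
  show "norm (x + y) \<le> norm x + norm y"
  proof (rule norm_ell2_leI)
    fix N
    have "L2_set (\<lambda>n. norm (coord (x + y) n)) {..<N} \<le> L2_set (\<lambda>n. norm (coord x n) + norm (coord y n)) {..<N}"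
      by (intro L2_set_mono) (auto intro: norm_triangle_ineq)
    also have "\<dots> \<le> L2_set (\<lambda>n. norm (coord x n)) {..<N} + L2_set (\<lambda>n. norm (coord y n)) {..<N}"
      by (rule L2_set_triangle_ineq)
    also have "\<dots> \<le> norm x + norm y" by (intro add_mono L2_set_le_norm_ell2)
    finally show "L2_set (\<lambda>n. norm (coord (x + y) n)) {..<N} \<le> norm x + norm y" .
  qed (simp add: norm_ell2_def suminf_nonneg summable_coord)
  show "norm (r *\<^sub>R x) = \<bar>r\<bar> * norm x"
    unfolding norm_ell2_def
    by (simp add: power_mult_distrib suminf_mult summable_coord real_sqrt_mult)
qed (simp_all add: sgn_ell2_def dist_ell2_def uniformity_ell2_def open_ell2_def)

end

lemma norm_coord_le: "norm (coord x n) \<le> norm x"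
proof -
  have "norm (coord x n) \<le> L2_set (\<lambda>n. norm (coord x n)) {..<Suc n}"
    by (rule member_le_L2_set) auto
  also have "\<dots> \<le> norm x" by (rule L2_set_le_norm_ell2)
  finally show ?thesis .
qed

lemma bounded_linear_coord: "bounded_linear (\<lambda>x. coord x n)"
  by (rule bounded_linear_intro[where K = 1]) (auto simp: norm_coord_le)

instance ell2 :: (chilbert_space) banach
proof
  fix X :: "nat \<Rightarrow> 'a ell2" assume X: "Cauchy X"
  have "Cauchy (\<lambda>m. coord (X m) n)" for n
    using bounded_linear.Cauchy[OF bounded_linear_coord X] .
  then obtain L where L: "\<And>n. (\<lambda>m. coord (X m) n) \<longlonglongrightarrow> L n"
    unfolding Cauchy_convergent_iff convergent_def by metis
  have part: "(\<Sum>n<N. (norm (coord (X m) n - L n))\<^sup>2) \<le> e\<^sup>2"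
    if M: "\<And>m n. m \<ge> M \<Longrightarrow> n \<ge> M \<Longrightarrow> norm (X m - X n) < e" and m: "m \<ge> M" for M m e N
  proof (rule LIMSEQ_le_const2)
    show "(\<lambda>k. \<Sum>n<N. (norm (coord (X m) n - coord (X k) n))\<^sup>2)
        \<longlonglongrightarrow> (\<Sum>n<N. (norm (coord (X m) n - L n))\<^sup>2)"
      by (intro tendsto_intros L)
    have "(\<Sum>n<N. (norm (coord (X m) n - coord (X k) n))\<^sup>2) \<le> e\<^sup>2" if "k \<ge> M" for k
    proof -
      have "L2_set (\<lambda>n. norm (coord (X m - X k) n)) {..<N} \<le> e"
        by (rule order_trans[OF L2_set_le_norm_ell2 less_imp_le[OF M[OF m that]]])
      then show ?thesis unfolding L2_set_def by (simp add: sqrt_le_D)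
    qed
    then show "\<exists>M. \<forall>k\<ge>M. (\<Sum>n<N. (norm (coord (X m) n - coord (X k) n))\<^sup>2) \<le> e\<^sup>2" by blast
  qed
  have "summable (\<lambda>n. (norm (L n))\<^sup>2)"
  proof -
    obtain M where "\<forall>m\<ge>M. \<forall>n\<ge>M. norm (X m - X n) < 1" using CauchyD[OF X, of 1] by auto
    then have "\<And>N. (\<Sum>n<N. (norm (coord (X M) n - L n))\<^sup>2) \<le> 1\<^sup>2"
      by (intro part[of M]) auto
    then have "summable (\<lambda>n. (norm (coord (X M) n - L n))\<^sup>2)"
      by (intro summableI_nonneg_bounded) auto
    then have "summable (\<lambda>n. (norm (L n - coord (X M) n))\<^sup>2)" by (simp add: norm_minus_commute)
    from summable_norm_square_add[OF this summable_coord[of "X M"]] show ?thesis by simp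
  qed
  then have cL: "coord (Ell2 L) = L" by (simp add: Ell2_inverse)
  have "X \<longlonglongrightarrow> Ell2 L"
  proof (rule LIMSEQ_I)
    fix e :: real assume e: "e > 0"
    then obtain M where M: "\<forall>m\<ge>M. \<forall>n\<ge>M. norm (X m - X n) < e / 2" using CauchyD[OF X, of "e / 2"] by auto
    have "norm (X m - Ell2 L) < e" if "m \<ge> M" for m
    proof -
      have "norm (X m - Ell2 L) \<le> e / 2"
      proof (rule norm_ell2_leI)
        fix N
        have "(\<Sum>n<N. (norm (coord (X m) n - L n))\<^sup>2) \<le> (e / 2)\<^sup>2"
          using M that by (intro part[of M]) auto
        then show "L2_set (\<lambda>n. norm (coord (X m - Ell2 L) n)) {..<N} \<le> e / 2"
          unfolding L2_set_def using e by (intro real_le_lsqrt) (auto simp: cL)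
      qed (use e in simp)
      then show ?thesis using e by simp
    qed
    then show "\<exists>M. \<forall>m\<ge>M. norm (X m - Ell2 L) < e" by blast
  qed
  then show "convergent X" by (auto simp: convergent_def)
qed

lemma summable_cinner_coord: "summable (\<lambda>n. cinner (coord x n) (coord y n))"
  using summable_ultraweak[OF summable_coord summable_coord, where T = 1] by simp

instantiation ell2 :: (chilbert_space) chilbert_space
begin

lift_definition scaleC_ell2 :: "complex \<Rightarrow> 'a ell2 \<Rightarrow> 'a ell2" is "\<lambda>c f n. c *\<^sub>C f n"
  by (simp add: norm_scaleC power_mult_distrib summable_mult)

definition cinner_ell2 :: "'a ell2 \<Rightarrow> 'a ell2 \<Rightarrow> complex" where
  "cinner_ell2 x y = (\<Sum>n. cinner (coord x n) (coord y n))"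

lemma coord_scaleC [simp]: "coord (c *\<^sub>C x) n = c *\<^sub>C coord x n"
  by transfer simp

instance
proof
  fix x y z :: "'a ell2" and c d :: complex and r :: real
  show "c *\<^sub>C (x + y) = c *\<^sub>C x + c *\<^sub>C y" "(c + d) *\<^sub>C x = c *\<^sub>C x + d *\<^sub>C x"
    "c *\<^sub>C d *\<^sub>C x = (c * d) *\<^sub>C x" "complex_of_real r *\<^sub>C x = r *\<^sub>R x"
    by (rule ell2_eqI; simp add: scaleC_add_right scaleC_add_left scaleC_scaleC scaleC_of_real)+
  show "cinner x y = cnj (cinner y x)"
    unfolding cinner_ell2_def
    by (rule sums_unique[symmetric], subst cinner_commute)
       (intro sums_cnj[THEN iffD2] summable_sums summable_cinner_coord)
  show "cinner x (y + z) = cinner x y + cinner x z"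
    unfolding cinner_ell2_def by (simp add: cinner_simps suminf_add summable_cinner_coord)
  show "cinner x (c *\<^sub>C y) = c * cinner x y"
    unfolding cinner_ell2_def by (simp add: cinner_simps suminf_mult summable_cinner_coord)
  show "cinner x x = complex_of_real ((norm x)\<^sup>2)"
    unfolding cinner_ell2_def norm_ell2_square cinner_self
    by (simp add: suminf_of_real summable_coord flip: of_real_power)
qed

end

lift_definition single :: "nat \<Rightarrow> 'h::chilbert_space \<Rightarrow> 'h ell2" is "\<lambda>m v n. if n = m then v else 0"
  by (rule summable_finite[of "{_}"]) auto

lift_definition amplify :: "'h::chilbert_space bop \<Rightarrow> 'h ell2 \<Rightarrow> 'h ell2" is "\<lambda>T f n. T \<rhd> f n"
proof -
  fix T :: "'h bop" and f :: "nat \<Rightarrow> 'h" assume f: "summable (\<lambda>n. (norm (f n))\<^sup>2)"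
  show "summable (\<lambda>n. (norm (T \<rhd> f n))\<^sup>2)"
  proof (rule summable_comparison_test)
    have "(norm (T \<rhd> f n))\<^sup>2 \<le> (bnorm T)\<^sup>2 * (norm (f n))\<^sup>2" for n
      using power_mono[OF bnorm_bound norm_ge_zero, of T "f n" 2] by (simp add: power_mult_distrib)
    then show "\<exists>N. \<forall>n\<ge>N. norm ((norm (T \<rhd> f n))\<^sup>2) \<le> (bnorm T)\<^sup>2 * (norm (f n))\<^sup>2" by simp
  qed (intro summable_mult f)
qed

lemma coord_single [simp]: "coord (single m v) n = (if n = m then v else 0)"
  and coord_amplify [simp]: "coord (amplify T x) n = T \<rhd> coord x n"
  by (transfer; simp)+

lemma amplify_simps:
  "amplify (S + T) x = amplify S x + amplify T x" "amplify (S - T) x = amplify S x - amplify T x"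
  "amplify (S * T) x = amplify S (amplify T x)" "amplify 1 x = x" "amplify 0 x = 0"
  "amplify (scaleC_bop c T) x = c *\<^sub>C amplify T x"
  "amplify T (x + y) = amplify T x + amplify T y" "amplify T (x - y) = amplify T x - amplify T y"
  "amplify T (c *\<^sub>C x) = c *\<^sub>C amplify T x" "amplify T (r *\<^sub>R x) = r *\<^sub>R amplify T x"
  "amplify T (single m v) = single m (T \<rhd> v)"
  by (rule ell2_eqI; simp add: apply_bop_add apply_bop_diff apply_bop_scaleC apply_bop_scaleR)+

lemma bounded_linear_amplify: "bounded_linear (amplify T)"
proof (rule bounded_linear_intro[where K = "bnorm T"])
  fix x
  show "norm (amplify T x) \<le> norm x * bnorm T"
  proof (rule norm_ell2_leI)
    fix N
    have "L2_set (\<lambda>n. norm (coord (amplify T x) n)) {..<N} \<le> L2_set (\<lambda>n. bnorm T * norm (coord x n)) {..<N}"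
      by (intro L2_set_mono) (auto intro: bnorm_bound)
    also have "\<dots> = bnorm T * L2_set (\<lambda>n. norm (coord x n)) {..<N}"
      by (simp add: L2_set_right_distrib bnorm_nonneg)
    also have "\<dots> \<le> bnorm T * norm x" by (intro mult_left_mono L2_set_le_norm_ell2 bnorm_nonneg)
    finally show "L2_set (\<lambda>n. norm (coord (amplify T x) n)) {..<N} \<le> norm x * bnorm T" by (simp add: mult.commute)
  qed (simp add: bnorm_nonneg)
qed (simp_all add: amplify_simps)

lemma cinner_amplify: "cinner x (amplify T y) = cinner (amplify (T\<^sup>\<dagger>) x) y"
  by (simp add: cinner_ell2_def cinner_adj_left)

lemma single_sums: "(\<lambda>n. single n (coord x n)) sums x"
  unfolding sums_def
proof (rule LIMSEQ_I)
  fix e :: real assume e: "e > 0"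
  have coord_sum: "coord (\<Sum>n<N. single n (coord x n)) k = (if k < N then coord x k else 0)" for N k
    by (induction N) (auto simp: less_Suc_eq)
  obtain M where M: "\<And>N. N \<ge> M \<Longrightarrow> norm (\<Sum>n. (norm (coord x (n + N)))\<^sup>2) < (e / 2)\<^sup>2"
    using suminf_exist_split[OF _ summable_coord, of "(e / 2)\<^sup>2" x] e by auto
  have "norm ((\<Sum>n<N. single n (coord x n)) - x) < e" if "N \<ge> M" for N
  proof -
    have "norm ((\<Sum>n<N. single n (coord x n)) - x) \<le> e / 2"
    proof (rule norm_ell2_leI)
      fix K
      have "(\<Sum>k<K. (norm (coord ((\<Sum>n<N. single n (coord x n)) - x) k))\<^sup>2)
          = (\<Sum>k\<in>{N..<K}. (norm (coord x k))\<^sup>2)"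
        by (rule sum.mono_neutral_cong_right) (auto simp: coord_sum)
      also have "\<dots> \<le> (\<Sum>k\<in>{N..<K + N}. (norm (coord x k))\<^sup>2)"
        by (rule sum_mono2) auto
      also have "\<dots> = (\<Sum>k<K. (norm (coord x (k + N)))\<^sup>2)"
        using sum.shift_bounds_nat_ivl[of "\<lambda>k. (norm (coord x k))\<^sup>2" 0 N K] by (simp add: atLeast0LessThan)
      also have "\<dots> \<le> (\<Sum>n. (norm (coord x (n + N)))\<^sup>2)"
        by (intro sum_le_suminf summable_ignore_initial_segment summable_coord) auto
      also have "\<dots> \<le> (e / 2)\<^sup>2" using M[OF that] by simp
      finally show "L2_set (\<lambda>k. norm (coord ((\<Sum>n<N. single n (coord x n)) - x) k)) {..<K} \<le> e / 2"
        unfolding L2_set_def using e by (intro real_le_lsqrt) auto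
    qed (use e in simp)
    then show ?thesis using e by simp
  qed
  then show "\<exists>M. \<forall>N\<ge>M. norm ((\<Sum>n<N. single n (coord x n)) - x) < e" by blast
qed

lemma sums_interleave:
  fixes f g :: "nat \<Rightarrow> complex"
  assumes "f sums x" "g sums y"
  shows "(\<lambda>n. if even n then f (n div 2) else g ((n - 1) div 2)) sums (x + y)"
proof -
  have "(\<lambda>n. if even n then h (f (n div 2)) else h (g ((n - 1) div 2))) sums (h x + h y)"
    if "\<And>f x. f sums x \<Longrightarrow> (\<lambda>n. h (f n)) sums (h x :: real)" for h
    using sums_if[OF that[OF assms(2)] that[OF assms(1)]] by (simp add: add.commute)
  from this[of Re] this[of Im] show ?thesis
    by (simp add: sums_complex_iff if_distrib)
qed

text \<open>Merging two sequences into one lets a single vector control two ultraweak functionals, or express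
  their sum.\<close>

lift_definition interleave :: "'h::chilbert_space ell2 \<Rightarrow> 'h ell2 \<Rightarrow> 'h ell2" is
  "\<lambda>f g n. if even n then f (n div 2) else g ((n - 1) div 2)"
proof -
  fix f g :: "nat \<Rightarrow> 'h" assume "summable (\<lambda>n. (norm (f n))\<^sup>2)" "summable (\<lambda>n. (norm (g n))\<^sup>2)"
  then have "summable (\<lambda>n. if even n then (norm (f (n div 2)))\<^sup>2 else (norm (g ((n - 1) div 2)))\<^sup>2)"
    using sums_if unfolding summable_def by blast
  then show "summable (\<lambda>n. (norm (if even n then f (n div 2) else g ((n - 1) div 2)))\<^sup>2)"
    by (rule back_subst[of summable]) (auto simp: fun_eq_iff)
qed

lemma coord_interleave: "coord (interleave x y) n = (if even n then coord x (n div 2) else coord y ((n - 1) div 2))"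
  by transfer simp

lemma cinner_interleave: "cinner (interleave x y) (interleave x' y') = cinner x x' + cinner y y'"
proof -
  have "(\<lambda>n. cinner (coord (interleave x y) n) (coord (interleave x' y') n)) sums (cinner x x' + cinner y y')"
    by (rule back_subst[of "\<lambda>f. f sums _", OF sums_interleave[OF summable_sums[OF summable_cinner_coord, of x x']
            summable_sums[OF summable_cinner_coord, of y y'], folded cinner_ell2_def]])
       (auto simp: fun_eq_iff coord_interleave)
  then show ?thesis by (simp add: cinner_ell2_def sums_iff)
qed

lemma amplify_interleave: "amplify T (interleave x y) = interleave (amplify T x) (amplify T y)"
  by (rule ell2_eqI) (simp add: coord_interleave)

lemma norm_interleave: "(norm (interleave x y))\<^sup>2 = (norm x)\<^sup>2 + (norm y)\<^sup>2"
  by (simp add: cinner_interleave flip: Re_cinner_self)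

lemma subspace_closure:
  fixes V :: "'a::real_normed_vector set"
  assumes V: "subspace V" shows "subspace (closure V)"
proof (rule subspaceI)
  show "0 \<in> closure V" using subspace_0[OF V] closure_subset by blast
  show "x + y \<in> closure V" if "x \<in> closure V" "y \<in> closure V" for x y
  proof -
    obtain f g where "\<forall>n. f n \<in> V" "f \<longlonglongrightarrow> x" "\<forall>n. g n \<in> V" "g \<longlonglongrightarrow> y"
      using \<open>x \<in> closure V\<close> \<open>y \<in> closure V\<close> unfolding closure_sequential by blast
    then show ?thesis unfolding closure_sequential
      by (intro exI[of _ "\<lambda>n. f n + g n"]) (auto intro: tendsto_add subspace_add[OF V])
  qed
  show "r *\<^sub>R x \<in> closure V" if "x \<in> closure V" for r x
  proof -
    obtain f where "\<forall>n. f n \<in> V" "f \<longlonglongrightarrow> x"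
      using \<open>x \<in> closure V\<close> unfolding closure_sequential by blast
    then show ?thesis unfolding closure_sequential
      by (intro exI[of _ "\<lambda>n. r *\<^sub>R f n"]) (auto intro: tendsto_scaleR subspace_scale[OF V])
  qed
qed

lemma real_imaginary_parts:
  obtains a b where "x = a + scaleC_bop \<i> b" "x\<^sup>\<dagger> = a - scaleC_bop \<i> b" "a\<^sup>\<dagger> = a" "b\<^sup>\<dagger> = b"
    "a = scaleC_bop (1/2) (x + x\<^sup>\<dagger>)" "b = scaleC_bop (- \<i> / 2) (x - x\<^sup>\<dagger>)"
proof -
  define a b where "a = scaleC_bop (1/2) (x + x\<^sup>\<dagger>)" and "b = scaleC_bop (- \<i> / 2) (x - x\<^sup>\<dagger>)"
  have half: "scaleC_bop (1/2) y + scaleC_bop (1/2) y = y" for y :: "'a bop"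
    by (simp add: scaleC_bop_simps flip: scaleC_bop_simps(3))
  have ib: "scaleC_bop \<i> b = scaleC_bop (1/2) x - scaleC_bop (1/2) (x\<^sup>\<dagger>)"
    by (simp add: b_def scaleC_bop_simps)
  have a: "a = scaleC_bop (1/2) x + scaleC_bop (1/2) (x\<^sup>\<dagger>)"
    by (simp add: a_def scaleC_bop_simps)
  have "x = a + scaleC_bop \<i> b" unfolding a ib using half[of x] by simp
  moreover have "x\<^sup>\<dagger> = a - scaleC_bop \<i> b" unfolding a ib using half[of "x\<^sup>\<dagger>"] by simp
  moreover have "a\<^sup>\<dagger> = a" by (simp add: a_def adj_scaleC adj_add add.commute)
  moreover have "b\<^sup>\<dagger> = b"
  proof -
    have "b\<^sup>\<dagger> = scaleC_bop (\<i> / 2) (x\<^sup>\<dagger> - x)" by (simp add: b_def adj_scaleC adj_diff)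
    also have "x\<^sup>\<dagger> - x = scaleC_bop (- 1) (x - x\<^sup>\<dagger>)" by (simp add: scaleC_bop_simps(6))
    also have "scaleC_bop (\<i> / 2) \<dots> = b" by (simp only: b_def scaleC_bop_simps(2)) simp
    finally show ?thesis .
  qed
  ultimately show ?thesis using that a_def b_def by blast
qed

locale unital_star_algebra =
  fixes A :: "'h::chilbert_space bop set"
  assumes one: "1 \<in> A" and add: "\<And>x y. x \<in> A \<Longrightarrow> y \<in> A \<Longrightarrow> x + y \<in> A"
    and mult: "\<And>x y. x \<in> A \<Longrightarrow> y \<in> A \<Longrightarrow> x * y \<in> A"
    and scale: "\<And>c x. x \<in> A \<Longrightarrow> scaleC_bop c x \<in> A"
    and adj: "\<And>x. x \<in> A \<Longrightarrow> x\<^sup>\<dagger> \<in> A"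
begin

text \<open>Von Neumann's argument: the projection onto the closed orbit of \<open>\<zeta>\<close> commutes with the amplified
  algebra, so its matrix entries lie in the commutant, and every element of the bicommutant,
  amplified, commutes with the projection as well.\<close>

theorem bicommutant_density:
  assumes v: "v \<in> commutant (commutant A)"
  shows "amplify v \<zeta> \<in> closure ((\<lambda>y. amplify y \<zeta>) ` A)"
proof -
  define S where "S = closure ((\<lambda>y. amplify y \<zeta>) ` A)"
  have clS: "closed S" by (simp add: S_def)
  have S_lim: "s \<in> S \<longleftrightarrow> (\<exists>f. (\<forall>n. f n \<in> A) \<and> (\<lambda>n. amplify (f n) \<zeta>) \<longlonglongrightarrow> s)" for s
  proof
    assume "s \<in> S"
    then obtain g where g: "\<forall>n. g n \<in> (\<lambda>y. amplify y \<zeta>) ` A" "g \<longlonglongrightarrow> s"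
      unfolding S_def closure_sequential by blast
    have "\<forall>n. \<exists>y\<in>A. g n = amplify y \<zeta>" using g(1) by blast
    then obtain f where f: "\<forall>n. f n \<in> A" "\<And>n. g n = amplify (f n) \<zeta>" by metis
    have "g = (\<lambda>n. amplify (f n) \<zeta>)" using f(2) by (rule ext)
    then show "\<exists>f. (\<forall>n. f n \<in> A) \<and> (\<lambda>n. amplify (f n) \<zeta>) \<longlonglongrightarrow> s"
      using g(2) f(1) by blast
  next
    assume "\<exists>f. (\<forall>n. f n \<in> A) \<and> (\<lambda>n. amplify (f n) \<zeta>) \<longlonglongrightarrow> s"
    then obtain f where "\<forall>n. f n \<in> A" "(\<lambda>n. amplify (f n) \<zeta>) \<longlonglongrightarrow> s" by blast
    then show "s \<in> S" unfolding S_def closure_sequential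
      by (intro exI[of _ "\<lambda>n. amplify (f n) \<zeta>"]) auto
  qed
  have S_add: "s + t \<in> S" if st: "s \<in> S" "t \<in> S" for s t
  proof -
    obtain f g where "\<forall>n. f n \<in> A" "(\<lambda>n. amplify (f n) \<zeta>) \<longlonglongrightarrow> s" "\<forall>n. g n \<in> A" "(\<lambda>n. amplify (g n) \<zeta>) \<longlonglongrightarrow> t"
      using st[unfolded S_lim] by blast
    then show ?thesis unfolding S_lim
      by (intro exI[of _ "\<lambda>n. f n + g n"]) (auto simp: add amplify_simps intro: tendsto_add)
  qed
  have S_amp: "amplify y s \<in> S" if y: "y \<in> A" and st: "s \<in> S" for y s
  proof -
    obtain f where "\<forall>n. f n \<in> A" "(\<lambda>n. amplify (f n) \<zeta>) \<longlonglongrightarrow> s"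
      using st[unfolded S_lim] by blast
    then show ?thesis unfolding S_lim using y
      by (intro exI[of _ "\<lambda>n. y * f n"])
         (auto simp: mult amplify_simps intro: bounded_linear.tendsto[OF bounded_linear_amplify])
  qed
  have S_scale: "c *\<^sub>C s \<in> S" if "s \<in> S" for c s
    using S_amp[OF scale[OF one, of c] that] by (simp add: amplify_simps)
  have \<zeta>S: "\<zeta> \<in> S" unfolding S_lim by (rule exI[of _ "\<lambda>_. 1"]) (simp add: one amplify_simps)
  have S0: "0 \<in> S" using S_scale[OF \<zeta>S, of 0] scaleC_of_real[of 0 \<zeta>] by simp
  have "\<exists>p. p \<in> S \<and> (\<forall>s\<in>S. cinner s (x - p) = 0)" for x
    by (rule orthogonal_projection[of S x, OF S0 S_add S_scale clS]) blast+
  then obtain P where P: "\<And>x. P x \<in> S" "\<And>x s. s \<in> S \<Longrightarrow> cinner s (x - P x) = 0" by metis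
  have P_unique: "P x = p" if "p \<in> S" "\<And>s. s \<in> S \<Longrightarrow> cinner s (x - p) = 0" for x p
  proof -
    have Pp: "P x - p \<in> S" using S_add[OF P(1)[of x] S_scale[OF that(1), of "- 1"]] by (simp add: scaleC_minus_one)
    have "cinner (P x - p) ((x - p) - (x - P x)) = 0"
      unfolding cinner_diff_right[of _ "x - p" "x - P x"] using that(2)[OF Pp] P(2)[OF Pp, of x] by simp
    then have "cinner (P x - p) (P x - p) = 0" by simp
    then show ?thesis by (simp add: cinner_self)
  qed
  have P_add: "P (x + y) = P x + P y" for x y
    by (rule P_unique) (auto intro: S_add P(1) simp: add_diff_add cinner_add_right P(2))
  have P_scale: "P (c *\<^sub>C x) = c *\<^sub>C P x" for c x
    by (rule P_unique) (auto intro: S_scale P(1) simp: cinner_scaleC_right P(2) simp flip: scaleC_diff_right)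
  have P_amp: "P (amplify y x) = amplify y (P x)" if "y \<in> A" for x y
    by (rule P_unique)
       (auto intro: S_amp P(1) that simp: cinner_amplify P(2)[OF S_amp[OF adj[OF that]]] simp flip: amplify_simps(8))
  have P_id: "P s = s" if "s \<in> S" for s
    by (rule P_unique) (auto intro: that)
  have blP: "bounded_linear P"
  proof (rule bounded_linear_intro[where K = 1])
    fix x
    have "cinner (P x) (x - P x) = 0" by (rule P(2)[OF P(1)])
    then have "(norm x)\<^sup>2 = (norm (P x))\<^sup>2 + (norm (x - P x))\<^sup>2"
      using norm_add_square[of "P x" "x - P x"] by simp
    then have "(norm (P x))\<^sup>2 \<le> (norm x)\<^sup>2" by simp
    then show "norm (P x) \<le> norm x * 1" by simp
    show "P (r *\<^sub>R x) = r *\<^sub>R P x" for r using P_scale[of "of_real r" x] by (simp add: scaleC_of_real)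
  qed (rule P_add)
  have entry: "P (single n (v \<rhd> u)) = amplify v (P (single n u))" for n u
  proof (rule ell2_eqI)
    fix m
    define p where "p w = coord (P (single n w)) m" for w
    have single_add: "single n (x + y) = single n x + single n y" for x y :: 'h
      by (rule ell2_eqI) simp
    have single_scale: "single n (c *\<^sub>C x) = c *\<^sub>C single n x" for c and x :: 'h
      by (rule ell2_eqI) (simp add: scaleC_zero_right)
    have norm_single: "norm (single n x) \<le> norm x" for x :: 'h
    proof (rule norm_ell2_leI)
      fix N
      have "(\<Sum>k<N. (norm (if k = n then x else 0))\<^sup>2) = (\<Sum>k<N. if k = n then (norm x)\<^sup>2 else 0)"
        by (rule sum.cong) auto
      also have "\<dots> \<le> (norm x)\<^sup>2" by (simp add: sum.delta)
      finally show "L2_set (\<lambda>k. norm (coord (single n x) k)) {..<N} \<le> norm x"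
        by (simp add: L2_set_def real_le_lsqrt)
    qed simp
    have bp: "bounded_linear p"
    proof (rule bounded_linear_intro[where K = "onorm P"])
      fix w
      have "norm (p w) \<le> norm (P (single n w))" unfolding p_def by (rule norm_coord_le)
      also have "\<dots> \<le> onorm P * norm (single n w)" by (rule onorm[OF blP])
      also have "\<dots> \<le> onorm P * norm w" by (intro mult_left_mono norm_single onorm_pos_le[OF blP])
      finally show "norm (p w) \<le> norm w * onorm P" by (simp add: mult.commute)
      show "p (r *\<^sub>R w) = r *\<^sub>R p w" for r
        unfolding p_def using P_scale[of "of_real r"] single_scale[of "of_real r" w] by (simp add: scaleC_of_real)
    qed (simp add: p_def single_add P_add)
    have sp: "p (c *\<^sub>C w) = c *\<^sub>C p w" for c w by (simp add: p_def single_scale P_scale)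
    have p: "apply_bop (Bop p) = p" by (rule apply_Bop[OF bp sp])
    have "Bop p \<in> commutant A"
    proof -
      have "Bop p * y = y * Bop p" if "y \<in> A" for y
        using P_amp[OF that] by (intro bop_eqI) (simp add: p, simp add: p_def flip: amplify_simps(11))
      then show ?thesis by (simp add: commutant_def)
    qed
    then have "v * Bop p = Bop p * v" using v by (simp add: commutant_def)
    then have "v \<rhd> p u = p (v \<rhd> u)" by (metis apply_bop_simps(6) p)
    then show "coord (P (single n (v \<rhd> u))) m = coord (amplify v (P (single n u))) m"
      by (simp add: p_def)
  qed
  have "(\<lambda>n. P (amplify v (single n (coord \<zeta> n)))) sums P (amplify v \<zeta>)"
    by (intro bounded_linear.sums[OF blP] bounded_linear.sums[OF bounded_linear_amplify] single_sums)
  moreover have "(\<lambda>n. amplify v (P (single n (coord \<zeta> n)))) sums amplify v (P \<zeta>)"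
    by (intro bounded_linear.sums[OF blP] bounded_linear.sums[OF bounded_linear_amplify] single_sums)
  ultimately have "P (amplify v \<zeta>) = amplify v (P \<zeta>)"
    by (simp add: amplify_simps entry sums_iff)
  then have "P (amplify v \<zeta>) = amplify v \<zeta>" by (simp add: P_id[OF \<zeta>S])
  then show ?thesis using P(1)[of "amplify v \<zeta>"] by (simp add: S_def)
qed

lemma bicommutant_functional_zero:
  assumes v: "v \<in> commutant (commutant A)" and z: "\<And>y. y \<in> A \<Longrightarrow> cinner \<omega> (amplify y \<zeta>) = 0"
  shows "cinner \<omega> (amplify v \<zeta>) = 0"
proof -
  have "closed {x. cinner \<omega> x = 0}"
    by (intro closed_Collect_eq continuous_intros linear_continuous_on
        bounded_bilinear.bounded_linear_right[OF bounded_bilinear_cinner])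
  then have "closure ((\<lambda>y. amplify y \<zeta>) ` A) \<subseteq> {x. cinner \<omega> x = 0}"
    using z by (intro closure_minimal) auto
  then show ?thesis using bicommutant_density[OF v, of \<zeta>] by blast
qed

text \<open>Passing to adjoints is not strongly continuous, so the approximants of a self-adjoint element
  cannot simply be symmetrized. But a vector orthogonal (for the real inner product) to the orbit of
  \<open>\<zeta>\<close> under the self-adjoint elements gives an ultraweak functional that vanishes on all of \<open>A\<close>.\<close>

theorem selfadjoint_density:
  assumes v: "v \<in> commutant (commutant A)" "v\<^sup>\<dagger> = v" and e: "e > 0"
  obtains y where "y \<in> A" "y\<^sup>\<dagger> = y" "norm (amplify (v - y) \<zeta>) < e"
proof -
  let ?V = "(\<lambda>y. amplify y \<zeta>) ` {y\<in>A. y\<^sup>\<dagger> = y}"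
  have "subspace ?V"
  proof (rule subspaceI)
    show "0 \<in> ?V"
      using scale[OF one, of 0] by (intro image_eqI[of _ _ 0]) (auto simp: scaleC_bop_simps amplify_simps)
    show "x + y \<in> ?V" if xy: "x \<in> ?V" "y \<in> ?V" for x y
    proof -
      obtain a b where "a \<in> A" "a\<^sup>\<dagger> = a" "x = amplify a \<zeta>" "b \<in> A" "b\<^sup>\<dagger> = b" "y = amplify b \<zeta>"
        using xy by blast
      then show ?thesis by (intro image_eqI[of _ _ "a + b"]) (auto simp: amplify_simps add adj_add)
    qed
    show "r *\<^sub>R x \<in> ?V" if x: "x \<in> ?V" for r x
    proof -
      obtain a where "a \<in> A" "a\<^sup>\<dagger> = a" "x = amplify a \<zeta>"
        using x by blast
      then show ?thesis
        by (intro image_eqI[of _ _ "r *\<^sub>r a"]) (auto simp: amplify_simps scale adj_scaleC scaleC_of_real)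
    qed
  qed
  then have sub: "subspace (closure ?V)" by (rule subspace_closure)
  obtain p where p: "p \<in> closure ?V" "\<And>s. s \<in> closure ?V \<Longrightarrow> Re (cinner s (amplify v \<zeta> - p)) = 0"
    using real_orthogonal_projection[OF sub, of "amplify v \<zeta>"] by auto
  define w where "w = amplify v \<zeta> - p"
  have orth: "Re (cinner w (amplify y \<zeta>)) = 0" if "y \<in> A" "y\<^sup>\<dagger> = y" for y
  proof -
    have "amplify y \<zeta> \<in> ?V" using that by simp
    then have "amplify y \<zeta> \<in> closure ?V" by (rule subsetD[OF closure_subset])
    from p(2)[OF this] show ?thesis unfolding w_def by (subst Re_cinner_commute)
  qed
  define g where "g y = cinner (interleave w \<zeta>) (amplify y (interleave \<zeta> w))" for y
  have g: "g y = cinner w (amplify y \<zeta>) + cinner \<zeta> (amplify y w)" for y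
    by (simp add: g_def amplify_interleave cinner_interleave)
  have g_sa: "g y = of_real (2 * Re (cinner w (amplify y \<zeta>)))" if "y\<^sup>\<dagger> = y" for y
  proof -
    have "cinner \<zeta> (amplify y w) = cnj (cinner w (amplify y \<zeta>))"
      by (metis cinner_amplify cinner_commute that)
    then show ?thesis unfolding g by (simp add: complex_eq_iff)
  qed
  have "g y = 0" if y: "y \<in> A" for y
  proof -
    obtain a b where ab: "y = a + scaleC_bop \<i> b" "a\<^sup>\<dagger> = a" "b\<^sup>\<dagger> = b"
      "a = scaleC_bop (1/2) (y + y\<^sup>\<dagger>)" "b = scaleC_bop (- \<i> / 2) (y - y\<^sup>\<dagger>)"
      by (rule real_imaginary_parts)
    have "y - y\<^sup>\<dagger> \<in> A"
      using add[OF y scale[OF adj[OF y], of "- 1"]] by (simp add: scaleC_bop_simps)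
    then have A: "a \<in> A" "b \<in> A" unfolding ab(4,5) by (auto intro!: scale add adj y)
    have "g y = g a + \<i> * g b" unfolding ab(1) by (simp add: g_def amplify_simps cinner_simps)
    then show ?thesis using orth A ab(2,3) by (simp add: g_sa)
  qed
  then have "g v = 0" unfolding g_def by (rule bicommutant_functional_zero[OF v(1)])
  then have "Re (cinner w (amplify v \<zeta>)) = 0" by (simp add: g_sa[OF v(2)] of_real_eq_0_iff del: of_real_mult)
  moreover have "Re (cinner w p) = 0" using p(2)[OF p(1)] Re_cinner_commute w_def by metis
  ultimately have "Re (cinner w w) = 0" by (simp add: w_def cinner_diff_right[of _ "amplify v \<zeta>" p])
  then have "amplify v \<zeta> \<in> closure ?V" using p(1) by (simp add: Re_cinner_self w_def)
  then obtain x where "x \<in> ?V" "dist x (amplify v \<zeta>) < e" using e closure_approachable by blast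
  then obtain y where "y \<in> A" "y\<^sup>\<dagger> = y" "dist (amplify y \<zeta>) (amplify v \<zeta>) < e" by blast
  then show ?thesis using that by (simp add: dist_norm norm_minus_commute amplify_simps)
qed

end

section \<open>Normal conditional expectations onto a tracial algebra\<close>

text \<open>Cauchy--Schwarz bounds \<open>ultraweak_functional \<xi> \<eta> (u\<^sup>\<dagger> * u)\<close> by the norms of the amplification of \<open>u\<close> at
  \<open>\<xi>\<close> and at \<open>\<eta>\<close>; interleaving handles finite intersections.\<close>

lemma ultraweak_neighbourhood:
  assumes U: "openin ultraweak_topology U" "0 \<in> U"
  obtains \<zeta> :: "'h::chilbert_space ell2" and e :: real
  where "e > 0" "\<And>u. norm (amplify u \<zeta>) < e \<Longrightarrow> u\<^sup>\<dagger> * u \<in> U"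
proof -
  let ?S = "{ultraweak_functional \<xi> \<eta> -` U | \<xi> \<eta> U.
        summable (\<lambda>n. (norm (\<xi> n :: 'h))\<^sup>2) \<and> summable (\<lambda>n. (norm (\<eta> n))\<^sup>2) \<and> open U}"
  have "0 \<in> V \<longrightarrow> (\<exists>(\<zeta> :: 'h ell2) e. e > 0 \<and> (\<forall>u. norm (amplify u \<zeta>) < e \<longrightarrow> u\<^sup>\<dagger> * u \<in> V))"
    if "generate_topology_on ?S V" for V
    using that
  proof induction
    case (Int V W)
    show ?case
    proof
      assume "0 \<in> V \<inter> W"
      then obtain \<zeta> \<zeta>' :: "'h ell2" and e e' :: real where *: "e > 0" "e' > 0"
        "\<And>u. norm (amplify u \<zeta>) < e \<Longrightarrow> u\<^sup>\<dagger> * u \<in> V" "\<And>u. norm (amplify u \<zeta>') < e' \<Longrightarrow> u\<^sup>\<dagger> * u \<in> W"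
        using Int.IH by blast
      have le: "norm x \<le> norm (interleave x y)" "norm y \<le> norm (interleave x y)" for x y :: "'h ell2"
        by (rule power2_le_imp_le; simp add: norm_interleave)+
      have "u\<^sup>\<dagger> * u \<in> V \<inter> W" if "norm (amplify u (interleave \<zeta> \<zeta>')) < min e e'" for u
        using that le(1)[of "amplify u \<zeta>" "amplify u \<zeta>'"] le(2)[of "amplify u \<zeta>'" "amplify u \<zeta>"] *
        by (auto simp: amplify_interleave)
      then show "\<exists>(\<zeta> :: 'h ell2) e. e > 0 \<and> (\<forall>u. norm (amplify u \<zeta>) < e \<longrightarrow> u\<^sup>\<dagger> * u \<in> V \<inter> W)"
        using *(1,2) by (intro exI[of _ "interleave \<zeta> \<zeta>'"] exI[of _ "min e e'"]) auto
    qed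
  next
    case (UN K)
    show ?case
    proof
      assume "0 \<in> \<Union>K"
      then obtain X where X: "X \<in> K" "0 \<in> X" by blast
      then obtain \<zeta> :: "'h ell2" and e where "e > 0" "\<forall>u. norm (amplify u \<zeta>) < e \<longrightarrow> u\<^sup>\<dagger> * u \<in> X"
        using UN.IH by blast
      then show "\<exists>(\<zeta> :: 'h ell2) e. e > 0 \<and> (\<forall>u. norm (amplify u \<zeta>) < e \<longrightarrow> u\<^sup>\<dagger> * u \<in> \<Union>K)"
        using X(1) by blast
    qed
  next
    case (Basis V)
    then obtain \<xi> \<eta> U where V: "V = ultraweak_functional \<xi> \<eta> -` U" "open U"
      "summable (\<lambda>n. (norm (\<xi> n :: 'h))\<^sup>2)" "summable (\<lambda>n. (norm (\<eta> n))\<^sup>2)" by blast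
    define x y where "x = Ell2 \<xi>" and "y = Ell2 \<eta>"
    have xy: "coord x = \<xi>" "coord y = \<eta>" using V by (auto simp: x_def y_def Ell2_inverse)
    have f: "ultraweak_functional \<xi> \<eta> T = cinner x (amplify T y)" for T
      by (simp add: ultraweak_functional_def cinner_ell2_def xy)
    show ?case
    proof
      assume "0 \<in> V"
      then have "0 \<in> U" by (simp add: V(1) f amplify_simps)
      then obtain d where d: "d > 0" "ball 0 d \<subseteq> U" using V(2) openE by blast
      have "u\<^sup>\<dagger> * u \<in> V" if u: "norm (amplify u (interleave x y)) < sqrt d" for u
      proof -
        have "(norm (amplify u x))\<^sup>2 + (norm (amplify u y))\<^sup>2 = (norm (amplify u (interleave x y)))\<^sup>2"
          by (simp add: amplify_interleave norm_interleave)
        also have "\<dots> < (sqrt d)\<^sup>2" by (rule power_strict_mono[OF u]) auto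
        also have "\<dots> = d" using d(1) by simp
        finally have le: "(norm (amplify u x))\<^sup>2 + (norm (amplify u y))\<^sup>2 < d" .
        have "cmod (ultraweak_functional \<xi> \<eta> (u\<^sup>\<dagger> * u)) = cmod (cinner (amplify u x) (amplify u y))"
          by (simp add: f amplify_simps cinner_amplify)
        also have "\<dots> \<le> norm (amplify u x) * norm (amplify u y)" by (rule cinner_cauchy_schwarz)
        also have "\<dots> \<le> (norm (amplify u x))\<^sup>2 + (norm (amplify u y))\<^sup>2"
          using sum_squares_bound[of "norm (amplify u x)" "norm (amplify u y)"]
            mult_nonneg_nonneg[OF norm_ge_zero norm_ge_zero, of "amplify u x" "amplify u y"] by linarith
        finally have "ultraweak_functional \<xi> \<eta> (u\<^sup>\<dagger> * u) \<in> ball 0 d" using le by simp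
        then show ?thesis using d(2) V(1) by blast
      qed
      then show "\<exists>(\<zeta> :: 'h ell2) e. e > 0 \<and> (\<forall>u. norm (amplify u \<zeta>) < e \<longrightarrow> u\<^sup>\<dagger> * u \<in> V)"
        using d(1) by (intro exI[of _ "interleave x y"] exI[of _ "sqrt d"]) auto
    qed
  qed auto
  then show ?thesis
    using U that unfolding ultraweak_topology_def openin_topology_generated_by_iff by blast
qed

lemma square_le_scale: "positive_bop T \<Longrightarrow> T \<preceq> c *\<^sub>r 1 \<Longrightarrow> T * T \<preceq> c *\<^sub>r T"
proof (rule le_bopI)
  fix x assume T: "positive_bop T" "T \<preceq> c *\<^sub>r 1"
  have "Re (cinner x ((T * T) \<rhd> x)) = (norm (T \<rhd> x))\<^sup>2"
    using cinner_selfadjoint[OF positive_selfadjoint[OF T(1)], of x "T \<rhd> x"] by (simp add: Re_cinner_self)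
  then show "Re (cinner x ((T * T) \<rhd> x)) \<le> Re (cinner x ((c *\<^sub>r T) \<rhd> x))"
    using norm_square_le_form[OF T] by (simp only: form_scale)
qed (auto simp: positive_selfadjoint adj_mult adj_scaleC)

lemma cut_kernel: "positive_bop s \<Longrightarrow> s \<rhd> v = 0 \<Longrightarrow> cut s \<rhd> v = 0"
  by (simp add: cut_eq(2))

lemma form_le_amplify:
  assumes "positive_bop T"
  shows "Re (cinner (coord \<zeta> i) (T \<rhd> coord \<zeta> i)) \<le> Re (cinner \<zeta> (amplify T \<zeta>))"
proof -
  have s: "summable (\<lambda>n. Re (cinner (coord \<zeta> n) (T \<rhd> coord \<zeta> n)))"
    using summable_Re[OF summable_cinner_coord[of \<zeta> "amplify T \<zeta>"]] by simp
  have "(\<Sum>n\<in>{i}. Re (cinner (coord \<zeta> n) (T \<rhd> coord \<zeta> n))) \<le> (\<Sum>n. Re (cinner (coord \<zeta> n) (T \<rhd> coord \<zeta> n)))"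
    by (intro sum_le_suminf s positive_form assms) auto
  also have "\<dots> = Re (cinner \<zeta> (amplify T \<zeta>))"
    using bounded_linear.suminf[OF bounded_linear_Re summable_cinner_coord[of \<zeta> "amplify T \<zeta>"]]
    by (simp add: cinner_ell2_def)
  finally show ?thesis by simp
qed

lemma amplify_form_mono: "S \<preceq> T \<Longrightarrow> Re (cinner \<zeta> (amplify S \<zeta>)) \<le> Re (cinner \<zeta> (amplify T \<zeta>))"
proof -
  assume "S \<preceq> T"
  then have "0 \<le> Re (cinner (coord \<zeta> 0) ((T - S) \<rhd> coord \<zeta> 0))" by (rule positive_form)
  also have "\<dots> \<le> Re (cinner \<zeta> (amplify (T - S) \<zeta>))" by (rule form_le_amplify) fact
  finally show ?thesis by (simp add: amplify_simps cinner_simps)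
qed

text \<open>The trace \<open>t\<close> is required to respect limits of bounded increasing sequences rather than to be
  ultraweakly continuous: the former survives any order isomorphism.\<close>

locale tracial_expectation =
  fixes M D :: "'k::chilbert_space bop set" and F :: "'k bop \<Rightarrow> 'k bop" and t :: "'k bop \<Rightarrow> complex"
  assumes M: "von_neumann_algebra M" and D_sub: "D \<subseteq> M"
    and D_one: "1 \<in> D" and D_add: "\<And>x y. x \<in> D \<Longrightarrow> y \<in> D \<Longrightarrow> x + y \<in> D"
    and D_mult: "\<And>x y. x \<in> D \<Longrightarrow> y \<in> D \<Longrightarrow> x * y \<in> D"
    and D_scale: "\<And>c x. x \<in> D \<Longrightarrow> scaleC_bop c x \<in> D"
    and D_adj: "\<And>x. x \<in> D \<Longrightarrow> x\<^sup>\<dagger> \<in> D"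
    and D_cut: "\<And>s. s \<in> D \<Longrightarrow> positive_bop s \<Longrightarrow> cut s \<in> D"
    and D_limit: "\<And>a l. (\<And>n. a n \<in> D) \<Longrightarrow> (\<And>n. positive_bop (a n)) \<Longrightarrow> (\<And>n. a n \<preceq> 1) \<Longrightarrow>
      (\<And>n. a n \<preceq> a (Suc n)) \<Longrightarrow> strong_limit a l \<Longrightarrow> l \<in> D \<and> (\<lambda>n. t (a n)) \<longlonglongrightarrow> t l"
    and F: "conditional_expectation M D F" and F_normal: "normal_map M D F"
    and t: "state_on D t" and t_faithful: "faithful_on D t" and t_trace: "tracial_on D t"
begin

lemmas M_rules = vna_adj[OF M] vna_zero[OF M] vna_one[OF M] vna_add[OF M] vna_diff[OF M]
  vna_minus[OF M] vna_scale[OF M] vna_mult[OF M] vna_sum[OF M]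

lemma D_zero: "0 \<in> D"
  using D_scale[OF D_one, of 0] by (simp add: scaleC_bop_simps)

lemma D_minus: "x \<in> D \<Longrightarrow> - x \<in> D"
  using D_scale[of x "- 1"] by (simp add: scaleC_bop_simps)

lemma D_diff: "x \<in> D \<Longrightarrow> y \<in> D \<Longrightarrow> x - y \<in> D"
  using D_add[OF _ D_minus] by fastforce

lemma D_sum: "(\<And>i. i \<in> I \<Longrightarrow> f i \<in> D) \<Longrightarrow> sum f I \<in> D"
  by (induction I rule: infinite_finite_induct) (auto intro: D_zero D_add)

lemmas D_rules = D_one D_zero D_add D_minus D_diff D_mult D_scale D_adj D_sum

lemma D_M: "x \<in> D \<Longrightarrow> x \<in> M"
  using D_sub by blast

subsection \<open>The trace and the expectation\<close>

lemma t_add: "x \<in> D \<Longrightarrow> y \<in> D \<Longrightarrow> t (x + y) = t x + t y"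
  and t_scale: "x \<in> D \<Longrightarrow> t (scaleC_bop c x) = c * t x"
  and t_one: "t 1 = 1"
  and t_positive: "x \<in> D \<Longrightarrow> positive_bop x \<Longrightarrow> t x \<in> \<real>\<^sub>\<ge>\<^sub>0"
  using t unfolding state_on_def by blast+

lemma t_diff: "x \<in> D \<Longrightarrow> y \<in> D \<Longrightarrow> t (x - y) = t x - t y"
  using t_add[of "x - y" y] by (simp add: D_diff)

lemma t_mono: "x \<in> D \<Longrightarrow> y \<in> D \<Longrightarrow> x \<preceq> y \<Longrightarrow> Re (t x) \<le> Re (t y)"
  using t_positive[of "y - x"] by (simp add: t_diff D_diff complex_nonneg_Reals_iff)

lemma F_in: "x \<in> M \<Longrightarrow> F x \<in> D"
  and F_add: "x \<in> M \<Longrightarrow> y \<in> M \<Longrightarrow> F (x + y) = F x + F y"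
  and F_scale: "x \<in> M \<Longrightarrow> F (scaleC_bop c x) = scaleC_bop c (F x)"
  and F_positive: "x \<in> M \<Longrightarrow> positive_bop x \<Longrightarrow> positive_bop (F x)"
  and F_id: "d \<in> D \<Longrightarrow> F d = d"
  and F_bimodule: "d \<in> D \<Longrightarrow> e \<in> D \<Longrightarrow> x \<in> M \<Longrightarrow> F (d * x * e) = d * F x * e"
  using F unfolding conditional_expectation_def by blast+

lemma F_left: "d \<in> D \<Longrightarrow> x \<in> M \<Longrightarrow> F (d * x) = d * F x"
  using F_bimodule[OF _ D_one, of d x] by simp

lemma F_right: "d \<in> D \<Longrightarrow> x \<in> M \<Longrightarrow> F (x * d) = F x * d"
  using F_bimodule[OF D_one, of d x] by simp

lemma F_diff: "x \<in> M \<Longrightarrow> y \<in> M \<Longrightarrow> F (x - y) = F x - F y"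
  using F_add[of "x - y" y] by (simp add: M_rules)

lemma F_zero: "F 0 = 0"
  by (rule F_id[OF D_zero])

lemma F_mono: "x \<in> M \<Longrightarrow> y \<in> M \<Longrightarrow> x \<preceq> y \<Longrightarrow> F x \<preceq> F y"
  using F_positive[of "y - x"] by (simp add: F_diff M_rules)

lemma F_selfadjoint: "x \<in> M \<Longrightarrow> x\<^sup>\<dagger> = x \<Longrightarrow> (F x)\<^sup>\<dagger> = F x"
proof -
  assume x: "x \<in> M" "x\<^sup>\<dagger> = x"
  have "positive_bop (F (bnorm x *\<^sub>r 1 - x))"
    by (intro F_positive le_bop_bnorm M_rules x)
  then have "positive_bop (bnorm x *\<^sub>r 1 - F x)"
    by (simp add: F_diff F_id x M_rules D_rules)
  then have "(bnorm x *\<^sub>r 1 - F x)\<^sup>\<dagger> = bnorm x *\<^sub>r 1 - F x" by (rule positive_selfadjoint)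
  then show ?thesis by (simp add: adj_diff adj_scaleC)
qed

end

context tracial_expectation
begin

lemma M_parts:
  assumes "x \<in> M"
  obtains a b where "x = a + scaleC_bop \<i> b" "x\<^sup>\<dagger> = a - scaleC_bop \<i> b" "a\<^sup>\<dagger> = a" "b\<^sup>\<dagger> = b" "a \<in> M" "b \<in> M"
proof (rule real_imaginary_parts[of x])
  fix a b
  assume *: "x = a + scaleC_bop \<i> b" "x\<^sup>\<dagger> = a - scaleC_bop \<i> b" "a\<^sup>\<dagger> = a" "b\<^sup>\<dagger> = b"
    "a = scaleC_bop (1/2) (x + x\<^sup>\<dagger>)" "b = scaleC_bop (- \<i> / 2) (x - x\<^sup>\<dagger>)"
  show ?thesis
  proof (rule that[OF *(1-4)])
    show "a \<in> M" unfolding *(5) by (intro M_rules assms)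
    show "b \<in> M" unfolding *(6) by (intro M_rules assms)
  qed
qed

lemma F_adj: "x \<in> M \<Longrightarrow> F (x\<^sup>\<dagger>) = (F x)\<^sup>\<dagger>"
proof -
  assume "x \<in> M"
  then obtain a b where ab: "x = a + scaleC_bop \<i> b" "x\<^sup>\<dagger> = a - scaleC_bop \<i> b" "a\<^sup>\<dagger> = a" "b\<^sup>\<dagger> = b" "a \<in> M" "b \<in> M"
    by (rule M_parts)
  have "F (x\<^sup>\<dagger>) = F a - scaleC_bop \<i> (F b)"
    unfolding ab(2) by (simp add: F_diff F_scale M_rules ab)
  moreover have "F x = F a + scaleC_bop \<i> (F b)"
    unfolding ab(1) by (simp add: F_add F_scale M_rules ab)
  moreover have "- scaleC_bop \<i> (F b) = scaleC_bop (- \<i>) (F b)"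
    using scaleC_bop_simps(2)[of "- 1" \<i> "F b"] by (simp add: scaleC_bop_simps(6))
  ultimately show ?thesis
    using F_selfadjoint[OF ab(5,3)] F_selfadjoint[OF ab(6,4)] by (simp add: adj_add adj_scaleC)
qed

text \<open>The state of \<open>M\<close> that extends the trace of \<open>D\<close>.\<close>

definition \<phi> :: "'k bop \<Rightarrow> complex" where "\<phi> x = t (F x)"

lemma \<phi>_add: "x \<in> M \<Longrightarrow> y \<in> M \<Longrightarrow> \<phi> (x + y) = \<phi> x + \<phi> y"
  and \<phi>_diff: "x \<in> M \<Longrightarrow> y \<in> M \<Longrightarrow> \<phi> (x - y) = \<phi> x - \<phi> y"
  and \<phi>_scale: "x \<in> M \<Longrightarrow> \<phi> (scaleC_bop c x) = c * \<phi> x"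
  and \<phi>_D: "x \<in> D \<Longrightarrow> \<phi> x = t x"
  by (simp_all add: \<phi>_def F_add F_diff F_scale F_id F_in t_add t_diff t_scale)

lemma \<phi>_zero: "\<phi> 0 = 0"
  using \<phi>_diff[of 0 0] by (simp add: M_rules)

lemma \<phi>_positive: "x \<in> M \<Longrightarrow> positive_bop x \<Longrightarrow> \<phi> x \<in> \<real>\<^sub>\<ge>\<^sub>0"
  unfolding \<phi>_def by (intro t_positive F_in F_positive)

lemma \<phi>_mono: "x \<in> M \<Longrightarrow> y \<in> M \<Longrightarrow> x \<preceq> y \<Longrightarrow> Re (\<phi> x) \<le> Re (\<phi> y)"
  unfolding \<phi>_def by (intro t_mono F_in F_mono)

lemma \<phi>_square: "x \<in> M \<Longrightarrow> \<phi> (x\<^sup>\<dagger> * x) = of_real (Re (\<phi> (x\<^sup>\<dagger> * x)))" "x \<in> M \<Longrightarrow> 0 \<le> Re (\<phi> (x\<^sup>\<dagger> * x))"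
  using \<phi>_positive[OF _ positive_square, of x] by (auto simp: M_rules complex_nonneg_Reals_iff complex_eq_iff)

lemma \<phi>_real: "x \<in> M \<Longrightarrow> x\<^sup>\<dagger> = x \<Longrightarrow> Im (\<phi> x) = 0"
proof -
  assume x: "x \<in> M" "x\<^sup>\<dagger> = x"
  have "\<phi> (bnorm x *\<^sub>r 1 - x) \<in> \<real>\<^sub>\<ge>\<^sub>0"
    by (intro \<phi>_positive le_bop_bnorm M_rules x)
  then show ?thesis
    by (simp add: \<phi>_diff \<phi>_scale \<phi>_D[OF D_one] t_one x M_rules complex_nonneg_Reals_iff)
qed

lemma \<phi>_adj: "x \<in> M \<Longrightarrow> \<phi> (x\<^sup>\<dagger>) = cnj (\<phi> x)"
proof -
  assume "x \<in> M"
  then obtain a b where ab: "x = a + scaleC_bop \<i> b" "x\<^sup>\<dagger> = a - scaleC_bop \<i> b" "a\<^sup>\<dagger> = a" "b\<^sup>\<dagger> = b" "a \<in> M" "b \<in> M"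
    by (rule M_parts)
  have "\<phi> (x\<^sup>\<dagger>) = \<phi> a - \<i> * \<phi> b" unfolding ab(2) by (simp add: \<phi>_diff \<phi>_scale M_rules ab)
  moreover have "\<phi> x = \<phi> a + \<i> * \<phi> b" unfolding ab(1) by (simp add: \<phi>_add \<phi>_scale M_rules ab)
  ultimately show ?thesis
    using \<phi>_real[OF ab(5,3)] \<phi>_real[OF ab(6,4)] by (simp add: complex_eq_iff)
qed

lemma \<phi>_cauchy_schwarz:
  assumes x: "x \<in> M" and y: "y \<in> M"
  shows "(cmod (\<phi> (x\<^sup>\<dagger> * y)))\<^sup>2 \<le> Re (\<phi> (x\<^sup>\<dagger> * x)) * Re (\<phi> (y\<^sup>\<dagger> * y))"
proof (rule gram_cauchy_schwarz)
  fix l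
  let ?z = "x + scaleC_bop l y"
  have z: "?z \<in> M" by (intro M_rules x y)
  have "?z\<^sup>\<dagger> * ?z = (x\<^sup>\<dagger> + scaleC_bop (cnj l) (y\<^sup>\<dagger>)) * (x + scaleC_bop l y)"
    by (simp only: adj_add adj_scaleC)
  also have "\<dots> = x\<^sup>\<dagger> * x + scaleC_bop l (x\<^sup>\<dagger> * y) + scaleC_bop (cnj l) ((x\<^sup>\<dagger> * y)\<^sup>\<dagger>)
      + scaleC_bop (cnj l * l) (y\<^sup>\<dagger> * y)"
    by (simp add: distrib_left distrib_right adj_mult scaleC_bop_mult scaleC_bop_simps(2,4) add.assoc mult.commute)
  finally have "\<phi> (?z\<^sup>\<dagger> * ?z) = \<phi> (x\<^sup>\<dagger> * x + scaleC_bop l (x\<^sup>\<dagger> * y)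
      + scaleC_bop (cnj l) ((x\<^sup>\<dagger> * y)\<^sup>\<dagger>) + scaleC_bop (cnj l * l) (y\<^sup>\<dagger> * y))" by simp
  also have "\<dots> = \<phi> (x\<^sup>\<dagger> * x) + l * \<phi> (x\<^sup>\<dagger> * y) + cnj (l * \<phi> (x\<^sup>\<dagger> * y)) + cnj l * l * \<phi> (y\<^sup>\<dagger> * y)"
  proof -
    have m: "x\<^sup>\<dagger> * x \<in> M" "x\<^sup>\<dagger> * y \<in> M" "y\<^sup>\<dagger> * y \<in> M" "(x\<^sup>\<dagger> * y)\<^sup>\<dagger> \<in> M" by (intro M_rules x y)+
    show ?thesis by (simp add: \<phi>_add \<phi>_scale \<phi>_adj[OF m(2)] m vna_add[OF M] vna_scale[OF M])
  qed
  finally have "\<phi> (?z\<^sup>\<dagger> * ?z) = \<phi> (x\<^sup>\<dagger> * x) + l * \<phi> (x\<^sup>\<dagger> * y) + cnj (l * \<phi> (x\<^sup>\<dagger> * y)) + cnj l * l * \<phi> (y\<^sup>\<dagger> * y)" .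
  moreover have "cnj l * l = of_real ((cmod l)\<^sup>2)" by (simp only: complex_norm_square mult.commute)
  ultimately have "Re (\<phi> (?z\<^sup>\<dagger> * ?z)) = Re (\<phi> (x\<^sup>\<dagger> * x)) + 2 * Re (l * \<phi> (x\<^sup>\<dagger> * y)) + (cmod l)\<^sup>2 * Re (\<phi> (y\<^sup>\<dagger> * y))"
    by (simp del: complex_cnj_mult)
  then show "0 \<le> Re (\<phi> (x\<^sup>\<dagger> * x)) + 2 * Re (l * \<phi> (x\<^sup>\<dagger> * y)) + (cmod l)\<^sup>2 * Re (\<phi> (y\<^sup>\<dagger> * y))"
    using \<phi>_square(2)[OF z] by simp
qed (rule \<phi>_square(2)[OF y])

text \<open>The seminorm of the Hilbert space \<open>L\<^sup>2(M, \<phi>)\<close>.\<close>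

definition norm2 :: "'k bop \<Rightarrow> real" where "norm2 x = sqrt (Re (\<phi> (x\<^sup>\<dagger> * x)))"

lemma norm2_nonneg: "x \<in> M \<Longrightarrow> 0 \<le> norm2 x"
  by (simp add: norm2_def \<phi>_square(2))

lemma norm2_square: "x \<in> M \<Longrightarrow> (norm2 x)\<^sup>2 = Re (\<phi> (x\<^sup>\<dagger> * x))"
  by (simp add: norm2_def \<phi>_square(2))

lemma norm2_cauchy_schwarz: "x \<in> M \<Longrightarrow> y \<in> M \<Longrightarrow> cmod (\<phi> (x\<^sup>\<dagger> * y)) \<le> norm2 x * norm2 y"
  using real_sqrt_le_mono[OF \<phi>_cauchy_schwarz[of x y]] by (simp add: norm2_def real_sqrt_mult)

lemma norm2_triangle: assumes "x \<in> M" "y \<in> M" shows "norm2 (x + y) \<le> norm2 x + norm2 y"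
proof (rule power2_le_imp_le)
  have "(x + y)\<^sup>\<dagger> * (x + y) = x\<^sup>\<dagger> * x + x\<^sup>\<dagger> * y + (x\<^sup>\<dagger> * y)\<^sup>\<dagger> + y\<^sup>\<dagger> * y"
    by (simp add: adj_add adj_mult algebra_simps)
  then have "(norm2 (x + y))\<^sup>2 = (norm2 x)\<^sup>2 + 2 * Re (\<phi> (x\<^sup>\<dagger> * y)) + (norm2 y)\<^sup>2"
    using assms by (simp add: norm2_square \<phi>_add \<phi>_adj M_rules)
  also have "\<dots> \<le> (norm2 x)\<^sup>2 + 2 * (norm2 x * norm2 y) + (norm2 y)\<^sup>2"
    using norm2_cauchy_schwarz[OF assms] complex_Re_le_cmod[of "\<phi> (x\<^sup>\<dagger> * y)"] by simp
  also have "\<dots> = (norm2 x + norm2 y)\<^sup>2" by (simp add: power2_sum)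
  finally show "(norm2 (x + y))\<^sup>2 \<le> (norm2 x + norm2 y)\<^sup>2" .
qed (use assms norm2_nonneg in auto)

lemma norm2_minus: "norm2 (- x) = norm2 x"
  by (simp add: norm2_def adj_minus)

lemma norm2_scale: "x \<in> M \<Longrightarrow> norm2 (scaleC_bop c x) = cmod c * norm2 x"
proof -
  assume x: "x \<in> M"
  have "(scaleC_bop c x)\<^sup>\<dagger> * scaleC_bop c x = scaleC_bop (of_real ((cmod c)\<^sup>2)) (x\<^sup>\<dagger> * x)"
    unfolding complex_norm_square
    by (simp add: adj_scaleC scaleC_bop_mult scaleC_bop_simps mult.commute)
  then have "Re (\<phi> ((scaleC_bop c x)\<^sup>\<dagger> * scaleC_bop c x)) = (cmod c)\<^sup>2 * Re (\<phi> (x\<^sup>\<dagger> * x))"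
    using x by (simp only: \<phi>_scale M_rules Re_complex_of_real times_complex.sel) simp
  then show ?thesis by (simp add: norm2_def real_sqrt_mult)
qed

lemma norm2_mult_left: assumes "a \<in> M" "x \<in> M" shows "norm2 (a * x) \<le> bnorm a * norm2 x"
proof (rule power2_le_imp_le)
  have "x\<^sup>\<dagger> * (a\<^sup>\<dagger> * a) * x \<preceq> x\<^sup>\<dagger> * ((bnorm a)\<^sup>2 *\<^sub>r 1) * x"
    by (intro le_bop_conj square_le_bnorm)
  then have "(a * x)\<^sup>\<dagger> * (a * x) \<preceq> (bnorm a)\<^sup>2 *\<^sub>r (x\<^sup>\<dagger> * x)"
    by (simp add: adj_mult mult.assoc scaleC_bop_mult)
  then have "Re (\<phi> ((a * x)\<^sup>\<dagger> * (a * x))) \<le> Re (\<phi> ((bnorm a)\<^sup>2 *\<^sub>r (x\<^sup>\<dagger> * x)))"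
    using assms by (intro \<phi>_mono M_rules)
  then show "(norm2 (a * x))\<^sup>2 \<le> (bnorm a * norm2 x)\<^sup>2"
    using assms by (simp add: norm2_square M_rules power_mult_distrib \<phi>_scale)
qed (intro mult_nonneg_nonneg bnorm_nonneg norm2_nonneg assms)

subsection \<open>A separating sequence of vectors\<close>

definition unit_interval :: "'k bop set" where
  "unit_interval = {g \<in> D. positive_bop g \<and> g \<preceq> 1}"

definition annihilator :: "(nat \<Rightarrow> 'k) \<Rightarrow> 'k bop set" where
  "annihilator \<xi> = {g \<in> unit_interval. \<forall>i. g \<rhd> \<xi> i = 0}"

lemma increasing_limit:
  assumes "\<And>n. a n \<in> unit_interval" "\<And>n. a n \<preceq> a (Suc n)"
  obtains l where "l \<in> unit_interval" "strong_limit a l" "(\<lambda>n. t (a n)) \<longlonglongrightarrow> t l"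
proof -
  have a: "a n \<in> D" "positive_bop (a n)" "a n \<preceq> 1" for n using assms(1) by (auto simp: unit_interval_def)
  obtain l where l: "strong_limit a l" using monotone_strong_limit[of a] a assms(2) by blast
  have "l \<in> D" "(\<lambda>n. t (a n)) \<longlonglongrightarrow> t l" using D_limit[OF a assms(2) l] by auto
  moreover have "positive_bop l" "l \<preceq> 1"
    using strong_limit_positive[OF l a(2)] strong_limit_le[OF l a(3)] by auto
  ultimately show ?thesis using that l by (auto simp: unit_interval_def)
qed

text \<open>Faithfulness speaks about squares; for positive \<open>g\<close> the square is dominated by a multiple of \<open>g\<close>.\<close>

lemma t_eq_zero: assumes "g \<in> D" "positive_bop g" "Re (t g) \<le> 0" shows "g = 0"
proof -
  have "g * g \<preceq> bnorm g *\<^sub>r g"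
    by (intro square_le_scale le_bop_bnorm positive_selfadjoint assms)
  then have "Re (t (g * g)) \<le> Re (t (bnorm g *\<^sub>r g))" using assms by (intro t_mono D_rules)
  also have "\<dots> = bnorm g * Re (t g)" using assms by (simp add: t_scale)
  also have "\<dots> \<le> 0" by (rule mult_nonneg_nonpos[OF bnorm_nonneg assms(3)])
  finally have "Re (t (g * g)) \<le> 0" .
  moreover have "t (g * g) \<in> \<real>\<^sub>\<ge>\<^sub>0"
    using positive_square[of g] assms by (intro t_positive D_rules) (auto simp: positive_selfadjoint)
  ultimately have "t (g\<^sup>\<dagger> * g) = 0"
    using assms(2) by (simp add: complex_nonneg_Reals_iff complex_eq_iff positive_selfadjoint)
  then show ?thesis using t_faithful assms(1) by (auto simp: faithful_on_def)
qed

text \<open>The bound is the limit of \<open>cut (m (g\<^sub>0 + \<dots> + g\<^sub>m))\<close>: cutting keeps it below \<open>1\<close> and in the annihilator of \<open>\<xi>\<close>,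
  while \<open>cut (m g)\<close> is at least \<open>m/(1+m) g\<close> for \<open>g\<close> between \<open>0\<close> and \<open>1\<close>.\<close>

lemma annihilator_upper_bound:
  assumes g: "\<And>n :: nat. g n \<in> annihilator \<xi>"
  obtains p where "p \<in> annihilator \<xi>" "\<And>n. g n \<preceq> p"
proof -
  have g': "g n \<in> D" "positive_bop (g n)" "g n \<preceq> 1" "g n \<rhd> \<xi> i = 0" for n i
    using g by (auto simp: annihilator_def unit_interval_def)
  define s where "s m = real m *\<^sub>r (\<Sum>j\<le>m. g j)" for m
  have s: "s m \<in> D" "positive_bop (s m)" for m
    unfolding s_def by (intro D_rules g' positive_scale positive_sum; simp)+
  have s_kill: "s m \<rhd> \<xi> i = 0" for m i
  proof -
    have "(\<Sum>j\<in>J. g j) \<rhd> \<xi> i = 0" for J :: "nat set"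
      by (induction J rule: infinite_finite_induct) (auto simp: g')
    then show ?thesis by (simp add: s_def scaleC_zero_right)
  qed
  have s_inc: "s m \<preceq> s (Suc m)" for m
  proof -
    have "s (Suc m) - s m = real m *\<^sub>r g (Suc m) + 1 *\<^sub>r (\<Sum>j\<le>Suc m. g j)"
      by (simp add: s_def scaleC_bop_simps algebra_simps)
    also have "positive_bop \<dots>" by (intro positive_add positive_scale positive_sum g') simp_all
    finally show ?thesis .
  qed
  obtain p where p: "p \<in> unit_interval" "strong_limit (\<lambda>m. cut (s m)) p"
    by (rule increasing_limit[of "\<lambda>m. cut (s m)"])
       (auto simp: unit_interval_def intro!: D_cut s cut_positive cut_le_one cut_mono s_inc)
  have "p \<rhd> \<xi> i = 0" for i
  proof -
    have "(\<lambda>m. cut (s m) \<rhd> \<xi> i) \<longlonglongrightarrow> p \<rhd> \<xi> i" using p(2) by (simp add: strong_limit_def)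
    then show ?thesis using cut_kernel[OF s(2) s_kill] by (simp add: LIMSEQ_const_iff)
  qed
  then have "p \<in> annihilator \<xi>" using p(1) by (simp add: annihilator_def)
  moreover have "g n \<preceq> p" for n
  proof (rule le_bopI)
    fix x
    have "(real m / (1 + real m)) * Re (cinner x (g n \<rhd> x)) \<le> Re (cinner x (p \<rhd> x))" if "m \<ge> n" for m
    proof -
      have mg: "positive_bop (real m *\<^sub>r g n)" by (intro positive_scale g') simp
      have "real m *\<^sub>r g n \<preceq> real m *\<^sub>r 1"
        using positive_scale[OF _ g'(3)[of n], of "real m"] by (simp add: scaleC_bop_simps)
      then have "(1 / (1 + real m)) *\<^sub>r (real m *\<^sub>r g n) \<preceq> cut (real m *\<^sub>r g n)"
        by (intro le_cut mg) auto
      moreover have "real m *\<^sub>r g n \<preceq> s m"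
      proof -
        have "s m - real m *\<^sub>r g n = real m *\<^sub>r (\<Sum>j\<in>{..m} - {n}. g j)"
          using that by (simp add: s_def sum.remove[of "{..m}" n g] scaleC_bop_simps)
        also have "positive_bop \<dots>" by (intro positive_scale positive_sum g') simp
        finally show ?thesis .
      qed
      then have "cut (real m *\<^sub>r g n) \<preceq> cut (s m)" by (rule cut_mono[OF mg])
      moreover have "cut (s m) \<preceq> p"
        by (rule strong_limit_ge[OF p(2)]) (intro cut_mono s s_inc)
      ultimately have "(1 / (1 + real m)) *\<^sub>r (real m *\<^sub>r g n) \<preceq> p" by (meson le_bop_trans)
      from le_bop_form[OF this, of x] show ?thesis unfolding form_scale by simp
    qed
    moreover have "(\<lambda>m. (real m / (1 + real m)) * Re (cinner x (g n \<rhd> x))) \<longlonglongrightarrow> 1 * Re (cinner x (g n \<rhd> x))"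
    proof (intro tendsto_mult tendsto_const)
      have "(\<lambda>m. real m / (1 + real m)) = (\<lambda>m. real m / real (Suc m))" by (simp add: add.commute)
      then show "(\<lambda>m. real m / (1 + real m)) \<longlonglongrightarrow> 1" using LIMSEQ_n_over_Suc_n by simp
    qed
    ultimately show "Re (cinner x (g n \<rhd> x)) \<le> Re (cinner x (p \<rhd> x))"
      by (intro LIMSEQ_le_const2[of _ "Re (cinner x (g n \<rhd> x))"]) auto
  next
    show "(g n)\<^sup>\<dagger> = g n" "p\<^sup>\<dagger> = p" using g' p(1) by (auto simp: unit_interval_def positive_selfadjoint)
  qed
  ultimately show ?thesis using that by blast
qed

text \<open>A faithful trace can only see countably many directions. Among all sequences \<open>\<xi>\<close>, take one for
  which the largest trace of an element annihilating \<open>\<xi>\<close> is minimal; a maximal such element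
  \<open>p \<noteq> 0\<close> would move some vector \<open>v\<close>, and adjoining \<open>v\<close> to \<open>\<xi>\<close> would lower the minimum.\<close>

lemma separating_sequence:
  obtains \<xi> where "annihilator \<xi> = {0}"
proof -
  define T where "T \<xi> = (SUP g\<in>annihilator \<xi>. Re (t g))" for \<xi>
  have zero_in: "0 \<in> annihilator \<xi>" for \<xi> by (simp add: annihilator_def unit_interval_def D_zero)
  have t_le: "Re (t g) \<le> 1" if "g \<in> annihilator \<xi>" for g \<xi>
    using t_mono[of g 1] that D_one by (auto simp: annihilator_def unit_interval_def t_one)
  have bdd: "bdd_above ((\<lambda>g. Re (t g)) ` annihilator \<xi>)" for \<xi>
    by (rule bdd_aboveI2) (rule t_le)
  have T_ge: "Re (t g) \<le> T \<xi>" if "g \<in> annihilator \<xi>" for g \<xi>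
    unfolding T_def by (rule cSUP_upper[OF that bdd])
  have t0: "t 0 = 0" using \<phi>_zero \<phi>_D[OF D_zero] by simp
  have T_nonneg: "0 \<le> T \<xi>" for \<xi> using T_ge[OF zero_in] t0 by simp
  have attained: "\<exists>p\<in>annihilator \<xi>. Re (t p) = T \<xi>" for \<xi>
  proof -
    have "\<exists>g\<in>annihilator \<xi>. T \<xi> - 1 / real (Suc n) < Re (t g)" for n
      using less_cSUP_iff[OF _ bdd, of \<xi> "T \<xi> - 1 / real (Suc n)"] zero_in unfolding T_def by fastforce
    then obtain g where g: "\<And>n. g n \<in> annihilator \<xi>" "\<And>n. T \<xi> - 1 / real (Suc n) < Re (t (g n))" by metis
    obtain p where p: "p \<in> annihilator \<xi>" "\<And>n. g n \<preceq> p" using annihilator_upper_bound[of g] g(1) by blast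
    have "T \<xi> - 1 / real (Suc n) \<le> Re (t p)" for n
    proof -
      have "Re (t (g n)) \<le> Re (t p)"
        using g(1) p by (intro t_mono) (auto simp: annihilator_def unit_interval_def)
      then show ?thesis using g(2)[of n] by simp
    qed
    moreover have "(\<lambda>n. T \<xi> - 1 / real (Suc n)) \<longlonglongrightarrow> T \<xi> - 0"
      by (intro tendsto_intros LIMSEQ_Suc[OF lim_1_over_n])
    ultimately have "T \<xi> \<le> Re (t p)" by (intro LIMSEQ_le_const2[of _ "T \<xi>"]) auto
    then show ?thesis using T_ge[OF p(1)] p(1) by force
  qed
  define m where "m = (INF \<xi>. T \<xi>)"
  have bddT: "bdd_below (range T)" by (rule bdd_belowI2) (rule T_nonneg)
  have m_le: "m \<le> T \<xi>" for \<xi> unfolding m_def by (rule cINF_lower[OF bddT]) simp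
  have "\<exists>\<xi>. T \<xi> < m + 1 / real (Suc n)" for n
    using cINF_less_iff[OF _ bddT, of "m + 1 / real (Suc n)"] unfolding m_def by fastforce
  then obtain \<Xi> where \<Xi>: "\<And>n. T (\<Xi> n) < m + 1 / real (Suc n)" by metis
  define \<xi> where "\<xi> k = \<Xi> (fst (prod_decode k)) (snd (prod_decode k))" for k
  have \<xi>_enum: "\<Xi> n i = \<xi> (prod_encode (n, i))" for n i by (simp add: \<xi>_def)
  have T_anti: "T \<eta> \<le> T \<eta>'" if "annihilator \<eta> \<subseteq> annihilator \<eta>'" for \<eta> \<eta>'
    using attained[of \<eta>] that T_ge by (metis subsetD)
  have "T \<xi> \<le> m + 1 / real (Suc n)" for n
  proof -
    have "annihilator \<xi> \<subseteq> annihilator (\<Xi> n)" by (auto simp: annihilator_def \<xi>_enum)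
    then show ?thesis using T_anti \<Xi>[of n] by (meson less_imp_le order_trans)
  qed
  moreover have "(\<lambda>n. m + 1 / real (Suc n)) \<longlonglongrightarrow> m + 0"
    by (intro tendsto_intros LIMSEQ_Suc[OF lim_1_over_n])
  ultimately have "T \<xi> \<le> m" by (intro LIMSEQ_le_const[of _ m]) auto
  then have Tm: "T \<xi> = m" using m_le[of \<xi>] by simp
  obtain p where p: "p \<in> annihilator \<xi>" "Re (t p) = m" using attained[of \<xi>] Tm by auto
  have "p = 0"
  proof (rule ccontr)
    assume "p \<noteq> 0"
    then obtain v where v: "p \<rhd> v \<noteq> 0" using bop_eqI[of p 0] by auto
    \<comment> \<open>The sequence \<open>\<eta>\<close> is \<open>\<xi>\<close> with \<open>v\<close> put in front.\<close>
    define \<eta> where "\<eta> = case_nat v \<xi>"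
    obtain q where q: "q \<in> annihilator \<eta>" "Re (t q) = T \<eta>" using attained by blast
    have sub: "annihilator \<eta> \<subseteq> annihilator \<xi>"
    proof
      fix g assume g: "g \<in> annihilator \<eta>"
      then have "g \<rhd> \<eta> (Suc i) = 0" for i unfolding annihilator_def by blast
      then show "g \<in> annihilator \<xi>" using g by (simp add: annihilator_def \<eta>_def)
    qed
    have "T \<eta> = m" using T_anti[OF sub] m_le[of \<eta>] Tm by simp
    define g where "g n = (if n = 0 then p else q)" for n :: nat
    have "g n \<in> annihilator \<xi>" for n using p(1) q(1) sub by (auto simp: g_def)
    then obtain r where r: "r \<in> annihilator \<xi>" "\<And>n. g n \<preceq> r" using annihilator_upper_bound by blast
    \<comment> \<open>Elements of maximal trace are maximal, so \<open>p\<close> and \<open>q\<close> both equal their common bound.\<close>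
    have "r = h" if "h \<in> annihilator \<xi>" "h \<preceq> r" "Re (t h) = m" for h
    proof -
      have hr: "h \<in> D" "r \<in> D" using that r(1) by (auto simp: annihilator_def unit_interval_def)
      have "r - h = 0"
        using T_ge[OF r(1)] that hr by (intro t_eq_zero) (auto simp: t_diff Tm D_rules)
      then show ?thesis by simp
    qed
    from this[OF p(1) _ p(2)] this[of q] have "r = p" "r = q"
      using r(2)[of 0] r(2)[of 1] q \<open>T \<eta> = m\<close> sub by (auto simp: g_def)
    moreover have "q \<rhd> \<eta> 0 = 0" using q(1) unfolding annihilator_def by blast
    ultimately show False using v by (simp add: \<eta>_def)
  qed
  then have "m = 0" using p(2) t0 by simp
  have "g = 0" if g: "g \<in> annihilator \<xi>" for g
    using T_ge[OF g] g unfolding Tm \<open>m = 0\<close>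
    by (intro t_eq_zero) (auto simp: annihilator_def unit_interval_def)
  then show ?thesis using that[of \<xi>] zero_in by blast
qed

text \<open>The vectors of a separating sequence may be scaled to make the sequence square-summable.\<close>

lemma separating_ell2:
  obtains \<zeta> where "\<And>g. g \<in> unit_interval \<Longrightarrow> (\<And>i. g \<rhd> coord \<zeta> i = 0) \<Longrightarrow> g = 0"
proof -
  obtain \<xi> where \<xi>: "annihilator \<xi> = {0}" by (rule separating_sequence)
  define c where "c i = (1/2) ^ i / (1 + norm (\<xi> i))" for i
  have c: "c i > 0" for i by (simp add: c_def add_pos_nonneg)
  have c_le: "norm (c i *\<^sub>R \<xi> i) \<le> (1/2) ^ i" for i
  proof -
    have "c i * norm (\<xi> i) \<le> c i * (1 + norm (\<xi> i))" using c[of i] by simp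
    also have "\<dots> = (1/2) ^ i"
      using norm_ge_zero[of "\<xi> i"] by (simp add: c_def del: norm_ge_zero)
    finally show ?thesis using c[of i] by simp
  qed
  have "summable (\<lambda>i. (norm (c i *\<^sub>R \<xi> i))\<^sup>2)"
  proof (rule summable_comparison_test)
    have "(norm (c i *\<^sub>R \<xi> i))\<^sup>2 \<le> (1/2) ^ i" for i
    proof -
      have "norm (c i *\<^sub>R \<xi> i) * norm (c i *\<^sub>R \<xi> i) \<le> (1/2) ^ i * 1"
        by (rule mult_mono[OF c_le order_trans[OF c_le]]) (simp_all add: power_le_one)
      then show ?thesis by (simp add: power2_eq_square)
    qed
    then show "\<exists>N. \<forall>i\<ge>N. norm ((norm (c i *\<^sub>R \<xi> i))\<^sup>2) \<le> (1/2) ^ i" by simp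
  qed simp
  then have coord: "coord (Ell2 (\<lambda>i. c i *\<^sub>R \<xi> i)) = (\<lambda>i. c i *\<^sub>R \<xi> i)" by (simp add: Ell2_inverse)
  show ?thesis
  proof (rule that[of "Ell2 (\<lambda>i. c i *\<^sub>R \<xi> i)"])
    fix g assume g: "g \<in> unit_interval" "\<And>i. g \<rhd> coord (Ell2 (\<lambda>i. c i *\<^sub>R \<xi> i)) i = 0"
    have "g \<rhd> \<xi> i = 0" for i
      using g(2)[of i] c[of i] by (simp add: coord apply_bop_scaleR)
    then show "g = 0" using g(1) \<xi> by (auto simp: annihilator_def)
  qed
qed

subsection \<open>Absolute continuity and approximation\<close>

text \<open>Normality of \<open>F\<close> only gives weak convergence of \<open>F (v\<^sup>\<dagger> g\<^sub>n v)\<close> to \<open>0\<close>. But this sequence of \<open>D\<close> decreases,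
  so \<open>0\<close> is its greatest lower bound, and the trace sees that.\<close>

lemma decreasing_to_zero:
  assumes g: "\<And>n. g n \<in> unit_interval" "\<And>n. g (Suc n) \<preceq> g n" "strong_limit g 0" and v: "v \<in> M"
  shows "(\<lambda>n. Re (\<phi> (v\<^sup>\<dagger> * g n * v))) \<longlonglongrightarrow> 0"
proof -
  have g': "g n \<in> D" "positive_bop (g n)" "g n \<preceq> 1" for n using g(1) by (auto simp: unit_interval_def)
  define C where "C = (bnorm v)\<^sup>2 + 1"
  have C: "C > 0" by (simp add: C_def add_nonneg_pos)
  define a where "a n = v\<^sup>\<dagger> * g n * v" for n
  have aM: "a n \<in> M" for n unfolding a_def by (intro M_rules v D_M g')
  have a_pos: "positive_bop (a n)" for n unfolding a_def by (intro positive_conj g')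
  have "v\<^sup>\<dagger> * g n * v \<preceq> v\<^sup>\<dagger> * 1 * v" for n by (intro le_bop_conj g')
  then have "a n \<preceq> v\<^sup>\<dagger> * v" for n by (simp add: a_def)
  moreover have "v\<^sup>\<dagger> * v \<preceq> C *\<^sub>r 1"
    using positive_add[OF square_le_bnorm[of v] positive_one] by (simp add: C_def scaleC_bop_simps algebra_simps)
  ultimately have a_le: "a n \<preceq> C *\<^sub>r 1" for n using le_bop_trans by blast
  have a_dec: "a (Suc n) \<preceq> a n" for n unfolding a_def by (intro le_bop_conj g)
  have a_lim: "strong_limit a 0"
    unfolding a_def using strong_limit_mult[OF g(3), of "v\<^sup>\<dagger>" v] by simp
  have a_bound: "norm (a n \<rhd> x) \<le> (bnorm v * bnorm v) * norm x" for n x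
  proof -
    have "norm (a n \<rhd> x) \<le> bnorm v * norm (g n \<rhd> v \<rhd> x)" unfolding a_def by (simp add: bnorm_adj)
    also have "\<dots> \<le> bnorm v * (bnorm v * norm x)"
      by (intro mult_left_mono bnorm_nonneg order_trans[OF contraction_norm bnorm_bound] g')
    finally show ?thesis by (simp add: mult.assoc)
  qed
  have F_form: "(\<lambda>n. cinner x (F (a n) \<rhd> y)) \<longlonglongrightarrow> 0" for x y
    using normal_map_limit_form[OF F_normal aM _ a_lim a_bound, of x y] by (simp add: M_rules F_zero)
  \<comment> \<open>Rescaled and turned upside down, the sequence increases inside the unit interval.\<close>
  define b where "b n = 1 - (1 / C) *\<^sub>r F (a n)" for n
  have FC: "F (a n) \<preceq> C *\<^sub>r 1" for n
    using F_mono[OF aM _ a_le, of n] by (simp add: M_rules F_id D_rules)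
  have "b n \<in> unit_interval" for n
  proof -
    have "(1 / C) *\<^sub>r (C *\<^sub>r 1 - F (a n)) = b n" using C by (simp add: b_def scaleC_bop_simps)
    then have "positive_bop (b n)" using positive_scale[OF _ FC, of "1 / C" n] C by simp
    moreover have "1 - b n = (1 / C) *\<^sub>r F (a n)" by (simp add: b_def)
    then have "b n \<preceq> 1" using positive_scale[OF _ F_positive[OF aM a_pos], of "1 / C" n] C by simp
    moreover have "b n \<in> D" unfolding b_def by (intro D_rules F_in aM)
    ultimately show ?thesis by (simp add: unit_interval_def)
  qed
  moreover have "b n \<preceq> b (Suc n)" for n
  proof -
    have "b (Suc n) - b n = (1 / C) *\<^sub>r (F (a n) - F (a (Suc n)))" by (simp add: b_def scaleC_bop_simps)
    also have "positive_bop \<dots>" by (intro positive_scale F_mono aM a_dec) (use C in simp)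
    finally show ?thesis .
  qed
  ultimately obtain l where l: "l \<in> unit_interval" "strong_limit b l" "(\<lambda>n. t (b n)) \<longlonglongrightarrow> t l"
    by (rule increasing_limit)
  have "l = 1"
  proof (intro bop_eqI cinner_extI)
    fix x y
    have "(\<lambda>n. cinner y x - complex_of_real (1 / C) * cinner y (F (a n) \<rhd> x))
        \<longlonglongrightarrow> cinner y x - complex_of_real (1 / C) * 0"
      by (intro tendsto_intros F_form)
    moreover have "cinner y (b n \<rhd> x) = cinner y x - complex_of_real (1 / C) * cinner y (F (a n) \<rhd> x)" for n
      by (simp add: b_def cinner_simps)
    ultimately show "cinner y (l \<rhd> x) = cinner y (1 \<rhd> x)"
      using strong_limit_form[OF l(2), of y x] LIMSEQ_unique by fastforce
  qed
  then have "(\<lambda>n. t (b n)) \<longlonglongrightarrow> 1" using l(3) by (simp add: t_one)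
  then have "(\<lambda>n. C * (1 - Re (t (b n)))) \<longlonglongrightarrow> C * (1 - Re 1)" by (intro tendsto_intros)
  moreover have "C * (1 - Re (t (b n))) = Re (\<phi> (v\<^sup>\<dagger> * g n * v))" for n
  proof -
    have "t (b n) = 1 - (1 / C) * \<phi> (a n)"
      unfolding b_def \<phi>_def by (simp add: t_diff t_scale t_one D_rules F_in aM)
    then show ?thesis using C by (simp add: a_def)
  qed
  ultimately show ?thesis by simp
qed

text \<open>Otherwise there are \<open>k\<^sub>n\<close> with \<open>\<omega> k\<^sub>n < 2\<^sup>-\<^sup>n\<close> on which the functional stays above \<open>\<delta>\<close>. As in the Borel--Cantelli
  lemma, take upper bounds \<open>g\<^sub>n\<close> of the tails, made from the cuts of their sums. They decrease to an
  element that \<open>\<omega>\<close> annihilates, so to \<open>0\<close>, which contradicts \<open>g\<^sub>n \<ge> k\<^sub>n / 2\<close>.\<close>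

lemma absolute_continuity:
  assumes \<zeta>: "\<And>g. g \<in> unit_interval \<Longrightarrow> (\<And>i. g \<rhd> coord \<zeta> i = 0) \<Longrightarrow> g = 0"
    and v: "v \<in> M" and \<delta>: "\<delta> > 0"
  shows "\<exists>\<eta>>0. \<forall>k\<in>unit_interval. Re (cinner \<zeta> (amplify k \<zeta>)) < \<eta> \<longrightarrow> Re (\<phi> (v\<^sup>\<dagger> * k * v)) < \<delta>"
proof (rule ccontr)
  define \<omega> where "\<omega> T = Re (cinner \<zeta> (amplify T \<zeta>))" for T
  assume neg: "\<not> ?thesis"
  have "\<exists>k\<in>unit_interval. \<omega> k < (1/2) ^ n \<and> \<delta> \<le> Re (\<phi> (v\<^sup>\<dagger> * k * v))" for n
  proof -
    have "(1/2 :: real) ^ n > 0" by simp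
    then show ?thesis using neg unfolding \<omega>_def by (meson not_le)
  qed
  then obtain k where k: "\<And>n. k n \<in> unit_interval" "\<And>n. \<omega> (k n) < (1/2) ^ n"
    "\<And>n. \<delta> \<le> Re (\<phi> (v\<^sup>\<dagger> * k n * v))" by metis
  have k': "k n \<in> D" "positive_bop (k n)" "k n \<preceq> 1" for n using k(1) by (auto simp: unit_interval_def)
  define s where "s n m = (\<Sum>j\<in>{n..<m}. k j)" for n m
  have s: "s n m \<in> D" "positive_bop (s n m)" for n m
    unfolding s_def by (intro D_rules positive_sum k')+
  have s_inc: "s n m \<preceq> s n (Suc m)" for n m
    by (cases "n \<le> m") (auto simp: s_def k')
  have s_dec: "s (Suc n) m \<preceq> s n m" for n m
    by (cases "n < m") (auto simp: s_def sum.atLeast_Suc_lessThan k')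
  have \<omega>_sum: "\<omega> (\<Sum>j\<in>J. k j) = (\<Sum>j\<in>J. \<omega> (k j))" for J :: "nat set"
    by (induction J rule: infinite_finite_induct) (auto simp: \<omega>_def amplify_simps cinner_simps)
  have \<omega>s: "\<omega> (s n m) \<le> 2 * (1/2) ^ n" for n m
  proof (cases "n \<le> m")
    case True
    have "\<omega> (s n m) \<le> (\<Sum>j\<in>{n..<m}. (1/2) ^ j)"
      unfolding s_def \<omega>_sum by (intro sum_mono less_imp_le k)
    also have "\<dots> = 2 * (1/2) ^ n - 2 * (1/2) ^ m"
      using True by (induction m rule: dec_induct) simp_all
    also have "\<dots> \<le> 2 * (1/2) ^ n" by simp
    finally show ?thesis .
  qed (simp add: s_def \<omega>_def amplify_simps)
  have ui: "cut (s n m) \<in> unit_interval" for n m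
    by (auto simp: unit_interval_def intro!: D_cut s cut_positive cut_le_one)
  have "\<exists>g. g \<in> unit_interval \<and> strong_limit (\<lambda>m. cut (s n m)) g" for n
    by (rule increasing_limit[of "\<lambda>m. cut (s n m)"]) (auto intro: ui cut_mono s s_inc)
  then obtain g where g: "\<And>n. g n \<in> unit_interval" "\<And>n. strong_limit (\<lambda>m. cut (s n m)) (g n)" by metis
  have cut_le_g: "cut (s n m) \<preceq> g n" for n m
    by (rule strong_limit_ge[OF g(2)]) (intro cut_mono s s_inc)
  have g_dec: "g (Suc n) \<preceq> g n" for n
    by (rule strong_limit_le[OF g(2)]) (intro le_bop_trans[OF cut_mono[OF s(2) s_dec] cut_le_g])
  have g_form: "Re (cinner (coord \<zeta> i) (g n \<rhd> coord \<zeta> i)) \<le> 2 * (1/2) ^ n" for i n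
  proof (rule LIMSEQ_le_const2[OF tendsto_Re[OF strong_limit_form[OF g(2)]]])
    have "Re (cinner (coord \<zeta> i) (cut (s n m) \<rhd> coord \<zeta> i)) \<le> 2 * (1/2) ^ n" for m
    proof -
      have "Re (cinner (coord \<zeta> i) (cut (s n m) \<rhd> coord \<zeta> i)) \<le> \<omega> (cut (s n m))"
        unfolding \<omega>_def by (intro form_le_amplify cut_positive s)
      also have "\<dots> \<le> \<omega> (s n m)" unfolding \<omega>_def by (intro amplify_form_mono cut_le s)
      finally show ?thesis using \<omega>s[of n m] by simp
    qed
    then show "\<exists>N. \<forall>m\<ge>N. Re (cinner (coord \<zeta> i) (cut (s n m) \<rhd> coord \<zeta> i)) \<le> 2 * (1/2) ^ n" by blast
  qed
  have co_ui: "1 - h \<in> unit_interval" if "h \<in> unit_interval" for h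
    using that by (auto simp: unit_interval_def D_rules)
  obtain l where l: "l \<in> unit_interval" "strong_limit (\<lambda>n. 1 - g n) l"
    by (rule increasing_limit[of "\<lambda>n. 1 - g n"]) (use g_dec in \<open>auto intro: co_ui g\<close>)
  have lim: "strong_limit g (1 - l)"
    using strong_limit_diff[OF strong_limit_const[of 1] l(2)] by simp
  have "1 - l = 0"
  proof (rule \<zeta>[OF co_ui[OF l(1)]])
    fix i
    have pos: "positive_bop (1 - l)" using l(1) by (simp add: unit_interval_def)
    have "1 - l \<preceq> g n" for n
      using strong_limit_ge[OF l(2), of n] g_dec by (simp add: algebra_simps)
    then have "Re (cinner (coord \<zeta> i) ((1 - l) \<rhd> coord \<zeta> i)) \<le> 2 * (1/2) ^ n" for n
      using le_bop_form g_form order_trans by blast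
    note bound = this
    have "(\<lambda>n. 2 * (1/2 :: real) ^ n) \<longlonglongrightarrow> 2 * 0"
      by (intro tendsto_intros LIMSEQ_realpow_zero) auto
    then have "Re (cinner (coord \<zeta> i) ((1 - l) \<rhd> coord \<zeta> i)) \<le> 2 * 0"
      by (rule LIMSEQ_le_const) (use bound in blast)
    then have "Re (cinner (coord \<zeta> i) ((1 - l) \<rhd> coord \<zeta> i)) \<le> 0" by simp
    then show "(1 - l) \<rhd> coord \<zeta> i = 0"
      using positive_form[OF pos] by (intro positive_form_zero[OF pos]) (simp add: order_antisym)
  qed
  then have "strong_limit g 0" using lim by simp
  then have to0: "(\<lambda>n. Re (\<phi> (v\<^sup>\<dagger> * g n * v))) \<longlonglongrightarrow> 0"
    by (intro decreasing_to_zero g g_dec v)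
  have "\<delta> / 2 \<le> Re (\<phi> (v\<^sup>\<dagger> * g n * v))" for n
  proof -
    have "(1 / (1 + 1)) *\<^sub>r k n \<preceq> cut (k n)"
      using k'[of n] by (intro le_cut) (auto simp: scaleC_bop_simps)
    moreover have "cut (k n) \<preceq> g n" using cut_le_g[of n "Suc n"] by (simp add: s_def)
    ultimately have "(1 / 2) *\<^sub>r k n \<preceq> g n" using le_bop_trans by fastforce
    then have "v\<^sup>\<dagger> * ((1 / 2) *\<^sub>r k n) * v \<preceq> v\<^sup>\<dagger> * g n * v" by (rule le_bop_conj)
    then have "Re (\<phi> (v\<^sup>\<dagger> * ((1 / 2) *\<^sub>r k n) * v)) \<le> Re (\<phi> (v\<^sup>\<dagger> * g n * v))"
      using g(1) k' v by (intro \<phi>_mono M_rules) (auto simp: unit_interval_def D_M)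
    moreover have "Re (\<phi> (v\<^sup>\<dagger> * ((1 / 2) *\<^sub>r k n) * v)) = (1 / 2) * Re (\<phi> (v\<^sup>\<dagger> * k n * v))"
      using k' v by (simp add: scaleC_bop_mult \<phi>_scale M_rules D_M)
    ultimately show ?thesis using k(3)[of n] by simp
  qed
  then have "\<delta> / 2 \<le> 0" by (intro LIMSEQ_le_const[OF to0]) auto
  then show False using \<delta> by simp
qed

end

section \<open>Approximation in the trace norm\<close>

lemma topspace_ultraweak: "topspace (ultraweak_topology :: 'h::chilbert_space bop topology) = UNIV"
proof -
  have "ultraweak_functional (\<lambda>_. 0) (\<lambda>_. 0) -` UNIV \<in> {ultraweak_functional \<xi> \<eta> -` U | \<xi> \<eta> U.
        summable (\<lambda>n. (norm (\<xi> n :: 'h))\<^sup>2) \<and> summable (\<lambda>n. (norm (\<eta> n))\<^sup>2) \<and> open U}"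
    by (intro CollectI exI[of _ "\<lambda>_. 0"] exI[of _ UNIV]) auto
  then show ?thesis unfolding ultraweak_topology_def topology_generated_by_topspace by blast
qed

locale dense_star_algebra = tracial_expectation M D F t + A: unital_star_algebra A
  for M D :: "'k::chilbert_space bop set" and F t A +
  assumes bicommutant: "M = commutant (commutant A)" and D_A: "D \<subseteq> A"
begin

lemma A_M: "y \<in> A \<Longrightarrow> y \<in> M"
  using bicommutant subset_bicommutant by blast

text \<open>Ultraweak density together with normality of \<open>F\<close> only makes \<open>h = F (u\<^sup>\<dagger> u)\<close>, for the error
  \<open>u = x - y\<close>, small against one normal functional, which does not bound its trace. Compressing
  \<open>y\<close> by \<open>r = (1 + h)\<^sup>-\<^sup>1\<close> cures this: the new error is governed by \<open>k = 1 - r\<close>, which lies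
  between \<open>0\<close> and \<open>1\<close> and below \<open>h\<close>, so that absolute continuity applies to it.\<close>

lemma selfadjoint_approximation:
  assumes x: "x \<in> M" "x\<^sup>\<dagger> = x" and e: "e > 0"
  obtains y where "y \<in> A" "y\<^sup>\<dagger> = y" "norm2 (x - y) < e"
proof -
  define b where "b = bnorm x"
  have b: "b \<ge> 0" by (simp add: b_def bnorm_nonneg)
  \<comment> \<open>The three error terms below add up to at most \<open>(2 + b) sqrt d\<close>.\<close>
  define d where "d = (e / (3 + b))\<^sup>2"
  have d: "d > 0" using e b by (simp add: d_def)
  obtain \<zeta> where \<zeta>: "\<And>g. g \<in> unit_interval \<Longrightarrow> (\<And>i. g \<rhd> coord \<zeta> i = 0) \<Longrightarrow> g = 0"
    by (rule separating_ell2) blast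
  define \<omega> where "\<omega> T = Re (cinner \<zeta> (amplify T \<zeta>))" for T
  obtain \<eta>1 where \<eta>1: "\<eta>1 > 0" "\<And>k. k \<in> unit_interval \<Longrightarrow> \<omega> k < \<eta>1 \<Longrightarrow> Re (\<phi> (1\<^sup>\<dagger> * k * 1)) < d"
    using absolute_continuity[OF \<zeta> vna_one[OF M] d] unfolding \<omega>_def by blast
  obtain \<eta>2 where \<eta>2: "\<eta>2 > 0" "\<And>k. k \<in> unit_interval \<Longrightarrow> \<omega> k < \<eta>2 \<Longrightarrow> Re (\<phi> (x\<^sup>\<dagger> * k * x)) < d"
    using absolute_continuity[OF \<zeta> x(1) d] unfolding \<omega>_def by blast
  define \<eta> where "\<eta> = min \<eta>1 \<eta>2"
  have \<eta>: "\<eta> > 0" using \<eta>1(1) \<eta>2(1) by (simp add: \<eta>_def)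
  have "openin ultraweak_topology (ultraweak_functional (coord \<zeta>) (coord \<zeta>) -` {z. Re z < \<eta>})"
    unfolding ultraweak_topology_def using summable_coord[of \<zeta>] open_halfspace_Re_lt[of \<eta>]
    by (intro topology_generated_by_Basis) blast
  moreover have "ultraweak_functional (coord \<zeta>) (coord \<zeta>) T = cinner \<zeta> (amplify T \<zeta>)" for T
    by (simp add: ultraweak_functional_def cinner_ell2_def)
  ultimately have "openin ultraweak_topology {T. \<omega> T < \<eta>}" by (simp add: vimage_def \<omega>_def)
  then have "openin (subtopology ultraweak_topology D) ({T. \<omega> T < \<eta>} \<inter> D)"
    unfolding openin_subtopology by blast
  from openin_continuous_map_preimage[OF F_normal[unfolded normal_map_def] this]
  obtain V where V: "openin ultraweak_topology V" "{T \<in> M. F T \<in> {T. \<omega> T < \<eta>} \<inter> D} = V \<inter> M"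
    unfolding openin_subtopology by (auto simp: topspace_ultraweak)
  have "0 \<in> {T \<in> M. F T \<in> {T. \<omega> T < \<eta>} \<inter> D}"
    using \<eta> by (simp add: M_rules F_zero D_rules \<omega>_def amplify_simps)
  then have V0: "0 \<in> V" unfolding V(2) by blast
  obtain \<zeta>' :: "'k ell2" and e' where e': "e' > 0" "\<And>u. norm (amplify u \<zeta>') < e' \<Longrightarrow> u\<^sup>\<dagger> * u \<in> V"
    by (rule ultraweak_neighbourhood[OF V(1) V0]) blast
  obtain y where y: "y \<in> A" "y\<^sup>\<dagger> = y" "norm (amplify (x - y) \<zeta>') < e'"
    by (rule A.selfadjoint_density[OF x(1)[unfolded bicommutant] x(2) e'(1)])
  define u where "u = x - y"
  have u: "u \<in> M" "u\<^sup>\<dagger> = u" using x y A_M by (auto simp: u_def M_rules adj_diff)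
  define h where "h = F (u * u)"
  have uu: "u * u \<in> M" "positive_bop (u * u)" using u positive_square[of u] by (auto simp: M_rules)
  have h: "h \<in> D" "positive_bop h" unfolding h_def by (intro F_in F_positive uu)+
  have "u\<^sup>\<dagger> * u \<in> V \<inter> M" using e'(2)[of u] y(3) uu u by (simp add: u_def)
  then have \<omega>h: "\<omega> h < \<eta>" unfolding V(2)[symmetric] using u by (simp add: h_def)
  define r k where "r = resolvent h" and "k = cut h"
  have k: "k \<in> D" "positive_bop k" "k \<preceq> 1" "k\<^sup>\<dagger> = k"
    unfolding k_def by (intro D_cut h cut_positive cut_le_one cut_selfadjoint)+
  have rk: "r = 1 - k" by (simp add: r_def k_def cut_def)
  have r: "r \<in> D" "positive_bop r" "r \<preceq> 1" "r\<^sup>\<dagger> = r"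
    using h(2) unfolding r_def
    by (auto intro: resolvent_positive positive_selfadjoint simp: rk[unfolded r_def] D_rules k)
  have hr: "h * r = k" "r * h = k" using cut_eq[OF h(2)] by (auto simp: r_def k_def)
  have \<omega>k: "\<omega> k < \<eta>"
    using amplify_form_mono[OF cut_le[OF h(2)], of \<zeta>] \<omega>h unfolding \<omega>_def k_def by simp
  have kui: "k \<in> unit_interval" using k by (simp add: unit_interval_def)
  have tk: "Re (\<phi> k) < d" using \<eta>1(2)[OF kui] \<omega>k by (simp add: \<eta>_def)
  have xkx: "Re (\<phi> (x * k * x)) < d" using \<eta>2(2)[OF kui] \<omega>k x(2) by (simp add: \<eta>_def)
  have kM: "k \<in> M" and rM: "r \<in> M" using k r D_M by auto
  have kk: "k * k \<preceq> k" by (rule contraction_square[OF k(2,3)])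
  have rr: "r * r \<preceq> r" by (rule contraction_square[OF r(2,3)])
  have rr1: "r * r \<preceq> 1" using le_bop_trans[OF rr r(3)] .
  have n1: "norm2 (k * x) \<le> sqrt d"
  proof -
    have "x\<^sup>\<dagger> * (k * k) * x \<preceq> x\<^sup>\<dagger> * k * x" by (rule le_bop_conj[OF kk])
    then have "Re (\<phi> (x * (k * k) * x)) \<le> Re (\<phi> (x * k * x))"
      unfolding x(2) by (intro \<phi>_mono M_rules x kM)
    then show ?thesis using xkx by (simp add: norm2_def adj_mult x k mult.assoc)
  qed
  have n2: "norm2 (r * x * k) \<le> b * sqrt d"
  proof -
    have "(r * x)\<^sup>\<dagger> * (r * x) \<preceq> x\<^sup>\<dagger> * 1 * x"
      using le_bop_conj[OF rr1, of x] by (simp add: adj_mult r mult.assoc)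
    then have "(r * x)\<^sup>\<dagger> * (r * x) \<preceq> b\<^sup>2 *\<^sub>r 1"
      using square_le_bnorm[of x] by (simp add: b_def) (meson le_bop_trans)
    then have "k\<^sup>\<dagger> * ((r * x)\<^sup>\<dagger> * (r * x)) * k \<preceq> k\<^sup>\<dagger> * (b\<^sup>2 *\<^sub>r 1) * k" by (rule le_bop_conj)
    then have "(r * x * k)\<^sup>\<dagger> * (r * x * k) \<preceq> b\<^sup>2 *\<^sub>r (k * k)"
      by (simp add: adj_mult mult.assoc k scaleC_bop_mult)
    moreover have "b\<^sup>2 *\<^sub>r (k * k) \<preceq> b\<^sup>2 *\<^sub>r k"
      using positive_scale[OF _ kk, of "b\<^sup>2"] by (simp add: scaleC_bop_simps)
    ultimately have "(r * x * k)\<^sup>\<dagger> * (r * x * k) \<preceq> b\<^sup>2 *\<^sub>r k" by (rule le_bop_trans)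
    then have "Re (\<phi> ((r * x * k)\<^sup>\<dagger> * (r * x * k))) \<le> Re (\<phi> (b\<^sup>2 *\<^sub>r k))"
      by (intro \<phi>_mono M_rules rM kM x)
    also have "\<dots> = b\<^sup>2 * Re (\<phi> k)" by (simp add: \<phi>_scale kM flip: of_real_power)
    also have "\<dots> \<le> b\<^sup>2 * d" using tk by (intro mult_left_mono) auto
    finally have "norm2 (r * x * k) \<le> sqrt (b\<^sup>2 * d)" unfolding norm2_def by (rule real_sqrt_le_mono)
    then show ?thesis using b by (simp add: real_sqrt_mult)
  qed
  have n3: "norm2 (r * u * r) \<le> sqrt d"
  proof -
    have "(u * r)\<^sup>\<dagger> * (r * r) * (u * r) \<preceq> (u * r)\<^sup>\<dagger> * 1 * (u * r)" by (rule le_bop_conj[OF rr1])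
    then have "(r * u * r)\<^sup>\<dagger> * (r * u * r) \<preceq> r * (u * u) * r"
      by (simp add: adj_mult r u mult.assoc)
    then have "Re (\<phi> ((r * u * r)\<^sup>\<dagger> * (r * u * r))) \<le> Re (\<phi> (r * (u * u) * r))"
      by (intro \<phi>_mono M_rules rM u)
    also have "\<phi> (r * (u * u) * r) = \<phi> (r * h * r)"
      using F_bimodule[OF r(1) r(1) uu(1)] F_id[OF D_mult[OF D_mult[OF r(1) h(1)] r(1)]] by (simp add: \<phi>_def h_def)
    also have "r * h * r = k - k * k" unfolding hr by (simp add: rk algebra_simps)
    also have "Re (\<phi> (k - k * k)) \<le> Re (\<phi> k)"
      using positive_square[of k] k by (intro \<phi>_mono M_rules kM) simp
    finally show ?thesis using tk by (simp add: norm2_def)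
  qed
  have "r * y * r \<in> A" using r(1) y(1) D_A by (auto intro: A.mult)
  moreover have "(r * y * r)\<^sup>\<dagger> = r * y * r" by (simp add: adj_mult r y mult.assoc)
  moreover have "norm2 (x - r * y * r) < e"
  proof -
    \<comment> \<open>Insert \<open>x = k x + r x\<close> and \<open>x = x k + x r\<close>.\<close>
    have "x - r * y * r = k * x + (r * x * k + r * u * r)"
      by (simp add: rk u_def algebra_simps)
    then have "norm2 (x - r * y * r) \<le> norm2 (k * x) + norm2 (r * x * k + r * u * r)"
      by (simp only:) (intro norm2_triangle M_rules kM rM x u)
    also have "norm2 (r * x * k + r * u * r) \<le> norm2 (r * x * k) + norm2 (r * u * r)"
      by (intro norm2_triangle M_rules kM rM x u)
    finally have "norm2 (x - r * y * r) \<le> (2 + b) * sqrt d" using n1 n2 n3 by (simp add: algebra_simps)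
    also have "sqrt d = e / (3 + b)" using e b by (simp add: d_def)
    also have "(2 + b) * (e / (3 + b)) < e" using e b by (simp add: field_simps)
    finally show ?thesis .
  qed
  ultimately show ?thesis using that by blast
qed

text \<open>Taking adjoints is not known to be continuous for the trace norm as long as \<open>\<phi>\<close> is not known to be a
  trace on \<open>M\<close>. Self-adjoint approximants of the real and imaginary parts control both errors.\<close>

lemma approximation:
  assumes x: "x \<in> M" and e: "e > 0"
  obtains y where "y \<in> A" "norm2 (x - y) < e" "norm2 (x\<^sup>\<dagger> - y\<^sup>\<dagger>) < e"
proof -
  obtain a b where ab: "x = a + scaleC_bop \<i> b" "x\<^sup>\<dagger> = a - scaleC_bop \<i> b" "a\<^sup>\<dagger> = a" "b\<^sup>\<dagger> = b" "a \<in> M" "b \<in> M"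
    using x by (rule M_parts)
  have "e / 2 > 0" using e by simp
  obtain a' where a': "a' \<in> A" "a'\<^sup>\<dagger> = a'" "norm2 (a - a') < e / 2"
    by (rule selfadjoint_approximation[OF ab(5,3) \<open>e / 2 > 0\<close>])
  obtain b' where b': "b' \<in> A" "b'\<^sup>\<dagger> = b'" "norm2 (b - b') < e / 2"
    by (rule selfadjoint_approximation[OF ab(6,4) \<open>e / 2 > 0\<close>])
  have M': "a - a' \<in> M" "b - b' \<in> M" using ab a' b' A_M by (auto intro: M_rules)
  have neg: "- scaleC_bop \<i> c = scaleC_bop (- \<i>) c" for c :: "'k bop"
    using scaleC_bop_simps(2)[of "- 1" \<i> c] by (simp add: scaleC_bop_simps(6))
  have bound: "norm2 ((a - a') + scaleC_bop z (b - b')) < e" if "cmod z = 1" for z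
  proof -
    have "norm2 ((a - a') + scaleC_bop z (b - b')) \<le> norm2 (a - a') + norm2 (scaleC_bop z (b - b'))"
      by (intro norm2_triangle M_rules M')
    then show ?thesis using a' b' that by (simp add: norm2_scale M')
  qed
  define y where "y = a' + scaleC_bop \<i> b'"
  have y': "y\<^sup>\<dagger> = a' - scaleC_bop \<i> b'" by (simp add: y_def adj_add adj_scaleC a' b' neg[symmetric])
  have "x - y = (a - a') + scaleC_bop \<i> (b - b')" by (simp add: ab y_def scaleC_bop_simps)
  moreover have "x\<^sup>\<dagger> - y\<^sup>\<dagger> = (a - a') + scaleC_bop (- \<i>) (b - b')"
    unfolding ab(2) y' neg[symmetric] by (simp add: scaleC_bop_simps)
  moreover have "y \<in> A" by (simp add: y_def A.add A.scale a' b')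
  ultimately show ?thesis using that[of y] bound[of \<i>] bound[of "- \<i>"] by simp
qed

text \<open>The form in which density is used: an estimate by a multiple of the approximation error.\<close>

lemma norm2_smallI:
  assumes "x \<in> M" and small: "\<And>y. y \<in> A \<Longrightarrow> norm2 (x - y) < 1 \<Longrightarrow> norm2 (x\<^sup>\<dagger> - y\<^sup>\<dagger>) < 1 \<Longrightarrow>
      r \<le> C * max (norm2 (x - y)) (norm2 (x\<^sup>\<dagger> - y\<^sup>\<dagger>))" and C: "C \<ge> 0"
  shows "r \<le> 0"
proof (rule field_le_epsilon)
  fix e :: real assume e: "e > 0"
  define e' where "e' = min 1 (e / (C + 1))"
  have e': "e' > 0" using e C by (simp add: e'_def)
  obtain y where y: "y \<in> A" "norm2 (x - y) < e'" "norm2 (x\<^sup>\<dagger> - y\<^sup>\<dagger>) < e'" by (rule approximation[OF assms(1) e'])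
  then have "r \<le> C * max (norm2 (x - y)) (norm2 (x\<^sup>\<dagger> - y\<^sup>\<dagger>))" by (intro small) (auto simp: e'_def)
  also have "\<dots> \<le> C * e'" using y C by (intro mult_left_mono) auto
  also have "\<dots> \<le> C * (e / (C + 1))" using C by (intro mult_left_mono) (auto simp: e'_def)
  also have "\<dots> \<le> e" using e C by (simp add: field_simps)
  finally show "r \<le> 0 + e" by simp
qed

lemma commute_extends:
  assumes c: "c \<in> M" and A: "\<And>y. y \<in> A \<Longrightarrow> \<phi> (c * y) = \<phi> (y * c)" and x: "x \<in> M"
  shows "\<phi> (c * x) = \<phi> (x * c)"
proof -
  have "cmod (\<phi> (c * x) - \<phi> (x * c)) \<le> 0"
  proof (rule norm2_smallI[OF x])
    fix y assume y: "y \<in> A"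
    have M': "y \<in> M" "x - y \<in> M" "c\<^sup>\<dagger> \<in> M" "x\<^sup>\<dagger> - y\<^sup>\<dagger> \<in> M" using A_M y c x by (auto intro: M_rules)
    have "\<phi> (c * x) - \<phi> (x * c) = \<phi> (c * (x - y)) - \<phi> ((x - y) * c)"
      using A[OF y] by (simp add: algebra_simps \<phi>_diff M_rules M' c x)
    also have "cmod \<dots> \<le> cmod (\<phi> (c * (x - y))) + cmod (\<phi> ((x - y) * c))" by (rule norm_triangle_ineq4)
    also have "\<dots> \<le> norm2 (c\<^sup>\<dagger>) * norm2 (x - y) + norm2 (x\<^sup>\<dagger> - y\<^sup>\<dagger>) * norm2 c"
      using norm2_cauchy_schwarz[OF M'(3,2)] norm2_cauchy_schwarz[OF M'(4) c] by (simp add: adj_diff)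
    also have "\<dots> \<le> norm2 (c\<^sup>\<dagger>) * max (norm2 (x - y)) (norm2 (x\<^sup>\<dagger> - y\<^sup>\<dagger>)) + max (norm2 (x - y)) (norm2 (x\<^sup>\<dagger> - y\<^sup>\<dagger>)) * norm2 c"
      by (intro add_mono mult_left_mono mult_right_mono norm2_nonneg M' c) auto
    finally show "cmod (\<phi> (c * x) - \<phi> (x * c)) \<le> (norm2 (c\<^sup>\<dagger>) + norm2 c) * max (norm2 (x - y)) (norm2 (x\<^sup>\<dagger> - y\<^sup>\<dagger>))"
      by (simp add: algebra_simps)
  qed (intro add_nonneg_nonneg norm2_nonneg M_rules c)
  then show ?thesis by simp
qed

lemma trace_extends:
  assumes "\<And>c y. c \<in> A \<Longrightarrow> y \<in> A \<Longrightarrow> \<phi> (c * y) = \<phi> (y * c)" and x: "x \<in> M" and y: "y \<in> M"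
  shows "\<phi> (x * y) = \<phi> (y * x)"
proof (rule commute_extends[OF x _ y])
  fix c assume c: "c \<in> A"
  show "\<phi> (x * c) = \<phi> (c * x)"
    using commute_extends[OF A_M[OF c] assms(1)[OF c] x] by simp
qed

end

locale tracial_dense_star_algebra = dense_star_algebra +
  assumes \<phi>_trace_A: "\<And>c y. c \<in> A \<Longrightarrow> y \<in> A \<Longrightarrow> \<phi> (c * y) = \<phi> (y * c)"
    and gns: "faithful_gns M F"
begin

lemmas \<phi>_trace = trace_extends[OF \<phi>_trace_A]

lemma norm2_adj: "x \<in> M \<Longrightarrow> norm2 (x\<^sup>\<dagger>) = norm2 x"
  using \<phi>_trace[of x "x\<^sup>\<dagger>"] by (simp add: norm2_def M_rules)

lemma norm2_mult_right: "x \<in> M \<Longrightarrow> a \<in> M \<Longrightarrow> norm2 (x * a) \<le> bnorm (a\<^sup>\<dagger>) * norm2 x"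
  using norm2_mult_left[of "a\<^sup>\<dagger>" "x\<^sup>\<dagger>"] norm2_adj[of "x * a"] norm2_adj[of x] by (simp add: adj_mult M_rules)

text \<open>The null space of the trace norm is a left ideal, and by the trace property a right ideal as well; \<open>F\<close> then
  vanishes on \<open>y\<^sup>\<dagger> x\<^sup>\<dagger> x y\<close> for all \<open>y\<close>, which is what faithfulness of the GNS representation excludes.\<close>

lemma norm2_faithful:
  assumes x: "x \<in> M" "norm2 x \<le> 0" shows "x = 0"
proof -
  have "F (y\<^sup>\<dagger> * x\<^sup>\<dagger> * x * y) = 0" if y: "y \<in> M" for y
  proof -
    let ?s = "(x * y)\<^sup>\<dagger> * (x * y)"
    have s: "?s \<in> M" by (intro M_rules x y)
    have "norm2 (x * y) \<le> 0"
      using norm2_mult_right[OF x(1) y] mult_nonneg_nonpos[OF bnorm_nonneg[of "y\<^sup>\<dagger>"] x(2)] by linarith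
    then have "(norm2 (x * y))\<^sup>2 = 0" using norm2_nonneg[of "x * y"] x y by (simp add: M_rules)
    then have "Re (\<phi> ?s) = 0" using norm2_square[of "x * y"] x y by (simp add: M_rules)
    then have "F ?s = 0"
      by (intro t_eq_zero F_in F_positive positive_square s) (simp add: \<phi>_def)
    then show ?thesis by (simp add: adj_mult mult.assoc)
  qed
  then show ?thesis using gns x by (simp add: faithful_gns_def)
qed

text \<open>Pythagoras: \<open>F\<close> is the orthogonal projection onto \<open>D\<close>.\<close>

lemma norm2_minus_F: assumes u: "u \<in> M" shows "norm2 (u - F u) \<le> norm2 u"
proof -
  have Fu: "F u \<in> D" "F u \<in> M" "(F u)\<^sup>\<dagger> \<in> D" "u\<^sup>\<dagger> \<in> M" using F_in u D_M D_adj by (auto simp: M_rules)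
  have "(u - F u)\<^sup>\<dagger> * (u - F u) = u\<^sup>\<dagger> * u - u\<^sup>\<dagger> * F u - ((F u)\<^sup>\<dagger> * u - (F u)\<^sup>\<dagger> * F u)"
    by (simp add: adj_diff algebra_simps)
  then have "F ((u - F u)\<^sup>\<dagger> * (u - F u)) = F (u\<^sup>\<dagger> * u) - (F u)\<^sup>\<dagger> * F u"
    using Fu u D_M[OF Fu(3)] by (simp add: F_diff F_left F_right F_adj M_rules F_id D_rules)
  then have "\<phi> ((u - F u)\<^sup>\<dagger> * (u - F u)) = \<phi> (u\<^sup>\<dagger> * u) - \<phi> ((F u)\<^sup>\<dagger> * F u)"
    using Fu u by (simp add: \<phi>_def t_diff F_in M_rules F_id D_rules)
  then show ?thesis using \<phi>_square(2)[OF Fu(2)] by (simp add: norm2_def)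
qed

end

section \<open>Words in the amalgamated free product\<close>

lemma (in vna_isomorphism) resolvent_image:
  assumes s: "s \<in> B" "positive_bop s"
  shows "\<pi> (resolvent s) = resolvent (\<pi> s)"
proof -
  have r: "resolvent s \<in> B" by (rule vna_resolvent[OF B s(2,1)])
  have ps: "positive_bop (\<pi> s)" using s positive_iff by simp
  have "\<pi> (resolvent s) * (1 + \<pi> s) = \<pi> (resolvent s * (1 + s))"
    using s r by (simp add: mult add one vna_one[OF B] vna_add[OF B])
  also have "\<dots> = 1" by (simp add: resolvent_inverse[OF s(2)] one)
  finally have "\<pi> (resolvent s) * ((1 + \<pi> s) * resolvent (\<pi> s)) = resolvent (\<pi> s)"
    by (simp flip: mult.assoc)
  then show ?thesis by (simp add: resolvent_inverse[OF ps])
qed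

lemma (in vna_isomorphism) cut_image:
  "s \<in> B \<Longrightarrow> positive_bop s \<Longrightarrow> \<pi> (cut s) = cut (\<pi> s)"
  by (simp add: cut_def diff one resolvent_image vna_one[OF B] vna_resolvent[OF B])

text \<open>Norm bounds that do not depend on the copy come from the order: \<open>b\<^sup>\<dagger> b\<close> lies below a scalar.\<close>

lemma (in vna_isomorphism) bnorm_image: assumes b: "b \<in> B" shows "bnorm (\<pi> b) \<le> bnorm b"
  unfolding bnorm_def[of "\<pi> b"]
proof (rule onorm_bound)
  fix x
  have bb: "b\<^sup>\<dagger> * b \<in> B" "(bnorm b)\<^sup>2 *\<^sub>r 1 \<in> B" by (intro vna_adj[OF B] vna_mult[OF B] vna_scale[OF B] vna_one[OF B] b)+
  have "\<pi> (b\<^sup>\<dagger> * b) \<preceq> \<pi> ((bnorm b)\<^sup>2 *\<^sub>r 1)"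
    unfolding le_iff[OF bb] by (rule square_le_bnorm)
  then have "(\<pi> b)\<^sup>\<dagger> * \<pi> b \<preceq> (bnorm b)\<^sup>2 *\<^sub>r 1"
    using b by (simp add: mult adj scale one vna_adj[OF B] vna_one[OF B])
  from le_bop_form[OF this, of x] have "(norm (\<pi> b \<rhd> x))\<^sup>2 \<le> (bnorm b * norm x)\<^sup>2"
    unfolding form_scale by (simp add: cinner_adj_right Re_cinner_self power_mult_distrib)
  then show "norm (\<pi> b \<rhd> x) \<le> bnorm b * norm x"
    by (rule power2_le_imp_le) (simp add: bnorm_nonneg)
qed (rule bnorm_nonneg)

locale tracial_free_product =
  fixes B D :: "'h::chilbert_space bop set" and E :: "'h bop \<Rightarrow> 'h bop"
    and \<pi> :: "nat \<Rightarrow> 'h bop \<Rightarrow> 'k::chilbert_space bop" and M :: "'k bop set" and F :: "'k bop \<Rightarrow> 'k bop"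
    and \<tau> :: "'h bop \<Rightarrow> complex"
  assumes B_vna: "von_neumann_algebra B" and D_vna: "von_neumann_algebra D" and D_B: "D \<subseteq> B"
    and E_expectation: "conditional_expectation B D E" and E_normal: "normal_map B D E"
    and \<tau>_state: "state_on D \<tau>" and \<tau>_normal: "normal_functional D \<tau>" and \<tau>_faithful: "faithful_on D \<tau>"
    and \<tau>_trace: "tracial_on D \<tau>" and \<tau>E_trace: "tracial_on B (\<tau> \<circ> E)"
    and free: "amalgamated_free_product B D E \<pi> M F"
begin

lemma base: "tracial_expectation B D E \<tau>"
proof
  fix a l assume a: "\<And>n. a n \<in> D" "\<And>n. positive_bop (a n)" "\<And>n. a n \<preceq> 1" "strong_limit a l"
  have "l \<in> D" by (rule vna_strong_limit[OF D_vna a(1,4)])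
  moreover have "norm (a n \<rhd> x) \<le> 1 * norm x" for n x using contraction_norm[OF a(2,3)] by simp
  ultimately show "l \<in> D \<and> (\<lambda>n. \<tau> (a n)) \<longlonglongrightarrow> \<tau> l"
    using normal_functional_limit[OF \<tau>_normal a(1) _ a(4)] by blast
qed (use B_vna D_B E_expectation E_normal \<tau>_state \<tau>_faithful \<tau>_trace in
    \<open>auto intro: vna_one[OF D_vna] vna_add[OF D_vna] vna_mult[OF D_vna] vna_scale[OF D_vna] vna_adj[OF D_vna] vna_cut[OF D_vna]\<close>)

lemmas E_in = tracial_expectation.F_in[OF base] and E_add = tracial_expectation.F_add[OF base]
  and E_diff = tracial_expectation.F_diff[OF base] and E_id = tracial_expectation.F_id[OF base]
  and E_left = tracial_expectation.F_left[OF base] and E_right = tracial_expectation.F_right[OF base]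
  and E_adj = tracial_expectation.F_adj[OF base] and E_zero = tracial_expectation.F_zero[OF base]
  and E_scale = tracial_expectation.F_scale[OF base]

lemmas B_rules = vna_adj[OF B_vna] vna_zero[OF B_vna] vna_one[OF B_vna] vna_add[OF B_vna] vna_diff[OF B_vna]
  vna_minus[OF B_vna] vna_scale[OF B_vna] vna_mult[OF B_vna]

lemmas Dh_rules = vna_adj[OF D_vna] vna_zero[OF D_vna] vna_one[OF D_vna] vna_add[OF D_vna] vna_diff[OF D_vna]
  vna_minus[OF D_vna] vna_scale[OF D_vna] vna_mult[OF D_vna]

lemma DB: "d \<in> D \<Longrightarrow> d \<in> B" using D_B by blast

lemma M_vna: "von_neumann_algebra M"
  and \<pi>_vna: "von_neumann_algebra (\<pi> i ` B)"
  and \<pi>_iso: "star_isomorphism B (\<pi> i ` B) (\<pi> i)"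
  and \<pi>_D: "d \<in> D \<Longrightarrow> \<pi> i d = \<pi> j d"
  and M_hull: "M = von_neumann_algebra hull (\<Union>i. \<pi> i ` B)"
  and F_expectation: "conditional_expectation M (\<pi> 0 ` D) F"
  and F_normal': "normal_map M (\<pi> 0 ` D) F"
  and F_gns: "faithful_gns M F"
  and F_\<pi>: "b \<in> B \<Longrightarrow> F (\<pi> i b) = \<pi> i (E b)"
  and F_word: "w \<noteq> [] \<Longrightarrow> (\<forall>(i, b)\<in>set w. b \<in> B \<and> E b = 0) \<Longrightarrow> distinct_adj (map fst w) \<Longrightarrow>
        F (prod_list (map (\<lambda>(i, b). \<pi> i b) w)) = 0"
  using free unfolding amalgamated_free_product_def by blast+

lemma copy: "vna_isomorphism B (\<pi> i ` B) (\<pi> i)"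
  by (intro vna_isomorphism.intro B_vna \<pi>_vna \<pi>_iso)

lemmas \<pi>_add = vna_isomorphism.add[OF copy] and \<pi>_mult = vna_isomorphism.mult[OF copy]
  and \<pi>_adj = vna_isomorphism.adj[OF copy] and \<pi>_diff = vna_isomorphism.diff[OF copy]
  and \<pi>_scale = vna_isomorphism.scale[OF copy] and \<pi>_one = vna_isomorphism.one[OF copy]
  and \<pi>_zero = vna_isomorphism.zero[OF copy] and \<pi>_inject = vna_isomorphism.inject[OF copy]

lemma \<pi>_M: "b \<in> B \<Longrightarrow> \<pi> i b \<in> M"
  unfolding M_hull using hull_subset[of "\<Union>i. \<pi> i ` B" von_neumann_algebra] by blast

text \<open>The trace \<open>\<tau>\<close>, moved to the common subalgebra of \<open>M\<close>.\<close>

definition t :: "'k bop \<Rightarrow> complex" where "t x = \<tau> (inv_into D (\<pi> 0) x)"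

lemma t_\<pi>: assumes "d \<in> D" shows "t (\<pi> i d) = \<tau> d"
proof -
  have "inj_on (\<pi> 0) D" using \<pi>_inject DB by (metis inj_onI)
  then show ?thesis unfolding t_def \<pi>_D[OF assms, of i 0] using assms by simp
qed

text \<open>Normality of \<open>\<tau>\<close> refers to the Hilbert space on which \<open>B\<close> acts. It reaches \<open>t\<close> through the order:
  an increasing sequence of the common subalgebra is pulled back to \<open>D\<close>, where it has a limit that \<open>\<tau>\<close>
  respects, and this limit is carried to the limit in \<open>M\<close>.\<close>

sublocale main: tracial_expectation M "\<pi> 0 ` D" F t
proof
  show "von_neumann_algebra M" "conditional_expectation M (\<pi> 0 ` D) F" "normal_map M (\<pi> 0 ` D) F"
    by (fact M_vna F_expectation F_normal')+
  show "\<pi> 0 ` D \<subseteq> M" using \<pi>_M DB by blast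
  show "1 \<in> \<pi> 0 ` D" using \<pi>_one[of 0] Dh_rules by (metis imageI)
  show "x + y \<in> \<pi> 0 ` D" "x * y \<in> \<pi> 0 ` D" if "x \<in> \<pi> 0 ` D" "y \<in> \<pi> 0 ` D" for x y
    using that by (auto simp: DB Dh_rules simp flip: \<pi>_add \<pi>_mult)
  show "scaleC_bop c x \<in> \<pi> 0 ` D" "x\<^sup>\<dagger> \<in> \<pi> 0 ` D" if "x \<in> \<pi> 0 ` D" for c x
    using that by (auto simp: DB Dh_rules simp flip: \<pi>_scale \<pi>_adj)
  show "cut s \<in> \<pi> 0 ` D" if s': "s \<in> \<pi> 0 ` D" and s: "positive_bop s" for s
  proof -
    obtain d where d: "d \<in> D" "s = \<pi> 0 d" using s' by blast
    have pd: "positive_bop d" using s d DB by (simp add: vna_isomorphism.positive_iff[OF copy])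
    have "cut s = \<pi> 0 (cut d)" using d pd DB by (simp add: vna_isomorphism.cut_image[OF copy])
    then show ?thesis using vna_cut[OF D_vna pd d(1)] by simp
  qed
  show "l \<in> \<pi> 0 ` D \<and> (\<lambda>n. t (a n)) \<longlonglongrightarrow> t l"
    if a: "\<And>n. a n \<in> \<pi> 0 ` D" "\<And>n. positive_bop (a n)" "\<And>n. a n \<preceq> 1" "\<And>n. a n \<preceq> a (Suc n)"
      and l: "strong_limit a l" for a l
  proof -
    have "\<forall>n. \<exists>d\<in>D. a n = \<pi> 0 d" using a(1) by blast
    then obtain d where d: "\<And>n. d n \<in> D" "\<And>n. a n = \<pi> 0 (d n)" by metis
    have dB: "d n \<in> B" for n using d DB by blast
    have pd: "positive_bop (d n)" and ld: "d n \<preceq> 1" and id: "d n \<preceq> d (Suc n)" for n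
      using a(2,3,4)[of n] dB by (simp_all add: d(2) vna_isomorphism.positive_iff[OF copy]
          vna_isomorphism.le_iff[OF copy] B_rules flip: \<pi>_one[of 0])
    obtain k where k: "strong_limit d k" using monotone_strong_limit[of d] pd ld id by blast
    have kD: "k \<in> D" by (rule vna_strong_limit[OF D_vna d(1) k])
    have "strong_limit (\<lambda>n. \<pi> 0 (d n)) (\<pi> 0 k)"
      using vna_isomorphism.strong_limit_iff[OF copy, of d k 0] dB pd ld id DB[OF kD] k by blast
    moreover have "a = (\<lambda>n. \<pi> 0 (d n))" using d(2) by (rule ext)
    ultimately have "l = \<pi> 0 k" using l strong_limit_unique by blast
    moreover have "(\<lambda>n. \<tau> (d n)) \<longlonglongrightarrow> \<tau> k"
      using tracial_expectation.D_limit[OF base d(1) pd ld id k] by blast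
    ultimately show ?thesis using d kD by (simp add: t_\<pi>)
  qed
  show "state_on (\<pi> 0 ` D) t" unfolding state_on_def
  proof (intro conjI ballI allI impI)
    show "t (x + y) = t x + t y" if "x \<in> \<pi> 0 ` D" "y \<in> \<pi> 0 ` D" for x y
      using that by (auto simp: DB Dh_rules t_\<pi> tracial_expectation.t_add[OF base] simp flip: \<pi>_add)
    show "t (scaleC_bop c x) = c * t x" if "x \<in> \<pi> 0 ` D" for c x
      using that by (auto simp: DB Dh_rules t_\<pi> tracial_expectation.t_scale[OF base] simp flip: \<pi>_scale)
    show "t x \<in> \<real>\<^sub>\<ge>\<^sub>0" if "x \<in> \<pi> 0 ` D" "positive_bop x" for x
      using that by (auto simp: DB t_\<pi> vna_isomorphism.positive_iff[OF copy] tracial_expectation.t_positive[OF base])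
    show "t 1 = 1"
      using t_\<pi>[of 1 0] by (simp add: \<pi>_one Dh_rules tracial_expectation.t_one[OF base])
  qed
  show "faithful_on (\<pi> 0 ` D) t" unfolding faithful_on_def
  proof (intro ballI impI)
    fix x assume "x \<in> \<pi> 0 ` D" and tx: "t (x\<^sup>\<dagger> * x) = 0"
    then obtain d where d: "d \<in> D" "x = \<pi> 0 d" by blast
    have "x\<^sup>\<dagger> * x = \<pi> 0 (d\<^sup>\<dagger> * d)" using d by (simp add: \<pi>_mult \<pi>_adj DB B_rules)
    then have "\<tau> (d\<^sup>\<dagger> * d) = 0" using tx d by (simp add: t_\<pi> Dh_rules)
    then show "x = 0" using \<tau>_faithful d by (auto simp: faithful_on_def \<pi>_zero)
  qed
  show "tracial_on (\<pi> 0 ` D) t" unfolding tracial_on_def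
  proof (intro ballI)
    fix x y assume "x \<in> \<pi> 0 ` D" "y \<in> \<pi> 0 ` D"
    then obtain d e where d: "d \<in> D" "x = \<pi> 0 d" "e \<in> D" "y = \<pi> 0 e" by blast
    then show "t (x * y) = t (y * x)"
      using \<tau>_trace by (simp add: DB Dh_rules t_\<pi> tracial_on_def flip: \<pi>_mult)
  qed
qed

definition reduced_word :: "nat set \<Rightarrow> (nat \<times> 'h bop) list \<Rightarrow> bool" where
  "reduced_word I w \<longleftrightarrow> (\<forall>(i, b)\<in>set w. i \<in> I \<and> b \<in> B \<and> E b = 0) \<and> distinct_adj (map fst w)"

definition val :: "(nat \<times> 'h bop) list \<Rightarrow> 'k bop" where
  "val w = prod_list (map (\<lambda>(i, b). \<pi> i b) w)"

text \<open>Sums of nonempty reduced words with letters from the copies in \<open>I\<close>. Scalars, signs and elements of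
  the common subalgebra can be absorbed into letters.\<close>

inductive_set centered :: "nat set \<Rightarrow> 'k bop set" for I where
  zero: "0 \<in> centered I"
| step: "v \<in> centered I \<Longrightarrow> reduced_word I w \<Longrightarrow> w \<noteq> [] \<Longrightarrow> v + val w \<in> centered I"

text \<open>The algebra generated by the copies in \<open>I\<close>.\<close>

definition word_algebra :: "nat set \<Rightarrow> 'k bop set" where
  "word_algebra I = {\<pi> 0 d + v | d v. d \<in> D \<and> v \<in> centered I}"

lemma val_simps [simp]: "val [] = 1" "val ((i, b) # w) = \<pi> i b * val w" "val (u @ w) = val u * val w"
  by (simp_all add: val_def)

lemma reduced_Nil [simp]: "reduced_word I []"
  by (simp add: reduced_word_def)

lemma reduced_Cons:
  "reduced_word I ((i, b) # w) \<longleftrightarrow> i \<in> I \<and> b \<in> B \<and> E b = 0 \<and> reduced_word I w \<and> (w \<noteq> [] \<longrightarrow> i \<noteq> fst (hd w))"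
  by (cases w) (auto simp: reduced_word_def)

lemma reduced_append:
  "reduced_word I (u @ w) \<longleftrightarrow> reduced_word I u \<and> reduced_word I w \<and> (u \<noteq> [] \<longrightarrow> w \<noteq> [] \<longrightarrow> fst (last u) \<noteq> fst (hd w))"
  by (auto simp: reduced_word_def distinct_adj_append_iff last_map hd_map)

lemma reduced_mono: "reduced_word I w \<Longrightarrow> I \<subseteq> J \<Longrightarrow> reduced_word J w"
  by (auto simp: reduced_word_def)

lemma reduced_index: "reduced_word I w \<Longrightarrow> w \<noteq> [] \<Longrightarrow> fst (hd w) \<in> I \<and> fst (last w) \<in> I"
  using hd_in_set[of w] last_in_set[of w] by (auto simp: reduced_word_def split_beta)

lemma val_M: "reduced_word I w \<Longrightarrow> val w \<in> M"
  by (induction w) (auto simp: reduced_Cons main.M_rules \<pi>_M)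

lemma F_val: "reduced_word I w \<Longrightarrow> w \<noteq> [] \<Longrightarrow> F (val w) = 0"
  using F_word[of w] by (auto simp: reduced_word_def val_def)

lemma centered_val: "reduced_word I w \<Longrightarrow> w \<noteq> [] \<Longrightarrow> val w \<in> centered I"
  using centered.step[OF centered.zero] by fastforce

text \<open>Additive properties of words extend to sums of words; the target \<open>S\<close> is any set closed under sums.\<close>

lemma centered_image:
  assumes v: "v \<in> centered I" and L: "L 0 = 0" "\<And>u v. L (u + v) = L u + L v"
    and S: "0 \<in> S" "\<And>u v. u \<in> S \<Longrightarrow> v \<in> S \<Longrightarrow> u + v \<in> S"
    and w: "\<And>w. reduced_word I w \<Longrightarrow> w \<noteq> [] \<Longrightarrow> L (val w) \<in> S"
  shows "L v \<in> S"
  using v by induction (auto simp: L intro: S w)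

lemma centered_add: assumes "u \<in> centered I" "v \<in> centered I" shows "u + v \<in> centered I"
  using assms(2) by induction (auto simp: assms(1) intro: centered.step simp flip: add.assoc)

lemmas centered_closed = centered.zero centered_add

lemma centered_mono: "v \<in> centered I \<Longrightarrow> I \<subseteq> J \<Longrightarrow> v \<in> centered J"
  by (rule centered_image[of v I "\<lambda>v. v"]) (auto intro: centered_closed centered_val reduced_mono)

lemma centered_M: "v \<in> centered I \<Longrightarrow> v \<in> M"
  by (rule centered_image[of v I "\<lambda>v. v"]) (auto intro: main.M_rules val_M)

lemma F_centered: "v \<in> centered I \<Longrightarrow> F v = 0"
  by (induction rule: centered.induct) (auto simp: main.F_zero main.F_add centered_M val_M F_val)

lemma centered_left: assumes d: "d \<in> D" and v: "v \<in> centered I" shows "\<pi> 0 d * v \<in> centered I"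
proof (rule centered_image[OF v])
  fix w assume w: "reduced_word I w" "w \<noteq> []"
  then obtain i b u where ibu: "w = (i, b) # u" by (cases w) auto
  have "reduced_word I ((i, d * b) # u)"
    using w d by (auto simp: ibu reduced_Cons B_rules DB E_left)
  moreover have "\<pi> 0 d * val w = val ((i, d * b) # u)"
    using w d by (simp add: ibu reduced_Cons \<pi>_D[OF d, of 0 i] \<pi>_mult DB mult.assoc)
  ultimately show "\<pi> 0 d * val w \<in> centered I" using centered_val[of I "(i, d * b) # u"] by simp
qed (auto simp: distrib_left intro: centered_closed)

lemma adj_val:
  assumes "reduced_word I w"
  obtains u where "reduced_word I u" "(val w)\<^sup>\<dagger> = val u" "length u = length w"
proof -
  define u where "u = rev (map (\<lambda>(i, b). (i, b\<^sup>\<dagger>)) w)"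
  have "map fst u = rev (map fst w)" by (simp add: u_def rev_map comp_def split_beta)
  moreover have "\<forall>(i, b)\<in>set u. i \<in> I \<and> b \<in> B \<and> E b = 0"
    using assms by (auto simp: u_def reduced_word_def B_rules E_adj)
  ultimately have "reduced_word I u" using assms by (simp add: reduced_word_def)
  moreover have "(val w)\<^sup>\<dagger> = val u"
    unfolding u_def using assms by (induction w) (auto simp: reduced_Cons adj_mult \<pi>_adj)
  ultimately show ?thesis using that by (simp add: u_def)
qed

lemma centered_adj: "v \<in> centered I \<Longrightarrow> v\<^sup>\<dagger> \<in> centered I"
proof (rule centered_image[of v I adj])
  fix w assume "reduced_word I w" "w \<noteq> []"
  then show "(val w)\<^sup>\<dagger> \<in> centered I" by (metis adj_val centered_val length_0_conv)
qed (auto simp: adj_add intro: centered_closed)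

lemma word_algebraI: "d \<in> D \<Longrightarrow> v \<in> centered I \<Longrightarrow> \<pi> 0 d + v \<in> word_algebra I"
  by (auto simp: word_algebra_def)

lemma word_algebra_centered: "v \<in> centered I \<Longrightarrow> v \<in> word_algebra I"
  using word_algebraI[of 0 v I] by (simp add: Dh_rules \<pi>_zero)

lemma word_algebra_D: "d \<in> D \<Longrightarrow> \<pi> 0 d \<in> word_algebra I"
  using word_algebraI[of d 0 I] by (simp add: centered.zero)

lemma word_algebra_add: "x \<in> word_algebra I \<Longrightarrow> y \<in> word_algebra I \<Longrightarrow> x + y \<in> word_algebra I"
proof -
  assume "x \<in> word_algebra I" "y \<in> word_algebra I"
  then obtain d u e v where *: "x = \<pi> 0 d + u" "y = \<pi> 0 e + v" "d \<in> D" "e \<in> D" "u \<in> centered I" "v \<in> centered I"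
    by (auto simp: word_algebra_def)
  have eq: "x + y = \<pi> 0 (d + e) + (u + v)" using * by (simp add: \<pi>_add DB algebra_simps)
  show ?thesis unfolding eq by (intro word_algebraI Dh_rules centered_add *)
qed

lemma word_algebra_zero: "0 \<in> word_algebra I"
  using word_algebra_centered centered.zero by blast

lemma word_algebra_left_D: "d \<in> D \<Longrightarrow> x \<in> word_algebra I \<Longrightarrow> \<pi> 0 d * x \<in> word_algebra I"
proof -
  assume d: "d \<in> D" and "x \<in> word_algebra I"
  then obtain e v where *: "x = \<pi> 0 e + v" "e \<in> D" "v \<in> centered I" by (auto simp: word_algebra_def)
  have eq: "\<pi> 0 d * x = \<pi> 0 (d * e) + \<pi> 0 d * v" using * d by (simp add: \<pi>_mult DB distrib_left)
  show ?thesis unfolding eq by (intro word_algebraI Dh_rules centered_left d *)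
qed

text \<open>The reduction rule of the free product: a letter from the copy of the first letter of a reduced word
  merges with it, and the merged letter splits into its expectation and a centered letter.\<close>

lemma merge_letter:
  assumes b: "b \<in> B" and w: "reduced_word I ((i, c) # u)"
  obtains e c' where "e \<in> D" "reduced_word I ((i, c') # u)"
    "\<pi> i b * val ((i, c) # u) = \<pi> 0 e * val u + val ((i, c') # u)"
proof -
  define e where "e = E (b * c)"
  have c: "c \<in> B" using w by (auto simp: reduced_Cons)
  have e: "e \<in> D" unfolding e_def by (intro E_in B_rules b c)
  have bc: "b * c \<in> B" "b * c - e \<in> B" using b c e by (auto simp: B_rules DB)
  have "\<pi> i b * val ((i, c) # u) = \<pi> 0 e * val u + val ((i, b * c - e) # u)"
    using b c bc e by (simp add: \<pi>_diff \<pi>_mult DB algebra_simps \<pi>_D[OF e, of 0 i])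
  moreover have "reduced_word I ((i, b * c - e) # u)"
    using w bc e b c by (simp add: reduced_Cons E_diff DB E_id) (simp add: e_def)
  ultimately show ?thesis using that e by blast
qed

lemma letter_word:
  assumes i: "i \<in> I" and b: "b \<in> B" "E b = 0" and w: "reduced_word I w"
  shows "\<pi> i b * val w \<in> word_algebra I"
proof (cases "w = [] \<or> fst (hd w) \<noteq> i")
  case True
  then have "reduced_word I ((i, b) # w)" using i b w by (auto simp: reduced_Cons)
  then show ?thesis using word_algebra_centered[OF centered_val] by fastforce
next
  case False
  then obtain c u where w': "w = (i, c) # u" by (cases w) auto
  then obtain e c' where e: "e \<in> D" "reduced_word I ((i, c') # u)"
    "\<pi> i b * val w = \<pi> 0 e * val u + val ((i, c') # u)"
    using merge_letter[OF b(1)] w by metis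
  have "\<pi> 0 e * val u \<in> word_algebra I"
    using e(1) w centered_val[of I u] word_algebra_D word_algebra_centered centered_left
    by (cases "u = []") (auto simp: w' reduced_Cons)
  moreover have "val ((i, c') # u) \<in> word_algebra I"
    by (rule word_algebra_centered[OF centered_val[OF e(2)]]) simp
  ultimately show ?thesis unfolding e(3) by (rule word_algebra_add)
qed

lemma word_algebra_left:
  assumes i: "i \<in> I" and b: "b \<in> B" and x: "x \<in> word_algebra I"
  shows "\<pi> i b * x \<in> word_algebra I"
proof -
  define c where "c = b - E b"
  have E: "E b \<in> D" "E b \<in> B" using b E_in DB by auto
  have c: "c \<in> B" "E c = 0" using b E by (auto simp: c_def B_rules E_diff E_id)
  obtain d v where x': "x = \<pi> 0 d + v" "d \<in> D" "v \<in> centered I" using x by (auto simp: word_algebra_def)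
  have "\<pi> i c * v \<in> word_algebra I"
    by (rule centered_image[OF x'(3)])
       (auto simp: distrib_left intro: word_algebra_zero word_algebra_add letter_word i c)
  moreover have "\<pi> i c * \<pi> 0 d \<in> word_algebra I"
    using letter_word[of i I "c * d" "[]"] i c x' by (simp add: \<pi>_D[OF x'(2), of 0 i] \<pi>_mult DB B_rules E_right)
  moreover have "\<pi> i b = \<pi> 0 (E b) + \<pi> i c"
    using b E by (simp add: c_def \<pi>_diff \<pi>_D[OF E(1), of 0 i])
  then have eq: "\<pi> i b * x = \<pi> 0 (E b) * x + (\<pi> i c * \<pi> 0 d + \<pi> i c * v)"
    by (simp add: x'(1) distrib_left distrib_right)
  ultimately show ?thesis
    unfolding eq by (intro word_algebra_add word_algebra_left_D[OF E(1) x])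
qed

lemma word_algebra_mult: "x \<in> word_algebra I \<Longrightarrow> y \<in> word_algebra I \<Longrightarrow> x * y \<in> word_algebra I"
proof -
  assume x: "x \<in> word_algebra I" and y: "y \<in> word_algebra I"
  obtain d v where x': "x = \<pi> 0 d + v" "d \<in> D" "v \<in> centered I" using x by (auto simp: word_algebra_def)
  have "val w * y \<in> word_algebra I" if "reduced_word I w" for w
    using that by (induction w) (auto simp: reduced_Cons mult.assoc intro: word_algebra_left y)
  then have "v * y \<in> word_algebra I"
    by (intro centered_image[OF x'(3), of "\<lambda>v. v * y"]) (auto simp: distrib_right intro: word_algebra_zero word_algebra_add)
  then show ?thesis
    unfolding x'(1) distrib_right by (intro word_algebra_add word_algebra_left_D x' y)
qed

lemma word_algebra_M: "x \<in> word_algebra I \<Longrightarrow> x \<in> M"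
  by (auto simp: word_algebra_def intro: centered_M intro!: vna_add[OF M_vna] \<pi>_M DB)

lemma word_algebra_adj: "x \<in> word_algebra I \<Longrightarrow> x\<^sup>\<dagger> \<in> word_algebra I"
proof -
  assume "x \<in> word_algebra I"
  then obtain d v where *: "x = \<pi> 0 d + v" "d \<in> D" "v \<in> centered I" by (auto simp: word_algebra_def)
  have eq: "x\<^sup>\<dagger> = \<pi> 0 (d\<^sup>\<dagger>) + v\<^sup>\<dagger>" using * by (simp add: adj_add \<pi>_adj DB)
  show ?thesis unfolding eq by (intro word_algebraI Dh_rules centered_adj *)
qed

lemma word_algebra_one: "1 \<in> word_algebra I"
  using word_algebra_D[of 1 I] by (simp add: Dh_rules \<pi>_one)

lemma word_algebra_minus_F: "x \<in> word_algebra I \<Longrightarrow> x - F x \<in> centered I"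
proof -
  assume "x \<in> word_algebra I"
  then obtain d v where *: "x = \<pi> 0 d + v" "d \<in> D" "v \<in> centered I" by (auto simp: word_algebra_def)
  have "F x = \<pi> 0 d"
    using * centered_M[OF *(3)] by (simp add: main.F_add \<pi>_M DB F_\<pi> E_id F_centered)
  then show ?thesis using * by simp
qed

lemma word_algebra_star: "unital_star_algebra (word_algebra UNIV)"
proof
  show "scaleC_bop c x \<in> word_algebra UNIV" if "x \<in> word_algebra UNIV" for c x
  proof -
    have "\<pi> 0 (scaleC_bop c 1) * x \<in> word_algebra UNIV" using that by (intro word_algebra_left_D Dh_rules)
    then show ?thesis by (simp add: \<pi>_scale B_rules \<pi>_one scaleC_bop_mult)
  qed
qed (auto intro: word_algebra_one word_algebra_add word_algebra_mult word_algebra_adj)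

lemma word_algebra_letter: "b \<in> B \<Longrightarrow> \<pi> i b \<in> word_algebra UNIV"
  using word_algebra_left[OF UNIV_I _ word_algebra_one, of b i] by simp

lemma M_bicommutant: "M = commutant (commutant (word_algebra UNIV))"
proof
  have "von_neumann_algebra (commutant (commutant (word_algebra UNIV)))"
    by (rule von_neumann_algebra_bicommutant[OF word_algebra_adj])
  moreover have "(\<Union>i. \<pi> i ` B) \<subseteq> commutant (commutant (word_algebra UNIV))"
    using word_algebra_letter subset_bicommutant by blast
  ultimately show "M \<subseteq> commutant (commutant (word_algebra UNIV))"
    unfolding M_hull by (rule hull_minimal[rotated])
  have "commutant (commutant (word_algebra UNIV)) \<subseteq> commutant (commutant M)"
    using word_algebra_M by (intro commutant_antimono) auto
  then show "commutant (commutant (word_algebra UNIV)) \<subseteq> M"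
    using M_vna by (simp add: von_neumann_algebra_def)
qed

text \<open>A finite sum of words uses finitely many copies. This is what makes a fresh copy available.\<close>

lemma centered_finite_index: "v \<in> centered UNIV \<Longrightarrow> \<exists>N. v \<in> centered {..<N::nat}"
proof (induction rule: centered.induct)
  case zero
  then show ?case using centered.zero by blast
next
  case (step v w)
  obtain N where N: "v \<in> centered {..<N}" using step.IH by blast
  define K where "K = Max (insert N (Suc ` fst ` set w))"
  have "N \<le> K" by (simp add: K_def)
  moreover have "fst a < K" if "a \<in> set w" for a
  proof -
    have "Suc (fst a) \<le> K" unfolding K_def using that by (intro Max_ge) auto
    then show ?thesis by simp
  qed
  then have "reduced_word {..<K} w" using step.hyps(2) by (auto simp: reduced_word_def)
  ultimately show ?case
    using centered.step[OF centered_mono[OF N, of "{..<K}"] _ step.hyps(3)] by auto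
qed

lemma word_algebra_finite_index:
  assumes "x \<in> word_algebra UNIV" obtains N :: nat where "x \<in> word_algebra {..<N}"
proof -
  obtain d v where x: "x = \<pi> 0 d + v" "d \<in> D" "v \<in> centered UNIV" using assms by (auto simp: word_algebra_def)
  then obtain N where "v \<in> centered {..<N::nat}" using centered_finite_index by blast
  then show ?thesis using that x word_algebraI by blast
qed

subsection \<open>The trace on words\<close>

lemma \<phi>_commute_D: assumes d: "d \<in> D" and x: "x \<in> M" shows "main.\<phi> (\<pi> 0 d * x) = main.\<phi> (x * \<pi> 0 d)"
  using main.t_trace[unfolded tracial_on_def, rule_format, OF imageI[OF d] main.F_in[OF x]] d x
  by (simp add: main.\<phi>_def main.F_left main.F_right)

text \<open>Merging a letter into a word with at least two letters leaves at least one letter.\<close>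

lemma F_letter_word:
  assumes b: "b \<in> B" "E b = 0" and w: "reduced_word UNIV w" "length w \<ge> 2"
  shows "F (\<pi> j b * val w) = 0"
proof (cases "fst (hd w) = j")
  case False
  then have "reduced_word UNIV ((j, b) # w)" using b w(1) by (auto simp: reduced_Cons)
  from F_val[OF this] show ?thesis by simp
next
  case True
  then obtain c u where w': "w = (j, c) # u" "u \<noteq> []" using w(2) by (cases w; cases "tl w") auto
  then obtain e c' where e: "e \<in> D" "reduced_word UNIV ((j, c') # u)"
    "\<pi> j b * val w = \<pi> 0 e * val u + val ((j, c') # u)"
    using merge_letter[OF b(1)] w by metis
  have u: "reduced_word UNIV u" using w(1) by (auto simp: w' reduced_Cons)
  have "F (\<pi> j b * val w) = F (\<pi> 0 e * val u) + F (val ((j, c') # u))"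
    unfolding e(3) using val_M[OF e(2)] val_M[OF u] \<pi>_M[OF DB[OF e(1)]] by (simp only: main.F_add main.M_rules)
  then show ?thesis
    using F_val[OF e(2)] F_val[OF u w'(2)] main.F_left[of "\<pi> 0 e" "val u"] e(1) val_M[OF u] by simp
qed

lemma F_word_letter:
  assumes b: "b \<in> B" "E b = 0" and w: "reduced_word UNIV w" "length w \<ge> 2"
  shows "F (val w * \<pi> j b) = 0"
proof -
  obtain u where u: "reduced_word UNIV u" "(val w)\<^sup>\<dagger> = val u" "length u = length w" by (rule adj_val[OF w(1)])
  have "F ((val w * \<pi> j b)\<^sup>\<dagger>) = 0"
    using F_letter_word[of "b\<^sup>\<dagger>" u j] b u w by (simp add: adj_mult B_rules E_adj flip: \<pi>_adj)
  then have "(F (val w * \<pi> j b))\<^sup>\<dagger> = 0"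
    using main.F_adj[of "val w * \<pi> j b"] b val_M[OF w(1)] by (simp add: main.M_rules \<pi>_M)
  then show ?thesis by (metis adj_adj adj_simps(1))
qed

text \<open>Both sides vanish, except when \<open>w\<close> is a single letter of the same copy, and then the trace property
  of \<open>\<tau> \<circ> E\<close> applies.\<close>

lemma \<phi>_commute_letter_word:
  assumes b: "b \<in> B" "E b = 0" and w: "reduced_word UNIV w"
  shows "main.\<phi> (\<pi> j b * val w) = main.\<phi> (val w * \<pi> j b)"
proof (cases "length w \<ge> 2")
  case True
  then show ?thesis using F_letter_word[OF b w] F_word_letter[OF b w] by (simp add: main.\<phi>_def)
next
  case False
  then consider "w = []" | i c where "w = [(i, c)]"
    by (cases w; cases "tl w") auto
  then show ?thesis
  proof cases
    case (2 i c)
    have c: "c \<in> B" "E c = 0" using w by (auto simp: 2 reduced_Cons)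
    show ?thesis
    proof (cases "i = j")
      case True
      have "\<tau> (E (b * c)) = \<tau> (E (c * b))" using \<tau>E_trace b c by (simp add: tracial_on_def)
      then show ?thesis using b c
        by (simp add: 2 True main.\<phi>_def F_\<pi> B_rules E_in t_\<pi> flip: \<pi>_mult)
    next
      case False
      then have "reduced_word UNIV [(j, b), (i, c)]" "reduced_word UNIV [(i, c), (j, b)]"
        using b c by (auto simp: reduced_Cons)
      from this[THEN F_val] show ?thesis by (simp add: 2 main.\<phi>_def)
    qed
  qed simp
qed

lemma \<phi>_commute_letter:
  assumes b: "b \<in> B" and y: "y \<in> word_algebra UNIV"
  shows "main.\<phi> (\<pi> j b * y) = main.\<phi> (y * \<pi> j b)"
proof -
  define c where "c = b - E b"
  have E: "E b \<in> D" "E b \<in> B" using b E_in DB by auto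
  have c: "c \<in> B" "E c = 0" using b E by (auto simp: c_def B_rules E_diff E_id)
  obtain d v where y': "y = \<pi> 0 d + v" "d \<in> D" "v \<in> centered UNIV" using y by (auto simp: word_algebra_def)
  have M: "\<pi> j c \<in> M" "v \<in> M" "\<pi> 0 d \<in> M" "\<pi> 0 (E b) \<in> M" "y \<in> M"
    using c y' E y by (auto intro: \<pi>_M DB centered_M word_algebra_M)
  have "v \<in> {v \<in> M. main.\<phi> (\<pi> j c * v) = main.\<phi> (v * \<pi> j c)}"
    by (rule centered_image[OF y'(3), of "\<lambda>v. v"])
       (auto simp: main.M_rules main.\<phi>_zero distrib_left distrib_right main.\<phi>_add M val_M \<phi>_commute_letter_word c)
  then have "main.\<phi> (\<pi> j c * y) = main.\<phi> (y * \<pi> j c)"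
    using \<phi>_commute_D[OF y'(2) M(1)] M
    by (simp add: y'(1) distrib_left distrib_right main.\<phi>_add main.M_rules)
  moreover have "\<pi> j b = \<pi> 0 (E b) + \<pi> j c"
    using b E by (simp add: c_def \<pi>_diff \<pi>_D[OF E(1), of 0 j])
  ultimately show ?thesis
    using \<phi>_commute_D[OF E(1) M(5)] M by (simp add: distrib_left distrib_right main.\<phi>_add main.M_rules)
qed

text \<open>Moving a word around cyclically, one letter at a time.\<close>

lemma \<phi>_trace_words:
  assumes x: "x \<in> word_algebra UNIV" and y: "y \<in> word_algebra UNIV"
  shows "main.\<phi> (x * y) = main.\<phi> (y * x)"
proof -
  obtain d v where x': "x = \<pi> 0 d + v" "d \<in> D" "v \<in> centered UNIV" using x by (auto simp: word_algebra_def)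
  have word: "main.\<phi> (val w * y) = main.\<phi> (y * val w)" if "reduced_word UNIV w" "y \<in> word_algebra UNIV" for w y
    using that
  proof (induction w arbitrary: y)
    case (Cons a w)
    obtain i b where a: "a = (i, b)" by (cases a)
    have b: "b \<in> B" "reduced_word UNIV w" using Cons.prems by (auto simp: a reduced_Cons)
    have w: "val w \<in> word_algebra UNIV"
      using b(2) word_algebra_one word_algebra_centered centered_val by (cases "w = []") auto
    have "main.\<phi> (val (a # w) * y) = main.\<phi> (\<pi> i b * (val w * y))" by (simp add: a mult.assoc)
    also have "\<dots> = main.\<phi> (val w * (y * \<pi> i b))"
      using \<phi>_commute_letter[OF b(1) word_algebra_mult[OF w Cons.prems(2)], of i] by (simp add: mult.assoc)
    also have "\<dots> = main.\<phi> (y * \<pi> i b * val w)"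
      by (intro Cons.IH b word_algebra_mult Cons.prems word_algebra_letter)
    finally show ?case by (simp add: a mult.assoc)
  qed simp
  have M: "y \<in> M" "\<pi> 0 d \<in> M" "v \<in> M" using x' y by (auto intro: \<pi>_M DB centered_M word_algebra_M)
  have "v \<in> {v \<in> M. main.\<phi> (v * y) = main.\<phi> (y * v)}"
    by (rule centered_image[OF x'(3), of "\<lambda>v. v"])
       (auto simp: main.M_rules main.\<phi>_zero distrib_left distrib_right main.\<phi>_add M val_M word y)
  then show ?thesis using \<phi>_commute_D[OF x'(2) M(1)] M
    by (simp add: x'(1) distrib_left distrib_right main.\<phi>_add main.M_rules)
qed

sublocale main: tracial_dense_star_algebra M "\<pi> 0 ` D" F t "word_algebra UNIV"
proof (intro tracial_dense_star_algebra.intro dense_star_algebra.intro main.tracial_expectation_axioms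
    word_algebra_star dense_star_algebra_axioms.intro tracial_dense_star_algebra_axioms.intro
    M_bicommutant \<phi>_trace_words F_gns)
  show "\<pi> 0 ` D \<subseteq> word_algebra UNIV" using word_algebra_D by blast
qed

end

section \<open>Central elements\<close>

context tracial_free_product
begin

text \<open>Letters of a copy outside \<open>I\<close> separate words with letters in \<open>I\<close>, so all the concatenations are reduced.\<close>

lemma F_separated_words:
  assumes I: "u \<in> centered I" "v \<in> centered I" and j: "j \<notin> I"
    and b: "b \<in> B" "E b = 0" and c: "c \<in> B" "E c = 0"
  shows "F (\<pi> j b * u * \<pi> j c) = 0" "F (u * \<pi> j b * v * \<pi> j c) = 0"
proof -
  have M: "u \<in> M" "v \<in> M" "\<pi> j b \<in> M" "\<pi> j c \<in> M" using I b c by (auto intro: centered_M \<pi>_M)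
  have lift: "F (x * z * y) = 0"
    if z: "z \<in> centered I" and x: "x \<in> M" and y: "y \<in> M"
      and w: "\<And>w. reduced_word I w \<Longrightarrow> w \<noteq> [] \<Longrightarrow> F (x * val w * y) = 0" for x y z
  proof -
    have "z \<in> {z \<in> M. F (x * z * y) = 0}"
      by (rule centered_image[OF z, of "\<lambda>z. z"])
         (auto simp: distrib_left distrib_right main.F_add main.M_rules main.F_zero val_M x y w)
    then show ?thesis by simp
  qed
  have idx: "fst (hd w) \<noteq> j \<and> fst (last w) \<noteq> j" if "reduced_word I w" "w \<noteq> []" for w
    using reduced_index[OF that] j by auto
  have r: "reduced_word UNIV w" if "reduced_word I w" for w using reduced_mono[OF that] by simp
  have single: "reduced_word UNIV [(j, b)]" "reduced_word UNIV [(j, c)]" using b c by (auto simp: reduced_Cons)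
  have bwc: "F (\<pi> j b * val w * \<pi> j c) = 0" if w: "reduced_word I w" "w \<noteq> []" for w
  proof -
    have "reduced_word UNIV ((j, b) # w @ [(j, c)])"
      using r[OF w(1)] w(2) idx[OF w] single b by (auto simp: reduced_Cons reduced_append)
    from F_val[OF this] show ?thesis by (simp add: mult.assoc)
  qed
  show "F (\<pi> j b * u * \<pi> j c) = 0" by (rule lift[OF I(1) M(3,4) bwc])
  have wbwc: "F (val w * \<pi> j b * val w' * \<pi> j c) = 0"
    if w: "reduced_word I w" "w \<noteq> []" and w': "reduced_word I w'" "w' \<noteq> []" for w w'
  proof -
    have "reduced_word UNIV (w @ (j, b) # w' @ [(j, c)])"
      using r[OF w(1)] r[OF w'(1)] w(2) w'(2) idx[OF w] idx[OF w'] single b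
      by (auto simp: reduced_Cons reduced_append)
    from F_val[OF this] show ?thesis by (simp add: mult.assoc)
  qed
  have "F (val w * \<pi> j b * v * \<pi> j c) = 0" if w: "reduced_word I w" "w \<noteq> []" for w
    by (rule lift[OF I(2) _ M(4) wbwc[OF w]]) (intro main.M_rules val_M[OF w(1)] M)
  then have "F (1 * u * (\<pi> j b * v * \<pi> j c)) = 0"
    by (intro lift[OF I(1)]) (auto intro: main.M_rules M simp: mult.assoc)
  then show "F (u * \<pi> j b * v * \<pi> j c) = 0" by (simp add: mult.assoc)
qed

text \<open>For a letter \<open>\<beta>\<close> in a copy that does not occur in \<open>y\<close>, the two halves of the commutator
  \<open>y \<beta> - \<beta> y\<close> consist of orthogonal words, so the commutator is at least as large as \<open>(y - F y) \<beta>\<close>.\<close>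

lemma commutator_lower_bound:
  assumes y: "y \<in> word_algebra I" and j: "j \<notin> I" and b: "b \<in> B" "E b = 0"
  shows "main.norm2 ((y - F y) * \<pi> j b) \<le> main.norm2 (y * \<pi> j b - \<pi> j b * y)"
proof -
  define \<beta> where "\<beta> = \<pi> j b"
  define y0 where "y0 = y - F y"
  have y0: "y0 \<in> centered I" unfolding y0_def by (rule word_algebra_minus_F[OF y])
  have yM: "y \<in> M" by (rule word_algebra_M[OF y])
  obtain d where d: "d \<in> D" "F y = \<pi> 0 d" using main.F_in[OF yM] by blast
  define c where "c = d * b - b * d"
  have c: "c \<in> B" "E c = 0" using b d by (auto simp: c_def B_rules DB E_diff E_left E_right)
  define s where "s = \<pi> j c - \<beta> * y0"
  have M: "\<beta> \<in> M" "y0 \<in> M" "\<pi> j c \<in> M" "s \<in> M"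
    using b c centered_M[OF y0] by (auto simp: \<beta>_def s_def \<pi>_M main.M_rules)
  have "\<pi> j c = F y * \<beta> - \<beta> * F y"
    using b d by (simp add: c_def \<beta>_def \<pi>_diff \<pi>_mult B_rules DB \<pi>_D[OF d(1), of 0 j])
  then have split: "y * \<beta> - \<beta> * y = y0 * \<beta> + s" by (simp add: s_def y0_def algebra_simps)
  have adj: "y0\<^sup>\<dagger> \<in> centered I" "\<beta>\<^sup>\<dagger> = \<pi> j (b\<^sup>\<dagger>)" "b\<^sup>\<dagger> \<in> B" "E (b\<^sup>\<dagger>) = 0"
    using b by (auto simp: \<beta>_def \<pi>_adj B_rules E_adj centered_adj[OF y0])
  have "main.\<phi> ((y0 * \<beta>)\<^sup>\<dagger> * s) = main.\<phi> (\<beta>\<^sup>\<dagger> * y0\<^sup>\<dagger> * \<pi> j c) - main.\<phi> (\<beta>\<^sup>\<dagger> * y0\<^sup>\<dagger> * \<beta> * y0)"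
    by (simp add: s_def adj_mult right_diff_distrib main.\<phi>_diff main.M_rules M mult.assoc)
  also have "main.\<phi> (\<beta>\<^sup>\<dagger> * y0\<^sup>\<dagger> * \<beta> * y0) = main.\<phi> (y0 * \<beta>\<^sup>\<dagger> * y0\<^sup>\<dagger> * \<beta>)"
    using main.\<phi>_trace[of "\<beta>\<^sup>\<dagger> * y0\<^sup>\<dagger> * \<beta>" y0] by (simp add: main.M_rules M mult.assoc)
  also have "\<dots> = 0"
    using F_separated_words(2)[OF y0 adj(1) j adj(3,4) b] main.\<phi>_zero
    unfolding adj(2) unfolding \<beta>_def by (simp add: main.\<phi>_def main.F_zero)
  also have "main.\<phi> (\<beta>\<^sup>\<dagger> * y0\<^sup>\<dagger> * \<pi> j c) = 0"
    using F_separated_words(1)[OF adj(1) centered.zero j adj(3,4) c] main.\<phi>_zero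
    unfolding adj(2) by (simp add: main.\<phi>_def main.F_zero)
  finally have "main.\<phi> ((y0 * \<beta>)\<^sup>\<dagger> * s) = 0" by simp
  then have cross: "main.\<phi> ((y0 * \<beta>)\<^sup>\<dagger> * s) = 0" "main.\<phi> (s\<^sup>\<dagger> * (y0 * \<beta>)) = 0"
    using main.\<phi>_adj[of "(y0 * \<beta>)\<^sup>\<dagger> * s"] by (simp_all add: main.M_rules M adj_mult)
  have "(y0 * \<beta> + s)\<^sup>\<dagger> * (y0 * \<beta> + s) = (y0 * \<beta>)\<^sup>\<dagger> * (y0 * \<beta>) + (y0 * \<beta>)\<^sup>\<dagger> * s + s\<^sup>\<dagger> * (y0 * \<beta>) + s\<^sup>\<dagger> * s"
    unfolding adj_add by (simp only: distrib_left distrib_right add.assoc) (simp add: ac_simps)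
  moreover have "(y0 * \<beta>)\<^sup>\<dagger> * (y0 * \<beta>) \<in> M" "(y0 * \<beta>)\<^sup>\<dagger> * s \<in> M" "s\<^sup>\<dagger> * (y0 * \<beta>) \<in> M" "s\<^sup>\<dagger> * s \<in> M"
    by (intro main.M_rules M)+
  ultimately have "main.\<phi> ((y0 * \<beta> + s)\<^sup>\<dagger> * (y0 * \<beta> + s)) = main.\<phi> ((y0 * \<beta>)\<^sup>\<dagger> * (y0 * \<beta>)) + main.\<phi> (s\<^sup>\<dagger> * s)"
    by (simp add: main.\<phi>_add vna_add[OF M_vna] cross)
  then have "main.norm2 (y0 * \<beta>) \<le> main.norm2 (y0 * \<beta> + s)"
    using main.\<phi>_square(2)[OF M(4)] by (simp add: main.norm2_def)
  then show ?thesis unfolding y0_def[symmetric] \<beta>_def[symmetric] split .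
qed

text \<open>As \<open>a\<close> belongs to the common subalgebra, the value is computed inside one copy.\<close>

lemma \<phi>_letter_form:
  assumes b: "b \<in> B" and a: "a \<in> \<pi> 0 ` D"
  shows "main.\<phi> ((\<pi> i b)\<^sup>\<dagger> * a * \<pi> i b) = main.\<phi> ((\<pi> j b)\<^sup>\<dagger> * a * \<pi> j b)"
proof -
  obtain d where d: "d \<in> D" "a = \<pi> 0 d" using a by blast
  have "main.\<phi> ((\<pi> k b)\<^sup>\<dagger> * a * \<pi> k b) = \<tau> (E (b\<^sup>\<dagger> * d * b))" for k
  proof -
    have "(\<pi> k b)\<^sup>\<dagger> * a * \<pi> k b = \<pi> k (b\<^sup>\<dagger> * d * b)"
      using b d by (simp add: \<pi>_mult \<pi>_adj B_rules DB \<pi>_D[OF d(1), of 0 k])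
    then show ?thesis using b d by (simp add: main.\<phi>_def F_\<pi> t_\<pi> E_in B_rules DB)
  qed
  then show ?thesis by simp
qed

text \<open>Seen from a fresh copy, \<open>y0\<^sup>\<dagger> y0\<close> has the same effect as its expectation.\<close>

lemma \<phi>_separated_form:
  assumes y0: "y0 \<in> centered I" and j: "j \<notin> I" and b: "b \<in> B" "E b = 0"
  shows "main.\<phi> ((\<pi> j b)\<^sup>\<dagger> * F (y0\<^sup>\<dagger> * y0) * \<pi> j b) = main.\<phi> ((y0 * \<pi> j b)\<^sup>\<dagger> * (y0 * \<pi> j b))"
proof -
  let ?s = "y0\<^sup>\<dagger> * y0"
  have s: "?s \<in> word_algebra I"
    by (intro word_algebra_mult word_algebra_adj word_algebra_centered y0)
  have M: "?s \<in> M" "F ?s \<in> M" "\<pi> j b \<in> M" "(\<pi> j b)\<^sup>\<dagger> \<in> M"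
    using word_algebra_M[OF s] main.D_M[OF main.F_in] b by (auto intro: \<pi>_M main.M_rules)
  have "F ((\<pi> j b)\<^sup>\<dagger> * (?s - F ?s) * \<pi> j b) = 0"
    using F_separated_words(1)[OF word_algebra_minus_F[OF s] centered.zero j, of "b\<^sup>\<dagger>" b] b
    by (simp add: \<pi>_adj B_rules E_adj)
  then have "main.\<phi> ((\<pi> j b)\<^sup>\<dagger> * (?s - F ?s) * \<pi> j b) = 0"
    using main.\<phi>_zero by (simp add: main.\<phi>_def main.F_zero)
  moreover have "(\<pi> j b)\<^sup>\<dagger> * (?s - F ?s) * \<pi> j b = (\<pi> j b)\<^sup>\<dagger> * ?s * \<pi> j b - (\<pi> j b)\<^sup>\<dagger> * F ?s * \<pi> j b"
    by (simp only: right_diff_distrib left_diff_distrib)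
  moreover have "(\<pi> j b)\<^sup>\<dagger> * ?s * \<pi> j b \<in> M" "(\<pi> j b)\<^sup>\<dagger> * F ?s * \<pi> j b \<in> M"
    by (intro vna_mult[OF M_vna] M)+
  ultimately show ?thesis by (simp add: main.\<phi>_diff adj_mult mult.assoc)
qed

text \<open>Approximate \<open>x\<close> by \<open>y\<close> in finitely many copies, and let \<open>\<gamma>\<close> be the copy of the letter in a fresh one. As
  \<open>x\<close> commutes with \<open>\<gamma>\<close>, the commutator of \<open>y\<close> with \<open>\<gamma>\<close> is small, hence so is \<open>(y - F y) \<gamma>\<close>. The size of the latter
  depends on \<open>\<gamma>\<close> only through \<open>F ((y - F y)\<^sup>\<dagger> (y - F y))\<close>, an element of the common subalgebra, so that the
  fresh copy can be replaced by any fixed one before passing to the limit in \<open>y\<close>.\<close>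

lemma central_defect_annihilates_letters:
  assumes x: "x \<in> center M" and b: "b \<in> B" "E b = 0"
  shows "F ((x - F x)\<^sup>\<dagger> * (x - F x)) * \<pi> i b = 0"
proof -
  define z where "z = x - F x"
  define a where "a = F (z\<^sup>\<dagger> * z)"
  define \<beta> where "\<beta> = \<pi> i b"
  define e where "e = F (\<beta> * \<beta>\<^sup>\<dagger>)"
  define K where "K = bnorm (e\<^sup>\<dagger>)"
  define C where "C = bnorm b + bnorm (b\<^sup>\<dagger>)"
  have xM: "x \<in> M" and comm: "\<And>m. m \<in> M \<Longrightarrow> x * m = m * x"
    using x by (auto simp: center_def commutant_def)
  have Fx: "F x \<in> M" using main.D_M[OF main.F_in[OF xM]] .
  have M: "z \<in> M" "\<beta> \<in> M" "z\<^sup>\<dagger> * z \<in> M" "\<beta> * \<beta>\<^sup>\<dagger> \<in> M"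
    using xM Fx b by (auto simp: z_def \<beta>_def \<pi>_M main.M_rules)
  have aD: "a \<in> \<pi> 0 ` D" "positive_bop a" unfolding a_def by (intro main.F_in main.F_positive positive_square M)+
  have eD: "e \<in> \<pi> 0 ` D" unfolding e_def by (intro main.F_in M)
  have aM: "a \<in> M" "e \<in> M" using aD eD main.D_M by auto
  have K: "K \<ge> 0" and C: "C \<ge> 0" by (auto simp: K_def C_def bnorm_nonneg)
  \<comment> \<open>The form in \<open>\<beta>\<close> is the functional of a fixed element \<open>e\<close> of the common subalgebra, so it is continuous
    for the trace norm.\<close>
  have form_e: "main.\<phi> (\<beta>\<^sup>\<dagger> * F s * \<beta>) = main.\<phi> (s * e)" if s: "s \<in> M" for s
  proof -
    have FsM: "F s \<in> M" "F s \<in> \<pi> 0 ` D" using main.F_in[OF s] main.D_M by auto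
    have "main.\<phi> (\<beta>\<^sup>\<dagger> * F s * \<beta>) = main.\<phi> (F s * (\<beta> * \<beta>\<^sup>\<dagger>))"
      using main.\<phi>_trace[of "\<beta>\<^sup>\<dagger>" "F s * \<beta>"] FsM M by (simp add: main.M_rules mult.assoc)
    also have "\<dots> = t (F s * e)" by (simp add: main.\<phi>_def main.F_left FsM M e_def)
    also have "\<dots> = main.\<phi> (s * e)" using s eD by (simp add: main.\<phi>_def main.F_right)
    finally show ?thesis .
  qed
  have "Re (main.\<phi> (\<beta>\<^sup>\<dagger> * a * \<beta>)) \<le> 0"
  proof (rule main.norm2_smallI[OF xM])
    fix y assume y: "y \<in> word_algebra UNIV" and small: "main.norm2 (x - y) < 1"
    define \<epsilon> where "\<epsilon> = main.norm2 (x - y)"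
    have yM: "y \<in> M" by (rule word_algebra_M[OF y])
    have uM: "x - y \<in> M" by (intro main.M_rules xM yM)
    have \<epsilon>: "0 \<le> \<epsilon>" "\<epsilon> < 1" using small main.norm2_nonneg[OF uM] by (auto simp: \<epsilon>_def)
    obtain N :: nat where N: "y \<in> word_algebra {..<N}" by (rule word_algebra_finite_index[OF y])
    define y0 where "y0 = y - F y"
    have y0: "y0 \<in> centered {..<N}" unfolding y0_def by (rule word_algebra_minus_F[OF N])
    have y0M: "y0 \<in> M" by (rule centered_M[OF y0])
    define \<gamma> where "\<gamma> = \<pi> N b"
    have \<gamma>M: "\<gamma> \<in> M" using b by (simp add: \<gamma>_def \<pi>_M)
    have \<gamma>_norm: "bnorm \<gamma> \<le> bnorm b" "bnorm (\<gamma>\<^sup>\<dagger>) \<le> bnorm (b\<^sup>\<dagger>)"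
      using b vna_isomorphism.bnorm_image[OF copy, of b N] vna_isomorphism.bnorm_image[OF copy, of "b\<^sup>\<dagger>" N]
      by (auto simp: \<gamma>_def B_rules simp flip: \<pi>_adj)
    have "y * \<gamma> - \<gamma> * y = \<gamma> * (x - y) + - ((x - y) * \<gamma>)"
      using comm[OF \<gamma>M] by (simp add: algebra_simps)
    then have "main.norm2 (y * \<gamma> - \<gamma> * y) \<le> main.norm2 (\<gamma> * (x - y)) + main.norm2 (- ((x - y) * \<gamma>))"
      by (simp only:) (intro main.norm2_triangle main.M_rules uM \<gamma>M)
    also have "\<dots> \<le> bnorm \<gamma> * \<epsilon> + bnorm (\<gamma>\<^sup>\<dagger>) * \<epsilon>"
      using main.norm2_mult_left[OF \<gamma>M uM] main.norm2_mult_right[OF uM \<gamma>M] by (simp add: main.norm2_minus \<epsilon>_def)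
    also have "\<dots> \<le> C * \<epsilon>"
      unfolding C_def distrib_right by (intro add_mono mult_right_mono \<gamma>_norm \<epsilon>)
    finally have "main.norm2 (y0 * \<gamma>) \<le> C * \<epsilon>"
      using commutator_lower_bound[OF N _ b, of N] by (simp add: y0_def \<gamma>_def)
    then have "(main.norm2 (y0 * \<gamma>))\<^sup>2 \<le> (C * \<epsilon>)\<^sup>2"
      by (rule power_mono) (intro main.norm2_nonneg main.M_rules y0M \<gamma>M)
    moreover have "main.\<phi> (\<beta>\<^sup>\<dagger> * F (y0\<^sup>\<dagger> * y0) * \<beta>) = main.\<phi> ((y0 * \<gamma>)\<^sup>\<dagger> * (y0 * \<gamma>))"
      unfolding \<beta>_def \<gamma>_def
      using \<phi>_letter_form[OF b(1), of "F (y0\<^sup>\<dagger> * y0)" i N] \<phi>_separated_form[OF y0 _ b, of N] main.F_in[of "y0\<^sup>\<dagger> * y0"]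
      by (simp add: main.M_rules y0M)
    ultimately have 1: "Re (main.\<phi> (\<beta>\<^sup>\<dagger> * F (y0\<^sup>\<dagger> * y0) * \<beta>)) \<le> (C * \<epsilon>)\<^sup>2"
      by (simp add: main.norm2_square main.M_rules y0M \<gamma>M)
    have "z - y0 = (x - y) - F (x - y)" by (simp add: z_def y0_def main.F_diff xM yM)
    then have zy: "main.norm2 (z - y0) \<le> \<epsilon>" using main.norm2_minus_F[OF uM] by (simp add: \<epsilon>_def)
    have zyM: "z - y0 \<in> M" by (intro main.M_rules M y0M)
    have "main.norm2 y0 = main.norm2 (z + - (z - y0))" by simp
    also have "\<dots> \<le> main.norm2 z + main.norm2 (- (z - y0))" by (intro main.norm2_triangle main.M_rules M y0M)
    finally have y0_norm: "main.norm2 y0 \<le> main.norm2 z + 1" using zy \<epsilon> main.norm2_minus[of "z - y0"] by linarith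
    have "main.\<phi> (\<beta>\<^sup>\<dagger> * a * \<beta>) - main.\<phi> (\<beta>\<^sup>\<dagger> * F (y0\<^sup>\<dagger> * y0) * \<beta>) = main.\<phi> (z\<^sup>\<dagger> * z * e) - main.\<phi> (y0\<^sup>\<dagger> * y0 * e)"
      using form_e[OF M(3)] form_e[of "y0\<^sup>\<dagger> * y0"] by (simp add: a_def main.M_rules y0M)
    also have "\<dots> = main.\<phi> (z\<^sup>\<dagger> * ((z - y0) * e)) + main.\<phi> ((z - y0)\<^sup>\<dagger> * (y0 * e))"
      by (simp add: adj_diff left_diff_distrib right_diff_distrib main.\<phi>_diff main.M_rules M y0M aM mult.assoc)
    finally have eq: "main.\<phi> (\<beta>\<^sup>\<dagger> * a * \<beta>) = main.\<phi> (\<beta>\<^sup>\<dagger> * F (y0\<^sup>\<dagger> * y0) * \<beta>)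
        + (main.\<phi> (z\<^sup>\<dagger> * ((z - y0) * e)) + main.\<phi> ((z - y0)\<^sup>\<dagger> * (y0 * e)))" by (simp add: algebra_simps)
    have "cmod (main.\<phi> (z\<^sup>\<dagger> * ((z - y0) * e))) \<le> main.norm2 z * main.norm2 ((z - y0) * e)"
      by (intro main.norm2_cauchy_schwarz main.M_rules M y0M aM)
    also have "\<dots> \<le> main.norm2 z * (K * \<epsilon>)"
    proof (intro mult_left_mono main.norm2_nonneg M)
      have "main.norm2 ((z - y0) * e) \<le> K * main.norm2 (z - y0)" unfolding K_def by (rule main.norm2_mult_right[OF zyM aM(2)])
      also have "\<dots> \<le> K * \<epsilon>" by (intro mult_left_mono zy K)
      finally show "main.norm2 ((z - y0) * e) \<le> K * \<epsilon>" .
    qed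
    finally have 2: "Re (main.\<phi> (z\<^sup>\<dagger> * ((z - y0) * e))) \<le> main.norm2 z * (K * \<epsilon>)"
      using complex_Re_le_cmod order_trans by blast
    have "cmod (main.\<phi> ((z - y0)\<^sup>\<dagger> * (y0 * e))) \<le> main.norm2 (z - y0) * main.norm2 (y0 * e)"
      by (intro main.norm2_cauchy_schwarz main.M_rules M y0M aM)
    also have "\<dots> \<le> \<epsilon> * (K * (main.norm2 z + 1))"
    proof (intro mult_mono zy \<epsilon> main.norm2_nonneg)
      have "main.norm2 (y0 * e) \<le> K * main.norm2 y0" unfolding K_def by (rule main.norm2_mult_right[OF y0M aM(2)])
      also have "\<dots> \<le> K * (main.norm2 z + 1)" by (intro mult_left_mono y0_norm K)
      finally show "main.norm2 (y0 * e) \<le> K * (main.norm2 z + 1)" .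
    qed (intro main.M_rules y0M aM)
    finally have 3: "Re (main.\<phi> ((z - y0)\<^sup>\<dagger> * (y0 * e))) \<le> \<epsilon> * (K * (main.norm2 z + 1))"
      using complex_Re_le_cmod order_trans by blast
    \<comment> \<open>As \<open>\<epsilon> < 1\<close>, all errors are bounded linearly in \<open>\<epsilon>\<close>.\<close>
    have "\<epsilon> * \<epsilon> \<le> \<epsilon>" using \<epsilon> by (simp add: mult_left_le)
    then have "C\<^sup>2 * (\<epsilon> * \<epsilon>) \<le> C\<^sup>2 * \<epsilon>" by (rule mult_left_mono) simp
    then have "(C * \<epsilon>)\<^sup>2 \<le> C\<^sup>2 * \<epsilon>"
      by (simp add: power_mult_distrib power2_eq_square[of \<epsilon>])
    then have "Re (main.\<phi> (\<beta>\<^sup>\<dagger> * a * \<beta>)) \<le> C\<^sup>2 * \<epsilon> + (main.norm2 z * (K * \<epsilon>) + \<epsilon> * (K * (main.norm2 z + 1)))"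
      unfolding eq using 1 2 3 by simp
    also have "\<dots> = (C\<^sup>2 + K * (2 * main.norm2 z + 1)) * \<epsilon>" by (simp add: algebra_simps)
    also have "\<dots> \<le> (C\<^sup>2 + K * (2 * main.norm2 z + 1)) * max (main.norm2 (x - y)) (main.norm2 (x\<^sup>\<dagger> - y\<^sup>\<dagger>))"
      using K main.norm2_nonneg[OF M(1)] by (intro mult_left_mono) (auto simp: \<epsilon>_def)
    finally show "Re (main.\<phi> (\<beta>\<^sup>\<dagger> * a * \<beta>)) \<le> (C\<^sup>2 + K * (2 * main.norm2 z + 1)) * max (main.norm2 (x - y)) (main.norm2 (x\<^sup>\<dagger> - y\<^sup>\<dagger>))" .
  next
    show "0 \<le> C\<^sup>2 + K * (2 * main.norm2 z + 1)" using K main.norm2_nonneg[OF M(1)] by simp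
  qed
  moreover have "Re (main.\<phi> ((a * \<beta>)\<^sup>\<dagger> * (a * \<beta>))) \<le> bnorm a * Re (main.\<phi> (\<beta>\<^sup>\<dagger> * a * \<beta>))"
  proof -
    have "a * a \<preceq> bnorm a *\<^sub>r a"
      by (intro square_le_scale le_bop_bnorm positive_selfadjoint aD)
    then have "\<beta>\<^sup>\<dagger> * (a * a) * \<beta> \<preceq> \<beta>\<^sup>\<dagger> * (bnorm a *\<^sub>r a) * \<beta>" by (rule le_bop_conj)
    then have "Re (main.\<phi> (\<beta>\<^sup>\<dagger> * (a * a) * \<beta>)) \<le> Re (main.\<phi> (\<beta>\<^sup>\<dagger> * (bnorm a *\<^sub>r a) * \<beta>))"
      by (intro main.\<phi>_mono main.M_rules M aM)
    then show ?thesis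
      using M aM by (simp add: scaleC_bop_mult main.\<phi>_scale main.M_rules adj_mult positive_selfadjoint[OF aD(2)] mult.assoc)
  qed
  ultimately have "Re (main.\<phi> ((a * \<beta>)\<^sup>\<dagger> * (a * \<beta>))) \<le> 0"
    using mult_nonneg_nonpos[OF bnorm_nonneg[of a]] by (meson order_trans)
  then have "main.norm2 (a * \<beta>) \<le> 0" by (simp add: main.norm2_def)
  then have "a * \<beta> = 0" by (intro main.norm2_faithful main.M_rules aM M)
  then show ?thesis by (simp add: a_def \<beta>_def z_def)
qed

text \<open>With \<open>z = x - F x\<close> and \<open>a = F (z\<^sup>\<dagger> z)\<close>, the element \<open>a\<close> annihilates all centered letters, hence all centered
  words, hence the kernel of \<open>F\<close>, to which \<open>z\<^sup>\<dagger>\<close> belongs. So \<open>a a = F (a z\<^sup>\<dagger> z) = 0\<close>.\<close>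

theorem center_subset: "center M \<subseteq> \<pi> 0 ` D"
proof
  fix x assume x: "x \<in> center M"
  define z where "z = x - F x"
  define a where "a = F (z\<^sup>\<dagger> * z)"
  have xM: "x \<in> M" using x by (simp add: center_def)
  have FxD: "F x \<in> \<pi> 0 ` D" by (rule main.F_in[OF xM])
  have zM: "z \<in> M" "z\<^sup>\<dagger> \<in> M" "z\<^sup>\<dagger> * z \<in> M" using xM main.D_M[OF FxD] by (auto simp: z_def main.M_rules)
  have Fz: "F z = 0" using xM main.D_M[OF FxD] by (simp add: z_def main.F_diff main.F_id FxD)
  have Fza: "F (z\<^sup>\<dagger>) = 0" using main.F_adj[OF zM(1)] Fz by simp
  have aD: "a \<in> \<pi> 0 ` D" "positive_bop a" unfolding a_def by (intro main.F_in main.F_positive positive_square zM)+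
  have aM: "a \<in> M" using main.D_M[OF aD(1)] .
  have letter: "a * \<pi> i b = 0" if "b \<in> B" "E b = 0" for i b
    using central_defect_annihilates_letters[OF x that] by (simp add: a_def z_def)
  have word: "a * v = 0" if "v \<in> centered UNIV" for v
  proof -
    have "a * v \<in> {0}"
    proof (rule centered_image[OF that])
      fix w assume "reduced_word UNIV w" "w \<noteq> []"
      then obtain i b u where "w = (i, b) # u" "b \<in> B" "E b = 0" by (cases w) (auto simp: reduced_Cons)
      then show "a * val w \<in> {0}" using letter[of b i] by (simp flip: mult.assoc)
    qed (auto simp: distrib_left)
    then show ?thesis by simp
  qed
  have kills: "a * m = 0" if m: "m \<in> M" "F m = 0" for m
  proof -
    have "main.norm2 (a * m) \<le> 0"
    proof (rule main.norm2_smallI[OF m(1)])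
      fix y assume y: "y \<in> word_algebra UNIV"
      have yM: "y \<in> M" by (rule word_algebra_M[OF y])
      have uM: "m - y \<in> M" by (intro main.M_rules m yM)
      have "F (m - y) = - F y" using m yM by (simp add: main.F_diff)
      then have "a * m = a * ((m - y) - F (m - y)) + a * (y - F y)"
        by (simp add: algebra_simps)
      then have "a * m = a * ((m - y) - F (m - y))" using word[OF word_algebra_minus_F[OF y]] by simp
      then have "main.norm2 (a * m) \<le> bnorm a * main.norm2 ((m - y) - F (m - y))"
        using main.norm2_mult_left[OF aM, of "(m - y) - F (m - y)"] uM main.D_M[OF main.F_in[OF uM]]
        by (simp add: main.M_rules)
      also have "\<dots> \<le> bnorm a * main.norm2 (m - y)"
        by (intro mult_left_mono main.norm2_minus_F uM bnorm_nonneg)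
      also have "\<dots> \<le> bnorm a * max (main.norm2 (m - y)) (main.norm2 (m\<^sup>\<dagger> - y\<^sup>\<dagger>))"
        by (intro mult_left_mono bnorm_nonneg) simp
      finally show "main.norm2 (a * m) \<le> bnorm a * max (main.norm2 (m - y)) (main.norm2 (m\<^sup>\<dagger> - y\<^sup>\<dagger>))" .
    qed (rule bnorm_nonneg)
    then show ?thesis by (intro main.norm2_faithful main.M_rules aM m)
  qed
  have "a * a = F (a * (z\<^sup>\<dagger> * z))" using main.F_left[OF aD(1) zM(3)] by (simp add: a_def)
  also have "\<dots> = 0" using kills[OF zM(2) Fza] by (simp add: main.F_zero flip: mult.assoc)
  finally have "main.norm2 a \<le> 0"
    by (simp add: main.norm2_def positive_selfadjoint[OF aD(2)] main.\<phi>_zero)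
  then have "a = 0" by (intro main.norm2_faithful aM)
  then have "main.norm2 z \<le> 0"
    using main.\<phi>_zero by (simp add: main.norm2_def main.\<phi>_def main.F_zero flip: a_def)
  then have "z = 0" by (intro main.norm2_faithful zM)
  then show "x \<in> \<pi> 0 ` D" using FxD by (simp add: z_def)
qed

theorem center_eq: "center M = \<pi> i ` (D \<inter> center B)"
proof
  show "center M \<subseteq> \<pi> i ` (D \<inter> center B)"
  proof
    fix x assume x: "x \<in> center M"
    then obtain d where d: "d \<in> D" "x = \<pi> 0 d" using center_subset by blast
    have xi: "x = \<pi> i d" using d \<pi>_D by simp
    have "d * b = b * d" if "b \<in> B" for b
    proof -
      have "\<pi> i (d * b) = \<pi> i (b * d)"
        using x that d \<pi>_M[OF that, of i] by (simp add: \<pi>_mult DB center_def commutant_def flip: xi)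
      then show ?thesis using that d by (simp add: \<pi>_inject B_rules DB)
    qed
    then have "d \<in> center B" using d DB by (simp add: center_def commutant_def)
    then show "x \<in> \<pi> i ` (D \<inter> center B)" using xi d by blast
  qed
  show "\<pi> i ` (D \<inter> center B) \<subseteq> center M"
  proof
    fix x assume "x \<in> \<pi> i ` (D \<inter> center B)"
    then obtain d where d: "d \<in> D" "d \<in> center B" "x = \<pi> i d" by blast
    have gen: "x * \<pi> j b = \<pi> j b * x" if "b \<in> B" for j b
    proof -
      have "d * b = b * d" using d(2) that by (simp add: center_def commutant_def)
      then show ?thesis using that d(1) unfolding d(3) \<pi>_D[OF d(1), of i j]
        by (simp add: DB flip: \<pi>_mult)
    qed
    have "x \<in> commutant (word_algebra UNIV)"
    proof -
      have x0: "x = \<pi> 0 d" using d \<pi>_D by simp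
      have "x * val w = val w * x" if "reduced_word UNIV w" for w
        using that
      proof (induction w)
        case (Cons a w)
        obtain k b where a: "a = (k, b)" by (cases a)
        have b: "b \<in> B" "reduced_word UNIV w" using Cons.prems by (auto simp: a reduced_Cons)
        have "x * val (a # w) = \<pi> k b * (x * val w)" using gen[OF b(1), of k] by (simp add: a flip: mult.assoc)
        also have "\<dots> = val (a # w) * x" using Cons.IH[OF b(2)] by (simp add: a mult.assoc)
        finally show ?case .
      qed simp
      then have "x * v - v * x \<in> {0}" if "v \<in> centered UNIV" for v
        by (intro centered_image[OF that, of "\<lambda>v. x * v - v * x"]) (auto simp: algebra_simps)
      moreover have "x * \<pi> 0 e = \<pi> 0 e * x" if "e \<in> D" for e using gen DB that by blast
      ultimately show ?thesis by (auto simp: commutant_def word_algebra_def distrib_left distrib_right)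
    qed
    then have "x \<in> commutant M"
      using commutant_antimono[OF subset_bicommutant, of "commutant (word_algebra UNIV)"] M_bicommutant
        subset_bicommutant[of "commutant (word_algebra UNIV)"] by auto
    then show "x \<in> center M" using d by (simp add: center_def \<pi>_M DB)
  qed
qed

end

theorem theorem3p3:
  fixes B D :: "'h::chilbert_space bop set"
    and E :: "'h bop \<Rightarrow> 'h bop"
    and \<pi> :: "nat \<Rightarrow> 'h bop \<Rightarrow> 'k::chilbert_space bop"
    and M :: "'k bop set"
    and F :: "'k bop \<Rightarrow> 'k bop"
  assumes "von_neumann_algebra B" and "von_neumann_algebra D" and "D \<subseteq> B"
    and "conditional_expectation B D E" and "normal_map B D E" and "faithful_gns B E"
    and "\<exists>\<tau>. state_on D \<tau> \<and> normal_functional D \<tau> \<and> faithful_on D \<tau> \<and> tracial_on D \<tau> \<and>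
           tracial_on B (\<tau> \<circ> E)"
    and "amalgamated_free_product B D E \<pi> M F"
  shows "\<forall>i. center M \<subseteq> \<pi> i ` D \<and> center M = \<pi> i ` (D \<inter> center B)"
proof -
  obtain \<tau> where "state_on D \<tau>" "normal_functional D \<tau>" "faithful_on D \<tau>" "tracial_on D \<tau>"
    "tracial_on B (\<tau> \<circ> E)" using assms(7) by blast
  then interpret tracial_free_product B D E \<pi> M F \<tau>
    using assms by unfold_locales
  show ?thesis using center_eq by blast
qed

end
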